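(* Let $n\ge 2$ and let $G$ be a connected weighted graph on $[n]$. If $n=4$ and $G$ is the $4$-cycle with uniform weights (the support graph is a $4$-cycle whose four edges have the same weight $c>0$), then the second eigenvalue of $L_G$ on $\mathbb R[\mathfrak S_4]$ has multiplicity $8$. If $G$ is any other connected weighted graph on $[n]$, then the second eigenvalue of $L_G$ on $\mathbb R[\mathfrak S_n]$ has multiplicity equal to $n-1$ times the multiplicity of the second eigenvalue of the graph Laplacian $\mathcal L_G$.
   Context: $[n]=\{1,\dots,n\}$ and $\mathfrak S_n$ is the symmetric group on $[n]$. A weighted graph $G$ on $[n]$ is given by real weights $c_{ij}=c_{ji}\ge 0$ for $i\ne j$, with $c_{ii}=0$; its support graph has edge set $\{ij:i<j,\ c_{ij}>0\}$, and graph-theoretic terms refer to the support graph. The interchange operator is $L_G=\sum_{1\le i<j\le n}c_{ij}(\mathrm{Id}-(i,j))$ acting on the group algebra $\mathbb R[\mathfrak S_n]$ by left multiplication; it is symmetric and positive semidefinite for the inner product making permutations orthonormal. The graph Laplacian $\mathcal L_G$ is the $n\times n$ matrix with $(\mathcal L_G\boldsymbol x)(i)=\sum_{j\ne i}c_{ij}(\boldsymbol x(i)-\boldsymbol x(j))$. For connected $G$ the eigenvalue $0$ is simple for both operators; the second eigenvalue of each operator is its second smallest eigenvalue counted with multiplicity, i.e. its smallest positive eigenvalue. *)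

theory Defs
  imports Complex_Main "HOL-Combinatorics.Permutations" "HOL-Library.Function_Algebras"
begin

text \<open>
  Vectors indexed by a finite set \<open>X\<close> are functions vanishing outside \<open>X\<close>. Giving functions the
  pointwise real vector space structure makes the library notions (\<open>dim\<close>, \<open>span\<close>, \<open>linear\<close>, \dots)
  available for them.
\<close>

instantiation "fun" :: (type, real_vector) real_vector
begin

definition scaleR_fun :: "real \<Rightarrow> ('a \<Rightarrow> 'b) \<Rightarrow> 'a \<Rightarrow> 'b" where
  "scaleR_fun r f = (\<lambda>x. r *\<^sub>R f x)"

instance
  by standard (simp_all add: scaleR_fun_def fun_eq_iff scaleR_add_right scaleR_add_left)

end

definition vectors_on :: "'a set \<Rightarrow> ('a \<Rightarrow> real) set" where
  "vectors_on X = {f. \<forall>x. x \<notin> X \<longrightarrow> f x = 0}"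


section \<open>Eigenvalues of an operator \<open>T\<close> on a subspace \<open>V\<close>\<close>

definition eigenspace_on :: "'v::real_vector set \<Rightarrow> ('v \<Rightarrow> 'v) \<Rightarrow> real \<Rightarrow> 'v set" where
  "eigenspace_on V T \<mu> = {v \<in> V. T v = \<mu> *\<^sub>R v}"

definition eigenvalues_on :: "'v::real_vector set \<Rightarrow> ('v \<Rightarrow> 'v) \<Rightarrow> real set" where
  "eigenvalues_on V T = {\<mu>. \<exists>v \<in> eigenspace_on V T \<mu>. v \<noteq> 0}"

text \<open>
  The operators of interest are symmetric, so geometric and algebraic multiplicities agree.
\<close>

definition eigenvalue_mult :: "'v::real_vector set \<Rightarrow> ('v \<Rightarrow> 'v) \<Rightarrow> real \<Rightarrow> nat" where
  "eigenvalue_mult V T \<mu> = dim (eigenspace_on V T \<mu>)"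

text \<open>
  All eigenvalues in increasing order, each repeated according to its multiplicity
  (\<open>V\<close> is finite-dimensional in every use, so that there are only finitely many eigenvalues).
\<close>

definition eigenvalue_list :: "'v::real_vector set \<Rightarrow> ('v \<Rightarrow> 'v) \<Rightarrow> real list" where
  "eigenvalue_list V T =
     concat (map (\<lambda>\<mu>. replicate (eigenvalue_mult V T \<mu>) \<mu>)
       (sorted_list_of_set (eigenvalues_on V T)))"

definition second_eigenvalue :: "'v::real_vector set \<Rightarrow> ('v \<Rightarrow> 'v) \<Rightarrow> real" where
  "second_eigenvalue V T = eigenvalue_list V T ! 1"

definition second_eigenvalue_mult :: "'v::real_vector set \<Rightarrow> ('v \<Rightarrow> 'v) \<Rightarrow> nat" where
  "second_eigenvalue_mult V T = eigenvalue_mult V T (second_eigenvalue V T)"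


section \<open>Weighted graphs on \<open>{1..n}\<close>\<close>

text \<open>Values of \<open>c\<close> outside \<open>{1..n} \<times> {1..n}\<close> are irrelevant.\<close>

definition weighted_graph :: "nat \<Rightarrow> (nat \<Rightarrow> nat \<Rightarrow> real) \<Rightarrow> bool" where
  "weighted_graph n c \<longleftrightarrow>
     (\<forall>i\<in>{1..n}. \<forall>j\<in>{1..n}. c i j = c j i \<and> 0 \<le> c i j) \<and> (\<forall>i\<in>{1..n}. c i i = 0)"

definition support_edges :: "nat \<Rightarrow> (nat \<Rightarrow> nat \<Rightarrow> real) \<Rightarrow> nat set set" where
  "support_edges n c = {{i, j} | i j. 1 \<le> i \<and> i < j \<and> j \<le> n \<and> 0 < c i j}"

definition connected_graph :: "nat \<Rightarrow> (nat \<Rightarrow> nat \<Rightarrow> real) \<Rightarrow> bool" where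
  "connected_graph n c \<longleftrightarrow>
     (\<forall>i\<in>{1..n}. \<forall>j\<in>{1..n}. (i, j) \<in> {(u, v). {u, v} \<in> support_edges n c}\<^sup>*)"

definition uniform_four_cycle :: "nat \<Rightarrow> (nat \<Rightarrow> nat \<Rightarrow> real) \<Rightarrow> bool" where
  "uniform_four_cycle n c \<longleftrightarrow> n = 4 \<and>
     (\<exists>p q r s. distinct [p, q, r, s] \<and>
        support_edges n c = {{p, q}, {q, r}, {r, s}, {s, p}}) \<and>
     (\<exists>w>0. \<forall>i\<in>{1..n}. \<forall>j\<in>{1..n}. {i, j} \<in> support_edges n c \<longrightarrow> c i j = w)"

definition graph_laplacian :: "nat \<Rightarrow> (nat \<Rightarrow> nat \<Rightarrow> real) \<Rightarrow> (nat \<Rightarrow> real) \<Rightarrow> nat \<Rightarrow> real" where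
  "graph_laplacian n c x =
     (\<lambda>i. if i \<in> {1..n} then \<Sum>j\<in>{1..n} - {i}. c i j * (x i - x j) else 0)"


section \<open>The real group algebra of the symmetric group on \<open>{1..n}\<close>\<close>

abbreviation sym_group :: "nat \<Rightarrow> (nat \<Rightarrow> nat) set" where
  "sym_group n \<equiv> {\<sigma>. \<sigma> permutes {1..n}}"

abbreviation group_algebra :: "nat \<Rightarrow> ((nat \<Rightarrow> nat) \<Rightarrow> real) set" where
  "group_algebra n \<equiv> vectors_on (sym_group n)"

definition perm_vector :: "(nat \<Rightarrow> nat) \<Rightarrow> (nat \<Rightarrow> nat) \<Rightarrow> real" where
  "perm_vector \<sigma> = (\<lambda>\<rho>. if \<rho> = \<sigma> then 1 else 0)"

text \<open>
  Bilinear extension of composition, characterised by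
  \<open>ga_mult n (perm_vector \<sigma>) (perm_vector \<tau>) = perm_vector (\<sigma> \<circ> \<tau>)\<close>.
\<close>

definition ga_mult ::
  "nat \<Rightarrow> ((nat \<Rightarrow> nat) \<Rightarrow> real) \<Rightarrow> ((nat \<Rightarrow> nat) \<Rightarrow> real) \<Rightarrow> (nat \<Rightarrow> nat) \<Rightarrow> real" where
  "ga_mult n f g = (\<lambda>\<rho>. \<Sum>\<sigma>\<in>sym_group n. f \<sigma> * g (inv \<sigma> \<circ> \<rho>))"

definition interchange_element ::
  "nat \<Rightarrow> (nat \<Rightarrow> nat \<Rightarrow> real) \<Rightarrow> (nat \<Rightarrow> nat) \<Rightarrow> real" where
  "interchange_element n c =
     (\<Sum>i=1..n. \<Sum>j=Suc i..n. c i j *\<^sub>R (perm_vector id - perm_vector (Transposition.transpose i j)))"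

definition interchange_operator ::
  "nat \<Rightarrow> (nat \<Rightarrow> nat \<Rightarrow> real) \<Rightarrow> ((nat \<Rightarrow> nat) \<Rightarrow> real) \<Rightarrow> (nat \<Rightarrow> nat) \<Rightarrow> real" where
  "interchange_operator n c f = ga_mult n (interchange_element n c) f"

end

theory Submission
  imports Defs
begin

text \<open>
  The gap \<open>\<lambda>\<close> of the graph Laplacian is compared with the interchange operator by induction on the
  vertex set, following Caputo, Liggett and Richthammer: eliminating a vertex \<open>v\<close> replaces its star by
  weights \<open>c v i * c v j / C\<close> with \<open>C = sum (c v)\<close>, which does not decrease the Laplacian gap, and the
  octopus inequality says that it does not increase the interchange form. On the cosets \<open>\<sigma> k = v\<close> the
  induction hypothesis applies to functions of mean zero.

  With \<open>c v\<close> set to \<open>- C\<close>, so that the weights sum to zero, the octopus inequality says that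
  \<open>S = \<Sum>i j. c i * c j * (i j)\<close> is positive semidefinite. With \<open>q = \<Sum>i. (c i)\<^sup>2\<close>, the operator
  \<open>2 * q * S - S * S\<close> is a combination of positive semidefinite elements of the group algebras of
  the four-point subsets, and a five-point inequality between these elements shows that the negative
  weight at \<open>v\<close> does no harm.

  The functions \<open>\<Sum>k. x k (\<sigma> k)\<close> with all \<open>x k\<close> in the gap eigenspace of the Laplacian account for
  \<open>n - 1\<close> times its multiplicity. A further eigenfunction for \<open>\<lambda>\<close> may be taken orthogonal to all
  additive functions, that is, with vanishing marginals. Equality in the induction makes it
  additive on every coset of every \<open>v\<close>, hence annihilated by \<open>(1 - (a b)) * (1 - (c d))\<close> for disjoint
  pairs and by the alternating sum over three points; from five points on this makes it additive, so
  it vanishes. On three points the sign function is excluded by the trace, and on four points only the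
  uniform cycle survives, where a two-dimensional space of such functions remains.
\<close>

section \<open>Sums over permutations\<close>

text \<open>The positive semidefinite four-point elements are multiples of the projections onto the
  two-dimensional irreducible of the symmetric group on four points. The same irreducible produces
  the exceptional case: on it complementary transpositions agree, so the six weights on four points
  enter only through three sums over complementary pairs, and for the uniform cycle its smaller
  eigenvalue meets the Laplacian gap.

  The exception also obstructs the induction for equality: eliminating a vertex of a graph on five
  points can produce a uniform cycle, for which additivity fails. In that situation the elimination
  raises the gap strictly, so equality is impossible for a nonzero function, and the induction
  hypothesis is needed for the other reductions only.

  Since vertices are deleted, everything is proved for arbitrary finite sets, and with a fixed lower
  bound \<mu> of the gap in place of the gap itself, which may grow under deletion.\<close>

abbreviation Sym :: "'a set \<Rightarrow> ('a \<Rightarrow> 'a) set" where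
  "Sym V \<equiv> {\<sigma>. \<sigma> permutes V}"

abbreviation swp :: "'a \<Rightarrow> 'a \<Rightarrow> 'a \<Rightarrow> 'a" where
  "swp \<equiv> Transposition.transpose"

definition ip :: "'a set \<Rightarrow> ('a \<Rightarrow> real) \<Rightarrow> ('a \<Rightarrow> real) \<Rightarrow> real" where
  "ip X f g = (\<Sum>x\<in>X. f x * g x)"

text \<open>The matrix coefficient of \<open>f\<close> under left translation. At \<open>id\<close>
  it is the squared norm, and the quadratic form of any group algebra element is a linear
  combination of its values.\<close>

definition corr :: "'a set \<Rightarrow> (('a \<Rightarrow> 'a) \<Rightarrow> real) \<Rightarrow> ('a \<Rightarrow> 'a) \<Rightarrow> real" where
  "corr V f \<tau> = (\<Sum>\<sigma>\<in>Sym V. f \<sigma> * f (\<tau> \<circ> \<sigma>))"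

text \<open>A double transposition only for distinct arguments; for arbitrary ones it is a general
  product of two transpositions, which is the form in which the terms of \<open>S * S\<close>
  appear.\<close>

definition dbl :: "'a \<Rightarrow> 'a \<Rightarrow> 'a \<Rightarrow> 'a \<Rightarrow> 'a \<Rightarrow> 'a" where
  "dbl a b c d = swp a b \<circ> swp c d"

text \<open>For distinct arguments, the 3-cycle sending \<open>a\<close> to \<open>b\<close> to \<open>c\<close> to \<open>a\<close>.\<close>

definition cyc :: "'a \<Rightarrow> 'a \<Rightarrow> 'a \<Rightarrow> 'a \<Rightarrow> 'a" where
  "cyc a b c = swp a b \<circ> swp b c"

lemma swp_app: "swp a b x = (if x = a then b else if x = b then a else x)"
  by (simp add: Transposition.transpose_def)

lemma dbl_permutes: "a \<in> V \<Longrightarrow> b \<in> V \<Longrightarrow> c \<in> V \<Longrightarrow> d \<in> V \<Longrightarrow> dbl a b c d permutes V"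
  unfolding dbl_def by (intro permutes_compose permutes_swap_id)

lemma cyc_permutes: "a \<in> V \<Longrightarrow> b \<in> V \<Longrightarrow> c \<in> V \<Longrightarrow> cyc a b c permutes V"
  unfolding cyc_def by (intro permutes_compose permutes_swap_id)

lemma sum_Sym_shift:
  assumes "\<tau> permutes V"
  shows "(\<Sum>\<sigma>\<in>Sym V. h (\<tau> \<circ> \<sigma>)) = (\<Sum>\<sigma>\<in>Sym V. h \<sigma>)"
proof (rule sum.reindex_bij_witness[of _ "\<lambda>\<sigma>. inv \<tau> \<circ> \<sigma>" "\<lambda>\<sigma>. \<tau> \<circ> \<sigma>"])
qed (use assms in \<open>auto simp: permutes_inv permutes_compose o_assoc permutes_inv_o\<close>)

text \<open>Translations are orthogonal, so the adjoint is translation by the inverse. The inverse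
  is passed as \<open>\<tau>'\<close> because for 3-cycles it is again of the form
  \<open>cyc\<close>.\<close>

lemma sum_Sym_adjoint:
  fixes f h :: "('a \<Rightarrow> 'a) \<Rightarrow> real"
  assumes "\<tau> permutes V" "\<tau> \<circ> \<tau>' = id" "\<tau>' \<circ> \<tau> = id"
  shows "(\<Sum>\<sigma>\<in>Sym V. f \<sigma> * h (\<tau> \<circ> \<sigma>)) = (\<Sum>\<sigma>\<in>Sym V. f (\<tau>' \<circ> \<sigma>) * h \<sigma>)"
proof -
  have "(\<Sum>\<sigma>\<in>Sym V. f (\<tau>' \<circ> \<sigma>) * h \<sigma>) = (\<Sum>\<sigma>\<in>Sym V. f (\<tau>' \<circ> (\<tau> \<circ> \<sigma>)) * h (\<tau> \<circ> \<sigma>))"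
    using sum_Sym_shift[OF assms(1), of "\<lambda>\<sigma>. f (\<tau>' \<circ> \<sigma>) * h \<sigma>"] by simp
  also have "\<dots> = (\<Sum>\<sigma>\<in>Sym V. f \<sigma> * h (\<tau> \<circ> \<sigma>))"
    by (simp add: o_assoc assms(3))
  finally show ?thesis by simp
qed

lemma sum_Sym_swp:
  fixes f h :: "('a \<Rightarrow> 'a) \<Rightarrow> real"
  assumes "a \<in> V" "b \<in> V"
  shows "(\<Sum>\<sigma>\<in>Sym V. f \<sigma> * h (swp a b \<circ> \<sigma>)) = (\<Sum>\<sigma>\<in>Sym V. f (swp a b \<circ> \<sigma>) * h \<sigma>)"
  by (rule sum_Sym_adjoint) (auto simp: permutes_swap_id assms)

lemma dbl_dbl: "distinct [a, b, c, d] \<Longrightarrow> dbl a b c d \<circ> dbl a b c d = id"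
  by (auto simp: dbl_def fun_eq_iff swp_app)

lemma sum_Sym_dbl:
  fixes f h :: "('a \<Rightarrow> 'a) \<Rightarrow> real"
  assumes "a \<in> V" "b \<in> V" "c \<in> V" "d \<in> V" "distinct [a, b, c, d]"
  shows "(\<Sum>\<sigma>\<in>Sym V. f \<sigma> * h (dbl a b c d \<circ> \<sigma>)) = (\<Sum>\<sigma>\<in>Sym V. f (dbl a b c d \<circ> \<sigma>) * h \<sigma>)"
  using assms by (intro sum_Sym_adjoint dbl_permutes dbl_dbl)

lemma cyc_inverse: "distinct [a, b, c] \<Longrightarrow> cyc a b c \<circ> cyc a c b = id"
  by (auto simp: cyc_def fun_eq_iff swp_app)

lemma sum_Sym_cyc:
  fixes f h :: "('a \<Rightarrow> 'a) \<Rightarrow> real"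
  assumes "a \<in> V" "b \<in> V" "c \<in> V" "distinct [a, b, c]"
  shows "(\<Sum>\<sigma>\<in>Sym V. f \<sigma> * h (cyc a b c \<circ> \<sigma>)) = (\<Sum>\<sigma>\<in>Sym V. f (cyc a c b \<circ> \<sigma>) * h \<sigma>)"
  by (rule sum_Sym_adjoint) (use assms in \<open>auto simp: cyc_permutes intro!: cyc_inverse\<close>)

lemma corr_id: "corr V f id = (\<Sum>\<sigma>\<in>Sym V. (f \<sigma>)\<^sup>2)"
  by (simp add: corr_def power2_eq_square)

lemma corr_id_nonneg: "corr V f id \<ge> 0"
  by (simp add: corr_id sum_nonneg)

text \<open>Translation by \<open>swp a b\<close> preserves the norm. Together with its counterpart
  for sums, this turns an extremal value of \<open>corr\<close> at a transposition into invariance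
  or antiinvariance of \<open>f\<close>.\<close>

lemma corr_swp_diff:
  assumes "a \<in> V" "b \<in> V"
  shows "(\<Sum>\<sigma>\<in>Sym V. (f \<sigma> - f (swp a b \<circ> \<sigma>))\<^sup>2) = 2 * (corr V f id - corr V f (swp a b))"
proof -
  have "(\<Sum>\<sigma>\<in>Sym V. (f (swp a b \<circ> \<sigma>))\<^sup>2) = (\<Sum>\<sigma>\<in>Sym V. (f \<sigma>)\<^sup>2)"
    by (rule sum_Sym_shift[where h="\<lambda>\<sigma>. (f \<sigma>)\<^sup>2"]) (simp add: permutes_swap_id assms)
  then show ?thesis
    by (simp add: corr_def power2_eq_square algebra_simps sum.distrib sum_subtractf sum_distrib_left)
qed

lemma corr_swp_add:
  assumes "a \<in> V" "b \<in> V"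
  shows "(\<Sum>\<sigma>\<in>Sym V. (f \<sigma> + f (swp a b \<circ> \<sigma>))\<^sup>2) = 2 * (corr V f id + corr V f (swp a b))"
proof -
  have "(\<Sum>\<sigma>\<in>Sym V. (f (swp a b \<circ> \<sigma>))\<^sup>2) = (\<Sum>\<sigma>\<in>Sym V. (f \<sigma>)\<^sup>2)"
    by (rule sum_Sym_shift[where h="\<lambda>\<sigma>. (f \<sigma>)\<^sup>2"]) (simp add: permutes_swap_id assms)
  then show ?thesis
    by (simp add: corr_def power2_eq_square algebra_simps sum.distrib sum_subtractf sum_distrib_left)
qed

lemma corr_swp_le:
  assumes "a \<in> V" "b \<in> V"
  shows "corr V f (swp a b) \<le> corr V f id"
  using corr_swp_diff[OF assms, of f] sum_nonneg[of "Sym V" "\<lambda>\<sigma>. (f \<sigma> - f (swp a b \<circ> \<sigma>))\<^sup>2"] by simp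

lemma corr_swp_ge:
  assumes "a \<in> V" "b \<in> V"
  shows "- corr V f id \<le> corr V f (swp a b)"
  using corr_swp_add[OF assms, of f] sum_nonneg[of "Sym V" "\<lambda>\<sigma>. (f \<sigma> + f (swp a b \<circ> \<sigma>))\<^sup>2"] by simp

lemma corr_cyc_inverse:
  assumes "a \<in> V" "b \<in> V" "c \<in> V" "distinct [a, b, c]"
  shows "corr V f (cyc a b c) = corr V f (cyc a c b)"
  unfolding corr_def using sum_Sym_cyc[OF assms, of f f] by (simp add: mult.commute)

lemma cyc_rotate:
  assumes "distinct [a, b, c]"
  shows "cyc a b c = cyc b c a" 
  using assms by (auto simp: cyc_def fun_eq_iff swp_app)

section \<open>The octopus inequality\<close>

definition klein :: "'a \<Rightarrow> 'a \<Rightarrow> 'a \<Rightarrow> 'a \<Rightarrow> (('a \<Rightarrow> 'a) \<Rightarrow> real) \<Rightarrow> ('a \<Rightarrow> 'a) \<Rightarrow> real" where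
  "klein a b c d f \<sigma> = f \<sigma> + f (dbl a b c d \<circ> \<sigma>) + f (dbl a c b d \<circ> \<sigma>) + f (dbl a d b c \<circ> \<sigma>)"

definition cycles4 :: "'a \<Rightarrow> 'a \<Rightarrow> 'a \<Rightarrow> 'a \<Rightarrow> (('a \<Rightarrow> 'a) \<Rightarrow> real) \<Rightarrow> ('a \<Rightarrow> 'a) \<Rightarrow> real" where
  "cycles4 a b c d f \<sigma> =
     f (cyc a b c \<circ> \<sigma>) + f (cyc a c b \<circ> \<sigma>) + f (cyc a b d \<circ> \<sigma>) + f (cyc a d b \<circ> \<sigma>) +
     f (cyc a c d \<circ> \<sigma>) + f (cyc a d c \<circ> \<sigma>) + f (cyc b c d \<circ> \<sigma>) + f (cyc b d c \<circ> \<sigma>)"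

text \<open>The coefficients 2 on the Klein four-group, -1 on the 3-cycles and 0 on odd permutations
  are the values of the character of the two-dimensional irreducible of the symmetric group on four
  points. Hence the operator is 12 times the projection onto the corresponding isotypic
  component.\<close>

definition Eop :: "'a \<Rightarrow> 'a \<Rightarrow> 'a \<Rightarrow> 'a \<Rightarrow> (('a \<Rightarrow> 'a) \<Rightarrow> real) \<Rightarrow> ('a \<Rightarrow> 'a) \<Rightarrow> real" where
  "Eop a b c d f \<sigma> = 2 * klein a b c d f \<sigma> - cycles4 a b c d f \<sigma>"

lemma dbl_comp_dbl:
  assumes "distinct [a, b, c, d]"
  shows "dbl a b c d \<circ> (dbl a c b d \<circ> \<sigma>) = dbl a d b c \<circ> \<sigma>"
    and "dbl a b c d \<circ> (dbl a d b c \<circ> \<sigma>) = dbl a c b d \<circ> \<sigma>"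
    and "dbl a c b d \<circ> (dbl a b c d \<circ> \<sigma>) = dbl a d b c \<circ> \<sigma>"
    and "dbl a c b d \<circ> (dbl a d b c \<circ> \<sigma>) = dbl a b c d \<circ> \<sigma>"
    and "dbl a d b c \<circ> (dbl a b c d \<circ> \<sigma>) = dbl a c b d \<circ> \<sigma>"
    and "dbl a d b c \<circ> (dbl a c b d \<circ> \<sigma>) = dbl a b c d \<circ> \<sigma>"
    and "dbl a b c d \<circ> (dbl a b c d \<circ> \<sigma>) = \<sigma>"
    and "dbl a c b d \<circ> (dbl a c b d \<circ> \<sigma>) = \<sigma>"
    and "dbl a d b c \<circ> (dbl a d b c \<circ> \<sigma>) = \<sigma>"
  using assms by (auto simp: dbl_def fun_eq_iff swp_app)

text \<open>The eight 3-cycles of \<open>cycles4\<close> form the two nontrivial cosets of the Klein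
  four-group in the alternating group, represented by \<open>cyc a b c\<close> and
  \<open>cyc a c b\<close>.\<close>

lemma dbl_comp_cyc:
  assumes "distinct [a, b, c, d]"
  shows "dbl a b c d \<circ> (cyc a b c \<circ> \<sigma>) = cyc b d c \<circ> \<sigma>"
    and "dbl a c b d \<circ> (cyc a b c \<circ> \<sigma>) = cyc a d b \<circ> \<sigma>"
    and "dbl a d b c \<circ> (cyc a b c \<circ> \<sigma>) = cyc a c d \<circ> \<sigma>"
    and "dbl a b c d \<circ> (cyc a c b \<circ> \<sigma>) = cyc a d c \<circ> \<sigma>"
    and "dbl a c b d \<circ> (cyc a c b \<circ> \<sigma>) = cyc b c d \<circ> \<sigma>"
    and "dbl a d b c \<circ> (cyc a c b \<circ> \<sigma>) = cyc a b d \<circ> \<sigma>"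
  using assms by (auto simp: dbl_def cyc_def fun_eq_iff swp_app)

lemma cyc_comp_dbl:
  assumes "distinct [a, b, c, d]"
  shows "cyc a b c \<circ> (dbl a b c d \<circ> \<sigma>) = dbl a d b c \<circ> (cyc a b c \<circ> \<sigma>)"
    and "cyc a b c \<circ> (dbl a c b d \<circ> \<sigma>) = dbl a b c d \<circ> (cyc a b c \<circ> \<sigma>)"
    and "cyc a b c \<circ> (dbl a d b c \<circ> \<sigma>) = dbl a c b d \<circ> (cyc a b c \<circ> \<sigma>)"
    and "cyc a c b \<circ> (dbl a b c d \<circ> \<sigma>) = dbl a c b d \<circ> (cyc a c b \<circ> \<sigma>)"
    and "cyc a c b \<circ> (dbl a c b d \<circ> \<sigma>) = dbl a d b c \<circ> (cyc a c b \<circ> \<sigma>)"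
    and "cyc a c b \<circ> (dbl a d b c \<circ> \<sigma>) = dbl a b c d \<circ> (cyc a c b \<circ> \<sigma>)"
  using assms by (auto simp: dbl_def cyc_def fun_eq_iff swp_app)

lemma cyc_comp_cyc:
  assumes "distinct [a, b, c]"
  shows "cyc a b c \<circ> (cyc a b c \<circ> \<sigma>) = cyc a c b \<circ> \<sigma>"
    and "cyc a c b \<circ> (cyc a c b \<circ> \<sigma>) = cyc a b c \<circ> \<sigma>"
    and "cyc a b c \<circ> (cyc a c b \<circ> \<sigma>) = \<sigma>"
    and "cyc a c b \<circ> (cyc a b c \<circ> \<sigma>) = \<sigma>"
  using assms by (auto simp: cyc_def fun_eq_iff swp_app)

lemma klein_dbl:
  assumes "distinct [a, b, c, d]"
  shows "klein a b c d f (dbl a b c d \<circ> \<sigma>) = klein a b c d f \<sigma>"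
    and "klein a b c d f (dbl a c b d \<circ> \<sigma>) = klein a b c d f \<sigma>"
    and "klein a b c d f (dbl a d b c \<circ> \<sigma>) = klein a b c d f \<sigma>"
  by (simp_all add: klein_def dbl_comp_dbl[OF assms])

lemma Eop_klein:
  assumes "distinct [a, b, c, d]"
  shows "Eop a b c d f \<sigma> = 2 * klein a b c d f \<sigma> - klein a b c d f (cyc a b c \<circ> \<sigma>)
           - klein a b c d f (cyc a c b \<circ> \<sigma>)"
  unfolding Eop_def klein_def[of a b c d f "cyc a b c \<circ> \<sigma>"] klein_def[of a b c d f "cyc a c b \<circ> \<sigma>"]
    cycles4_def dbl_comp_cyc[OF assms] by simp

lemma ip_klein:
  fixes f h :: "('a \<Rightarrow> 'a) \<Rightarrow> real"
  assumes V: "{a, b, c, d} \<subseteq> V" and dist: "distinct [a, b, c, d]"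
    and h: "\<And>\<sigma>. h (dbl a b c d \<circ> \<sigma>) = h \<sigma>" "\<And>\<sigma>. h (dbl a c b d \<circ> \<sigma>) = h \<sigma>"
      "\<And>\<sigma>. h (dbl a d b c \<circ> \<sigma>) = h \<sigma>"
  shows "ip (Sym V) (klein a b c d f) h = 4 * ip (Sym V) f h"
proof -
  have "(\<Sum>\<sigma>\<in>Sym V. f (dbl a b c d \<circ> \<sigma>) * h \<sigma>) = (\<Sum>\<sigma>\<in>Sym V. f \<sigma> * h \<sigma>)"
    "(\<Sum>\<sigma>\<in>Sym V. f (dbl a c b d \<circ> \<sigma>) * h \<sigma>) = (\<Sum>\<sigma>\<in>Sym V. f \<sigma> * h \<sigma>)"
    "(\<Sum>\<sigma>\<in>Sym V. f (dbl a d b c \<circ> \<sigma>) * h \<sigma>) = (\<Sum>\<sigma>\<in>Sym V. f \<sigma> * h \<sigma>)"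
    using V dist sum_Sym_dbl[of a V b c d f h] sum_Sym_dbl[of a V c b d f h]
      sum_Sym_dbl[of a V d b c f h] by (auto simp: h)
  then show ?thesis
    by (simp add: ip_def klein_def distrib_right sum.distrib)
qed

text \<open>With K the Klein sum and t the 3-cycle, the operator is
  \<open>K * (2 - t - inv t)\<close>, where K is self-adjoint and commutes with t because the Klein
  four-group is normal. From \<open>K * K = 4 * K\<close> its form is a quarter of the squared norm
  of \<open>(1 - t) * K\<close> applied to \<open>f\<close>.\<close>

lemma ip_Eop:
  assumes V: "{a, b, c, d} \<subseteq> V" and dist: "distinct [a, b, c, d]"
  shows "ip (Sym V) f (Eop a b c d f) =
    (\<Sum>\<sigma>\<in>Sym V. (klein a b c d f \<sigma> - klein a b c d f (cyc a b c \<circ> \<sigma>))\<^sup>2) / 4"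
proof -
  define g where "g = klein a b c d f"
  define t where "t = cyc a b c"
  define t' where "t' = cyc a c b"
  have gd: "g (dbl a b c d \<circ> \<sigma>) = g \<sigma>" "g (dbl a c b d \<circ> \<sigma>) = g \<sigma>" "g (dbl a d b c \<circ> \<sigma>) = g \<sigma>" for \<sigma>
    unfolding g_def by (rule klein_dbl[OF dist])+
  have gt: "g (t \<circ> (dbl a b c d \<circ> \<sigma>)) = g (t \<circ> \<sigma>)" "g (t \<circ> (dbl a c b d \<circ> \<sigma>)) = g (t \<circ> \<sigma>)"
    "g (t \<circ> (dbl a d b c \<circ> \<sigma>)) = g (t \<circ> \<sigma>)" "g (t' \<circ> (dbl a b c d \<circ> \<sigma>)) = g (t' \<circ> \<sigma>)"
    "g (t' \<circ> (dbl a c b d \<circ> \<sigma>)) = g (t' \<circ> \<sigma>)" "g (t' \<circ> (dbl a d b c \<circ> \<sigma>)) = g (t' \<circ> \<sigma>)" for \<sigma>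
    unfolding t_def t'_def cyc_comp_dbl[OF dist] by (rule gd)+
  have 1: "ip (Sym V) g g = 4 * ip (Sym V) f g"
    unfolding g_def by (rule ip_klein[OF V dist]) (rule klein_dbl[OF dist])+
  have 2: "ip (Sym V) g (\<lambda>\<sigma>. g (t \<circ> \<sigma>)) = 4 * ip (Sym V) f (\<lambda>\<sigma>. g (t \<circ> \<sigma>))"
    unfolding g_def[symmetric] using ip_klein[OF V dist, of "\<lambda>\<sigma>. g (t \<circ> \<sigma>)" f] gt g_def by simp
  have 3: "ip (Sym V) g (\<lambda>\<sigma>. g (t' \<circ> \<sigma>)) = 4 * ip (Sym V) f (\<lambda>\<sigma>. g (t' \<circ> \<sigma>))"
    unfolding g_def[symmetric] using ip_klein[OF V dist, of "\<lambda>\<sigma>. g (t' \<circ> \<sigma>)" f] gt g_def by simp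
  have 4: "ip (Sym V) g (\<lambda>\<sigma>. g (t' \<circ> \<sigma>)) = ip (Sym V) g (\<lambda>\<sigma>. g (t \<circ> \<sigma>))"
    unfolding ip_def t_def t'_def using sum_Sym_cyc[of a V b c g g] V dist
    by (simp add: mult.commute)
  have 5: "(\<Sum>\<sigma>\<in>Sym V. (g (t \<circ> \<sigma>))\<^sup>2) = ip (Sym V) g g"
    unfolding ip_def power2_eq_square
    by (rule sum_Sym_shift[where h="\<lambda>\<sigma>. g \<sigma> * g \<sigma>"]) (use V in \<open>simp add: t_def cyc_permutes\<close>)
  have "(\<Sum>\<sigma>\<in>Sym V. (g \<sigma> - g (t \<circ> \<sigma>))\<^sup>2) = 2 * ip (Sym V) g g - 2 * ip (Sym V) g (\<lambda>\<sigma>. g (t \<circ> \<sigma>))"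
    unfolding power2_diff sum.distrib sum_subtractf 5
    by (simp add: ip_def power2_eq_square sum_distrib_left mult.assoc)
  moreover have "ip (Sym V) f (Eop a b c d f) =
      2 * ip (Sym V) f g - ip (Sym V) f (\<lambda>\<sigma>. g (t \<circ> \<sigma>)) - ip (Sym V) f (\<lambda>\<sigma>. g (t' \<circ> \<sigma>))"
    by (simp add: ip_def Eop_klein[OF dist] g_def t_def t'_def algebra_simps sum.distrib
        sum_subtractf sum_distrib_left)
  ultimately show ?thesis using 1 2 3 4 unfolding g_def[symmetric] t_def[symmetric] by simp
qed

lemma ip_Eop_nonneg:
  assumes "{a, b, c, d} \<subseteq> V" "distinct [a, b, c, d]"
  shows "ip (Sym V) f (Eop a b c d f) \<ge> 0"
  by (simp add: ip_Eop[OF assms] sum_nonneg)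

lemma ip_Eop_commute:
  assumes V: "{a, b, c, d} \<subseteq> V" and dist: "distinct [a, b, c, d]"
  shows "ip (Sym V) f (Eop a b c d h) = ip (Sym V) (Eop a b c d f) h"
proof -
  have m: "(\<Sum>x\<in>S. p x * (2 * q x)) = 2 * (\<Sum>x\<in>S. p x * q x)" for S and p q :: "_ \<Rightarrow> real"
    by (simp add: sum_distrib_left algebra_simps)
  have d: "c \<noteq> b" "d \<noteq> b" "d \<noteq> c"
    using dist by auto
  show ?thesis
    using V dist d
    by (simp add: ip_def Eop_def klein_def cycles4_def distrib_left distrib_right left_diff_distrib
        right_diff_distrib sum.distrib sum_subtractf m sum_Sym_dbl sum_Sym_cyc
        mult.assoc sum_distrib_left[symmetric])
qed

lemma Eop_comb:
  "Eop a b c d (\<lambda>\<sigma>. h \<sigma> - r * f \<sigma>) \<sigma> = Eop a b c d h \<sigma> - r * Eop a b c d f \<sigma>"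
  by (simp add: Eop_def klein_def cycles4_def algebra_simps)

lemma ip_comb:
  "ip X (\<lambda>x. f x - r * g x) (\<lambda>x. h x - r * k x) = ip X f h - r * ip X f k - r * ip X g h + r\<^sup>2 * ip X g k"
  by (simp add: ip_def algebra_simps power2_eq_square sum.distrib sum_subtractf sum_distrib_left)

text \<open>These equations place the image in the isotypic component: the Klein four-group acts
  trivially, and what remains is an action of the symmetric group on three points in which the sum
  over the 3-cycles and the identity vanishes.\<close>

lemma Eop_sums:
  fixes f :: "('a \<Rightarrow> 'a) \<Rightarrow> real"
  assumes dist: "distinct [a, b, c, d]"
  defines "h \<equiv> Eop a b c d f"
  shows "h (dbl a b c d \<circ> \<sigma>) = h \<sigma>" "h (dbl a c b d \<circ> \<sigma>) = h \<sigma>" "h (dbl a d b c \<circ> \<sigma>) = h \<sigma>"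
    and "h \<sigma> + h (cyc a b c \<circ> \<sigma>) + h (cyc a c b \<circ> \<sigma>) = 0"
proof -
  show k: "h (dbl a b c d \<circ> \<sigma>) = h \<sigma>" "h (dbl a c b d \<circ> \<sigma>) = h \<sigma>" "h (dbl a d b c \<circ> \<sigma>) = h \<sigma>" for \<sigma>
    unfolding h_def Eop_klein[OF dist] cyc_comp_dbl[OF dist] klein_dbl[OF dist] by (rule refl)+
  have dist': "distinct [a, b, c]"
    using dist by auto
  show "h \<sigma> + h (cyc a b c \<circ> \<sigma>) + h (cyc a c b \<circ> \<sigma>) = 0"
    unfolding h_def Eop_klein[OF dist] cyc_comp_cyc[OF dist'] by simp
qed

lemma cycles4_invariant:
  assumes dist: "distinct [a, b, c, d]"
    and k: "\<And>\<sigma>. h (dbl a b c d \<circ> \<sigma>) = h \<sigma>" "\<And>\<sigma>. h (dbl a c b d \<circ> \<sigma>) = h \<sigma>"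
      "\<And>\<sigma>. h (dbl a d b c \<circ> \<sigma>) = h \<sigma>"
  shows "cycles4 a b c d h \<sigma> = 4 * (h (cyc a b c \<circ> \<sigma>) + h (cyc a c b \<circ> \<sigma>))"
  unfolding cycles4_def dbl_comp_cyc[OF dist, symmetric] k by simp

text \<open>On its image the Klein sum acts as 4 and the two 3-cycles together as -1, so the
  operator acts there as \<open>4 * (2 + 1) = 12\<close>.\<close>

lemma ip_Eop_Eop:
  fixes f :: "('a \<Rightarrow> 'a) \<Rightarrow> real"
  assumes V: "{a, b, c, d} \<subseteq> V" and dist: "distinct [a, b, c, d]"
  defines "h \<equiv> Eop a b c d f"
  shows "ip (Sym V) h h = 12 * ip (Sym V) f h"
proof -
  note E = Eop_sums[OF dist, of f, folded h_def]
  have "Eop a b c d h \<sigma> = 12 * h \<sigma>" for \<sigma>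
    unfolding Eop_def cycles4_invariant[OF dist E(1-3)] klein_def E(1-3) using E(4)[of \<sigma>] by simp
  then have "ip (Sym V) f (Eop a b c d h) = 12 * ip (Sym V) f h"
    by (simp add: ip_def sum_distrib_left algebra_simps)
  then show ?thesis
    unfolding ip_Eop_commute[OF V dist] h_def .
qed

lemma dbl_as_cyc:
  assumes "distinct [z, i, j, k, l]"
  shows "dbl z i j k \<circ> \<sigma> = dbl i l j k \<circ> (cyc z l i \<circ> \<sigma>)"
  using assms by (auto simp: dbl_def cyc_def fun_eq_iff swp_app)

lemma dbl_commute:
  assumes "distinct [a, b, c, d]"
  shows "dbl a b c d = dbl b a c d" "dbl a b c d = dbl a b d c" "dbl a b c d = dbl c d a b"
  using assms by (auto simp: dbl_def fun_eq_iff swp_app)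

text \<open>
  On the left the twelve double transpositions moving \<open>z\<close> have coefficient 2 and the twelve 3-cycles
  moving \<open>z\<close> have coefficient -2; modulo the Klein four-group on \<open>{a, b, c, d}\<close> they are matched by
  \<open>dbl_as_cyc\<close> and cancel.
\<close>

lemma Eop_sum5:
  fixes f :: "('a \<Rightarrow> 'a) \<Rightarrow> real"
  assumes dist: "distinct [z, a, b, c, d]"
  defines "h \<equiv> Eop a b c d f"
  shows "Eop z b c d h \<sigma> + Eop z a c d h \<sigma> + Eop z a b d h \<sigma> + Eop z a b c h \<sigma> = 12 * h \<sigma>"
proof -
  have dist': "distinct [a, b, c, d]"
    using dist by simp
  note E = Eop_sums[OF dist', of f, folded h_def]
  have E': "h (dbl b a c d \<circ> \<sigma>) = h \<sigma>" "h (dbl c a b d \<circ> \<sigma>) = h \<sigma>" "h (dbl d a b c \<circ> \<sigma>) = h \<sigma>"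
    "h (dbl b c a d \<circ> \<sigma>) = h \<sigma>" "h (dbl c b a d \<circ> \<sigma>) = h \<sigma>" "h (dbl b d a c \<circ> \<sigma>) = h \<sigma>"
    "h (dbl d b a c \<circ> \<sigma>) = h \<sigma>" "h (dbl c d a b \<circ> \<sigma>) = h \<sigma>" "h (dbl d c a b \<circ> \<sigma>) = h \<sigma>" for \<sigma>
    using E(1-3) dist' dbl_commute[of a b c d] dbl_commute[of a c b d] dbl_commute[of a d b c]
      dbl_commute[of b a c d] dbl_commute[of c a b d] dbl_commute[of d a b c]
      dbl_commute[of b d a c] dbl_commute[of c d a b] dbl_commute[of b c a d] by auto
  have D: "h (dbl z i j k \<circ> \<sigma>) = h (cyc z l i \<circ> \<sigma>)"
    if "distinct [z, i, j, k, l]" "\<And>\<sigma>. h (dbl i l j k \<circ> \<sigma>) = h \<sigma>" for i j k l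
    unfolding dbl_as_cyc[OF that(1)] that(2) ..
  have d: "h (dbl z b c d \<circ> \<sigma>) = h (cyc z a b \<circ> \<sigma>)" "h (dbl z c b d \<circ> \<sigma>) = h (cyc z a c \<circ> \<sigma>)"
    "h (dbl z d b c \<circ> \<sigma>) = h (cyc z a d \<circ> \<sigma>)"
    "h (dbl z a c d \<circ> \<sigma>) = h (cyc z b a \<circ> \<sigma>)" "h (dbl z c a d \<circ> \<sigma>) = h (cyc z b c \<circ> \<sigma>)"
    "h (dbl z d a c \<circ> \<sigma>) = h (cyc z b d \<circ> \<sigma>)"
    "h (dbl z a b d \<circ> \<sigma>) = h (cyc z c a \<circ> \<sigma>)" "h (dbl z b a d \<circ> \<sigma>) = h (cyc z c b \<circ> \<sigma>)"
    "h (dbl z d a b \<circ> \<sigma>) = h (cyc z c d \<circ> \<sigma>)"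
    "h (dbl z a b c \<circ> \<sigma>) = h (cyc z d a \<circ> \<sigma>)" "h (dbl z b a c \<circ> \<sigma>) = h (cyc z d b \<circ> \<sigma>)"
    "h (dbl z c a b \<circ> \<sigma>) = h (cyc z d c \<circ> \<sigma>)"
    using dist by (auto intro!: D simp: E E')
  have "cycles4 a b c d h \<sigma> = - 4 * h \<sigma>"
    unfolding cycles4_invariant[OF dist' E(1-3)] using E(4)[of \<sigma>] by simp
  then show ?thesis
    unfolding Eop_def klein_def cycles4_def d by simp
qed

text \<open>Let A be the sum of the four elements containing \<open>z\<close>. It is positive
  semidefinite and by \<open>Eop_sum5\<close> acts as 12 on the image of E, the element of
  \<open>a b c d\<close>. Split \<open>f\<close> into \<open>h / 12\<close>, its projection to that
  image, and \<open>- r / 12\<close>. The cross terms vanish by orthogonality, A and E have the same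
  form on the first part, E vanishes on the second and A is nonnegative there.\<close>

lemma Eop_five_points:
  assumes V: "{z, a, b, c, d} \<subseteq> V" and dist: "distinct [z, a, b, c, d]"
  shows "ip (Sym V) f (Eop a b c d f) \<le>
     ip (Sym V) f (Eop z b c d f) + ip (Sym V) f (Eop z a c d f) +
     ip (Sym V) f (Eop z a b d f) + ip (Sym V) f (Eop z a b c f)"
proof -
  define h where "h = Eop a b c d f"
  define r where "r = (\<lambda>\<sigma>. h \<sigma> - 12 * f \<sigma>)"
  have hh: "ip (Sym V) h h = 12 * ip (Sym V) f h"
    unfolding h_def by (rule ip_Eop_Eop) (use V dist in auto)
  have lin: "ip (Sym V) r (Eop p q s t r) =
      ip (Sym V) h (Eop p q s t h) - 24 * ip (Sym V) f (Eop p q s t h) + 144 * ip (Sym V) f (Eop p q s t f)"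
    if "{p, q, s, t} \<subseteq> V" "distinct [p, q, s, t]" for p q s t
  proof -
    have "ip (Sym V) r (Eop p q s t r) =
        ip (Sym V) h (Eop p q s t h) - 12 * ip (Sym V) h (Eop p q s t f)
        - 12 * ip (Sym V) f (Eop p q s t h) + 144 * ip (Sym V) f (Eop p q s t f)"
    proof -
      have "Eop p q s t r = (\<lambda>\<sigma>. Eop p q s t h \<sigma> - 12 * Eop p q s t f \<sigma>)"
        unfolding r_def by (rule ext) (rule Eop_comb)
      then show ?thesis
        unfolding r_def by (simp add: ip_comb)
    qed
    moreover have "ip (Sym V) h (Eop p q s t f) = ip (Sym V) f (Eop p q s t h)"
      using ip_Eop_commute[OF that, of h f] by (simp add: ip_def mult.commute)
    ultimately show ?thesis by simp
  qed
  have sum12: "ip (Sym V) p (Eop z b c d h) + ip (Sym V) p (Eop z a c d h) + ip (Sym V) p (Eop z a b d h)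
      + ip (Sym V) p (Eop z a b c h) = 12 * ip (Sym V) p h" for p
    unfolding ip_def sum.distrib[symmetric] distrib_left[symmetric]
      Eop_sum5[OF dist, of f, folded h_def] by (simp add: sum_distrib_left algebra_simps)
  have "0 \<le> ip (Sym V) r (Eop z b c d r) + ip (Sym V) r (Eop z a c d r) +
     ip (Sym V) r (Eop z a b d r) + ip (Sym V) r (Eop z a b c r)"
    by (intro add_nonneg_nonneg ip_Eop_nonneg) (use V dist in auto)
  also have "\<dots> = 12 * ip (Sym V) h h - 24 * (12 * ip (Sym V) f h) + 
    144 * (ip (Sym V) f (Eop z b c d f) + ip (Sym V) f (Eop z a c d f) +
     ip (Sym V) f (Eop z a b d f) + ip (Sym V) f (Eop z a b c f))"
    unfolding sum12[symmetric] using V dist by (simp add: lin)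
  finally show ?thesis using hh unfolding h_def by simp
qed

text \<open>The form of \<open>Eop\<close> in terms of \<open>corr\<close>, with each 3-cycle merged
  with its inverse. The value 0 at coinciding indices allows sums over all quadruples of
  vertices.\<close>

definition quad :: "'a set \<Rightarrow> (('a \<Rightarrow> 'a) \<Rightarrow> real) \<Rightarrow> 'a \<Rightarrow> 'a \<Rightarrow> 'a \<Rightarrow> 'a \<Rightarrow> real" where
  "quad V f i j k l = (if distinct [i, j, k, l] then
     2 * corr V f id + 2 * (corr V f (dbl i j k l) + corr V f (dbl i k j l) + corr V f (dbl i l j k))
     - 2 * (corr V f (cyc i j k) + corr V f (cyc i j l) + corr V f (cyc i k l) + corr V f (cyc j k l))
     else 0)"

lemma quad_eq_ip:
  assumes "{i, j, k, l} \<subseteq> V" "distinct [i, j, k, l]"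
  shows "quad V f i j k l = ip (Sym V) f (Eop i j k l f)"
proof -
  have "corr V f (cyc i k j) = corr V f (cyc i j k)" "corr V f (cyc i l j) = corr V f (cyc i j l)"
    "corr V f (cyc i l k) = corr V f (cyc i k l)" "corr V f (cyc j l k) = corr V f (cyc j k l)"
    using assms by (auto intro!: corr_cyc_inverse)
  then have "ip (Sym V) f (Eop i j k l f) = 2 * corr V f id
     + 2 * (corr V f (dbl i j k l) + corr V f (dbl i k j l) + corr V f (dbl i l j k))
     - 2 * (corr V f (cyc i j k) + corr V f (cyc i j l) + corr V f (cyc i k l) + corr V f (cyc j k l))"
    by (simp add: ip_def Eop_def klein_def cycles4_def corr_def algebra_simps sum.distrib
        sum_subtractf sum_distrib_left)
  then show ?thesis
    using assms(2) by (simp add: quad_def)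
qed

lemma quad_nonneg:
  assumes "{i, j, k, l} \<subseteq> V"
  shows "quad V f i j k l \<ge> 0"
proof (cases "distinct [i, j, k, l]")
  case True
  then show ?thesis using quad_eq_ip[OF assms True] ip_Eop_nonneg[OF assms True] by simp
qed (simp only: quad_def if_False)

lemma quad_five_points:
  assumes "{z, a, b, c, d} \<subseteq> V" "z \<notin> {a, b, c, d}"
  shows "quad V f a b c d \<le> quad V f z b c d + quad V f z a c d + quad V f z a b d + quad V f z a b c"
proof (cases "distinct [a, b, c, d]")
  case True
  then show ?thesis
    using Eop_five_points[of z a b c d V f] assms by (simp add: quad_eq_ip)
next
  case False
  then have "quad V f a b c d = 0"
    by (simp only: quad_def if_False)
  then show ?thesis
    using assms by (simp add: add_nonneg_nonneg quad_nonneg)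
qed

lemma quad_commute:
  assumes "{i, j, k, l} \<subseteq> V"
  shows "quad V f i j k l = quad V f j i k l" "quad V f i j k l = quad V f i k j l"
    "quad V f i j k l = quad V f i j l k"
proof -
  have c: "corr V f (cyc b a c) = corr V f (cyc a b c)" "corr V f (cyc a c b) = corr V f (cyc a b c)"
    if "a \<in> V" "b \<in> V" "c \<in> V" "distinct [a, b, c]" for a b c
    using that corr_cyc_inverse[of a V b c f] cyc_rotate[of a b c] cyc_rotate[of b a c] by auto
  have d: "distinct [i, j, k, l] \<Longrightarrow> dbl j i k l = dbl i j k l \<and> dbl j k i l = dbl i l j k \<and> dbl j l i k = dbl i k j l
    \<and> dbl i k l j = dbl i k j l \<and> dbl i j l k = dbl i j k l \<and> dbl i l k j = dbl i l j k"
    by (auto simp: dbl_def fun_eq_iff swp_app)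
  show "quad V f i j k l = quad V f j i k l"
    using assms c[of i j k] c[of i j l] c[of i k l] c[of j k l] d by (auto simp: quad_def)
  show "quad V f i j k l = quad V f i k j l"
    using assms c[of i j k] c[of i j l] c[of i k l] c[of j k l] d by (auto simp: quad_def)
  show "quad V f i j k l = quad V f i j l k"
    using assms c[of i j k] c[of i j l] c[of i k l] c[of j k l] d by (auto simp: quad_def)
qed

section \<open>Fourfold weighted sums of the four-point forms\<close>

definition sum4 :: "'a set \<Rightarrow> ('a \<Rightarrow> real) \<Rightarrow> ('a \<Rightarrow> 'a \<Rightarrow> 'a \<Rightarrow> 'a \<Rightarrow> real) \<Rightarrow> real" where
  "sum4 X c F = (\<Sum>i\<in>X. \<Sum>j\<in>X. \<Sum>k\<in>X. \<Sum>l\<in>X. c i * c j * c k * c l * F i j k l)"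

lemma sum4_swap:
  shows sum4_swap12: "sum4 X c (\<lambda>i j k l. F j i k l) = sum4 X c F"
    and sum4_swap23: "sum4 X c (\<lambda>i j k l. F i k j l) = sum4 X c F"
    and sum4_swap34: "sum4 X c (\<lambda>i j k l. F i j l k) = sum4 X c F"
proof -
  show "sum4 X c (\<lambda>i j k l. F j i k l) = sum4 X c F"
    unfolding sum4_def
    by (rule trans[OF sum.swap]) (simp add: mult.commute mult.left_commute)
  show "sum4 X c (\<lambda>i j k l. F i k j l) = sum4 X c F"
    unfolding sum4_def
    by (rule sum.cong[OF refl], rule trans[OF sum.swap]) (simp add: mult.commute mult.left_commute)
  show "sum4 X c (\<lambda>i j k l. F i j l k) = sum4 X c F"
    unfolding sum4_def
    by (rule sum.cong[OF refl], rule sum.cong[OF refl], rule trans[OF sum.swap])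
      (simp add: mult.commute mult.left_commute)
qed

lemma sum4_add: "sum4 X c (\<lambda>i j k l. F i j k l + G i j k l) = sum4 X c F + sum4 X c G"
  by (simp add: sum4_def distrib_left sum.distrib)

lemma sum4_diff: "sum4 X c (\<lambda>i j k l. F i j k l - G i j k l) = sum4 X c F - sum4 X c G"
  by (simp add: sum4_def right_diff_distrib sum_subtractf)

lemma sum4_scale: "sum4 X c (\<lambda>i j k l. r * F i j k l) = r * sum4 X c F"
  by (simp add: sum4_def sum_distrib_left mult.left_commute)

lemma sum4_cong:
  assumes "\<And>i j k l. {i, j, k, l} \<subseteq> X \<Longrightarrow> F i j k l = G i j k l"
  shows "sum4 X c F = sum4 X c G"
  unfolding sum4_def by (intro sum.cong refl) (simp add: assms)

lemma sum4_const: "sum4 X c (\<lambda>i j k l. F i j k) = (\<Sum>i\<in>X. \<Sum>j\<in>X. \<Sum>k\<in>X. c i * c j * c k * F i j k) * sum c X"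
proof -
  have "(\<Sum>l\<in>X. c i * c j * c k * c l * F i j k) = c i * c j * c k * F i j k * sum c X" for i j k
    by (simp add: sum_distrib_right[symmetric] sum_distrib_left[symmetric])
  then show ?thesis
    by (simp add: sum4_def sum_distrib_right)
qed

definition kd :: "'a \<Rightarrow> 'a \<Rightarrow> real" where
  "kd i j = (if i = j then 1 else 0)"

text \<open>
  The values at coinciding arguments are chosen to make \<open>quad_expansion\<close> hold for all indices. Any
  function of only three of the four indices sums to zero against weights of total zero.
\<close>

definition tri :: "'a set \<Rightarrow> (('a \<Rightarrow> 'a) \<Rightarrow> real) \<Rightarrow> 'a \<Rightarrow> 'a \<Rightarrow> 'a \<Rightarrow> real" where
  "tri V f i j k = (if distinct [i, j, k] then corr V f (cyc i j k)
     else if i = j \<and> j = k then - corr V f id / 2 else corr V f id / 2)"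

lemma dbl_coincide:
  "dbl a a c d = swp c d" "dbl a b c c = swp a b" "dbl a b a b = id" "dbl a b b a = id"
  "a \<noteq> b \<Longrightarrow> a \<noteq> d \<Longrightarrow> dbl a b a d = cyc b a d"
  "a \<noteq> b \<Longrightarrow> b \<noteq> d \<Longrightarrow> dbl a b b d = cyc a b d"
  "a \<noteq> b \<Longrightarrow> a \<noteq> c \<Longrightarrow> dbl a b c a = cyc b a c"
  "a \<noteq> b \<Longrightarrow> b \<noteq> c \<Longrightarrow> dbl a b c b = cyc a b c"
  by (auto simp: dbl_def cyc_def fun_eq_iff swp_app)

lemma corr_cyc_all:
  assumes "a \<in> V" "b \<in> V" "c \<in> V" "distinct [a, b, c]"
  shows "corr V f (cyc a c b) = corr V f (cyc a b c)" "corr V f (cyc b a c) = corr V f (cyc a b c)"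
    "corr V f (cyc b c a) = corr V f (cyc a b c)" "corr V f (cyc c a b) = corr V f (cyc a b c)"
    "corr V f (cyc c b a) = corr V f (cyc a b c)"
proof -
  show 1: "corr V f (cyc a c b) = corr V f (cyc a b c)"
    using corr_cyc_inverse[OF assms] ..
  have d: "distinct [b, c, a]" "distinct [c, a, b]" "distinct [a, b, c]" "distinct [a, c, b]"
    "distinct [b, a, c]" "distinct [c, b, a]"
    using assms by auto
  show "corr V f (cyc b c a) = corr V f (cyc a b c)" "corr V f (cyc c a b) = corr V f (cyc a b c)"
    by (simp_all only: cyc_rotate[OF d(3)] cyc_rotate[OF d(1)])
  show "corr V f (cyc b a c) = corr V f (cyc a b c)" "corr V f (cyc c b a) = corr V f (cyc a b c)"
    by (simp_all only: cyc_rotate[OF d(6)] cyc_rotate[OF d(5)] 1)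
qed

text \<open>The content lies in the coinciding indices, where the left side is 0: the products
  \<open>dbl\<close> then degenerate to transpositions, 3-cycles or the identity, and the
  \<open>kd\<close> and \<open>tri\<close> terms cancel exactly these. This makes the unrestricted
  sum in \<open>sum4_quad\<close> possible without inclusion and exclusion.\<close>

lemma quad_expansion:
  assumes V: "{i, j, k, l} \<subseteq> V"
  shows "quad V f i j k l =
    2 * (corr V f (dbl i j k l) + corr V f (dbl i k j l) + corr V f (dbl i l j k)) + 2 * corr V f id
    - 2 * (tri V f i j k + tri V f i j l + tri V f i k l + tri V f j k l)
    - 2 * (kd k l * corr V f (swp i j) + kd j l * corr V f (swp i k) + kd j k * corr V f (swp i l)
      + kd i l * corr V f (swp j k) + kd i k * corr V f (swp j l) + kd i j * corr V f (swp k l))"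
    (is "_ = ?R i j k l")
proof -
  define R where "R i j k l = ?R i j k l" for i j k l
  have s: "corr V f (swp a b) = corr V f (swp b a)" for a b
    by (simp add: transpose_commute)
  have three: "R p p q r = 0 \<and> R p q p r = 0 \<and> R p q r p = 0 \<and> R p q q r = 0 \<and> R p q r q = 0 \<and> R p q r r = 0"
    if "p \<in> V" "q \<in> V" "r \<in> V" "distinct [p, q, r]" for p q r
    using that not_sym[of p q] not_sym[of p r] not_sym[of q r] s[of q p] s[of r p] s[of r q]
    by (simp add: R_def tri_def kd_def dbl_coincide corr_cyc_all[of p V q r] id_def)
  have two: "R p p q q = 0 \<and> R p q p q = 0 \<and> R p q q p = 0 \<and> R p p p q = 0 \<and> R p p q p = 0 \<and> R p q p p = 0
      \<and> R q p p p = 0" if "p \<noteq> q" for p q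
    using that not_sym[of p q] s[of q p] by (simp add: R_def tri_def kd_def dbl_coincide id_def)
  have one: "R p p p p = 0" for p
    by (simp add: R_def tri_def kd_def dbl_coincide id_def)
  have "quad V f i j k l = R i j k l"
  proof (cases "distinct [i, j, k, l]")
    case True
    then show ?thesis by (simp add: R_def quad_def tri_def kd_def id_def)
  next
    case False
    then have "quad V f i j k l = 0"
      by (simp only: quad_def if_False)
    moreover have "R i j k l = 0"
    proof -
      consider "i = j" | "i \<noteq> j" "i = k" | "i \<noteq> j" "i \<noteq> k" "i = l" | "i \<noteq> j" "i \<noteq> k" "i \<noteq> l" "j = k"
        | "distinct [i, j, k]" "j = l" "i \<noteq> l" | "distinct [i, j, k]" "k = l"
        using False by auto
      then show ?thesis
      proof cases
        case 1
        consider "i = k" "i = l" | "i = k" "i \<noteq> l" | "i \<noteq> k" "i = l" | "i \<noteq> k" "k = l" | "distinct [i, k, l]"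
          by auto
        then show ?thesis
          by cases (use 1 V one[of i] two[of i k] two[of i l] three[of i k l] in simp_all)
      next
        case 2
        consider "i = l" | "j = l" | "distinct [i, j, l]"
          using 2 by auto
        then show ?thesis
          by cases (use 2 V two[of i j] three[of i j l] in simp_all)
      next
        case 3
        then show ?thesis
          by (cases "j = k") (use V two[of i j] three[of i j k] in simp_all)
      next
        case 4
        then show ?thesis
          by (cases "j = l") (use V two[of j i] three[of i j l] in simp_all)
      next
        case 5
        then show ?thesis
          using V three[of i j k] by simp
      next
        case 6
        then show ?thesis
          using V three[of i j k] by simp
      qed
    qed
    ultimately show ?thesis by simp
  qed
  then show ?thesis unfolding R_def .
qed

text \<open>The sum is the form of \<open>S * S\<close>, and S is self-adjoint as a combination of
  transpositions, so it is a squared norm.\<close>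

lemma sum4_corr_dbl_nonneg:
  assumes "finite V"
  shows "sum4 V c (\<lambda>i j k l. corr V f (dbl i j k l)) \<ge> 0"
proof -
  define S where "S = (\<lambda>\<sigma>. \<Sum>i\<in>V. \<Sum>j\<in>V. c i * c j * f (swp i j \<circ> \<sigma>))"
  have "(S \<sigma>)\<^sup>2 = (\<Sum>i\<in>V. \<Sum>j\<in>V. \<Sum>k\<in>V. \<Sum>l\<in>V.
      c i * c j * c k * c l * (f (swp k l \<circ> \<sigma>) * f (swp i j \<circ> \<sigma>)))" for \<sigma>
    unfolding S_def power2_eq_square sum_distrib_left sum_distrib_right
    by (intro sum.cong refl) (simp add: sum_distrib_left sum_distrib_right ac_simps)
  then have "(\<Sum>\<sigma>\<in>Sym V. (S \<sigma>)\<^sup>2) = (\<Sum>i\<in>V. \<Sum>j\<in>V. \<Sum>k\<in>V. \<Sum>l\<in>V. \<Sum>\<sigma>\<in>Sym V.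
      c i * c j * c k * c l * (f (swp k l \<circ> \<sigma>) * f (swp i j \<circ> \<sigma>)))"
    by (simp add: sum.swap[of _ V "Sym V"])
  also have "\<dots> = sum4 V c (\<lambda>i j k l. corr V f (dbl i j k l))"
    unfolding sum4_def
  proof (intro sum.cong refl)
    fix i j k l assume "k \<in> V" "l \<in> V"
    then show "(\<Sum>\<sigma>\<in>Sym V. c i * c j * c k * c l * (f (swp k l \<circ> \<sigma>) * f (swp i j \<circ> \<sigma>))) =
        c i * c j * c k * c l * corr V f (dbl i j k l)"
      unfolding corr_def dbl_def o_assoc[symmetric] 
      using sum_Sym_swp[of k V l f "\<lambda>\<sigma>. f (swp i j \<circ> \<sigma>)"]
      by (simp add: sum_distrib_left[symmetric])
  qed
  finally show ?thesis
    by (metis sum_nonneg zero_le_power2)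
qed

text \<open>Terms that ignore one of the four indices vanish because the weights have total zero. Of
  the rest, the three pairings with coefficient 2 each give 6 times the form of
  \<open>S * S\<close>, and the six \<open>kd\<close> terms with coefficient -2 give -12 times q
  times the form of S.\<close>

lemma sum4_quad:
  assumes "sum c V = 0"
  shows "sum4 V c (quad V f) = 6 * sum4 V c (\<lambda>i j k l. corr V f (dbl i j k l))
    - 12 * ((\<Sum>i\<in>V. \<Sum>j\<in>V. c i * c j * corr V f (swp i j)) * (\<Sum>k\<in>V. (c k)\<^sup>2))"
proof -
  define D where "D i j k l = corr V f (dbl i j k l)" for i j k l
  define K where "K i j k l = kd k l * corr V f (swp i j)" for i j k l :: 'a
  have "sum4 V c (quad V f) = sum4 V c (\<lambda>i j k l.
      2 * (D i j k l + D i k j l + D i l j k) + 2 * corr V f id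
    - 2 * (tri V f i j k + tri V f i j l + tri V f i k l + tri V f j k l)
    - 2 * (K i j k l + K i k j l + K i l j k + K j k i l + K j l i k + K k l i j))"
    unfolding D_def K_def by (rule sum4_cong) (rule quad_expansion)
  also have "\<dots> = 6 * sum4 V c D - 12 * sum4 V c K"
  proof -
    have z: "sum4 V c (\<lambda>i j k l. F i j k) = 0" for F
      by (simp add: sum4_const assms)
    have t: "sum4 V c (\<lambda>i j k l. F i j l) = 0" "sum4 V c (\<lambda>i j k l. F i k l) = 0" "sum4 V c (\<lambda>i j k l. F j k l) = 0" for F
      using z[of F] sum4_swap34[of V c "\<lambda>i j k l. F i j k"] sum4_swap23[of V c "\<lambda>i j k l. F i j l"]
        sum4_swap12[of V c "\<lambda>i j k l. F i k l"] by simp_all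
    have p: "sum4 V c (\<lambda>i j k l. F i k j l) = sum4 V c F" "sum4 V c (\<lambda>i j k l. F i l j k) = sum4 V c F"
      "sum4 V c (\<lambda>i j k l. F j k i l) = sum4 V c F" "sum4 V c (\<lambda>i j k l. F j l i k) = sum4 V c F"
      "sum4 V c (\<lambda>i j k l. F k l i j) = sum4 V c F" for F
      using sum4_swap23[of V c F] sum4_swap34[of V c "\<lambda>i j k l. F i k j l"] sum4_swap12[of V c "\<lambda>i j k l. F i k j l"]
        sum4_swap34[of V c "\<lambda>i j k l. F j k i l"] sum4_swap23[of V c "\<lambda>i j k l. F j l i k"]
      by simp_all
    show ?thesis
      by (simp add: sum4_add sum4_diff sum4_scale z t p[of D] p[of K])
  qed
  also have "sum4 V c K = (\<Sum>i\<in>V. \<Sum>j\<in>V. c i * c j * corr V f (swp i j)) * (\<Sum>k\<in>V. (c k)\<^sup>2)"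
  proof (cases "finite V")
    case True
    have "(\<Sum>k\<in>V. \<Sum>l\<in>V. c i * c j * c k * c l * K i j k l) =
        c i * c j * corr V f (swp i j) * (\<Sum>k\<in>V. (c k)\<^sup>2)" for i j
    proof -
      have "(\<Sum>l\<in>V. c i * c j * c k * c l * K i j k l) = c i * c j * corr V f (swp i j) * (c k)\<^sup>2"
        if "k \<in> V" for k
      proof -
        have "(\<Sum>l\<in>V. c i * c j * c k * c l * K i j k l) =
            (\<Sum>l\<in>V. if k = l then c i * c j * c k * c l * corr V f (swp i j) else 0)"
          by (intro sum.cong) (auto simp: K_def kd_def)
        then show ?thesis using that True by (simp add: power2_eq_square)
      qed
      then show ?thesis by (simp add: sum_distrib_left)
    qed
    then show ?thesis
      unfolding sum4_def by (simp only: sum_distrib_right[symmetric])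
  qed (simp add: sum4_def)
  finally show ?thesis unfolding D_def .
qed

lemma quad_coincide:
  "quad V f i i k l = 0" "quad V f i j i l = 0" "quad V f i j k i = 0"
  "quad V f i j j l = 0" "quad V f i j k j = 0" "quad V f i j k k = 0"
  by (simp_all add: quad_def)

lemma sum4_insert:
  assumes "finite X" "z \<notin> X"
    and "\<And>k l. F z z k l = 0" "\<And>j l. F z j z l = 0" "\<And>j k. F z j k z = 0"
      "\<And>i l. F i z z l = 0" "\<And>i k. F i z k z = 0" "\<And>i j. F i j z z = 0"
  shows "sum4 (insert z X) c F = sum4 X c F
        + (\<Sum>i\<in>X. \<Sum>j\<in>X. \<Sum>k\<in>X. c z * c i * c j * c k * F z i j k)
        + (\<Sum>i\<in>X. \<Sum>j\<in>X. \<Sum>k\<in>X. c i * c z * c j * c k * F i z j k)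
        + (\<Sum>i\<in>X. \<Sum>j\<in>X. \<Sum>k\<in>X. c i * c j * c z * c k * F i j z k)
        + (\<Sum>i\<in>X. \<Sum>j\<in>X. \<Sum>k\<in>X. c i * c j * c k * c z * F i j k z)"
  unfolding sum4_def by (simp add: assms sum.distrib)

text \<open>A term in which \<open>z\<close> occurs twice vanishes, so \<open>z\<close> sits in at
  most one of the four positions, and by symmetry the position does not matter.\<close>

lemma sum4_insert_symmetric:
  assumes "finite X" "z \<notin> X"
    and "\<And>k l. F z z k l = 0" "\<And>j l. F z j z l = 0" "\<And>j k. F z j k z = 0"
      "\<And>i l. F i z z l = 0" "\<And>i k. F i z k z = 0" "\<And>i j. F i j z z = 0"
    and mv: "\<And>i k l. i \<in> X \<Longrightarrow> k \<in> X \<Longrightarrow> l \<in> X \<Longrightarrow> F i z k l = F z i k l"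
      "\<And>i k l. i \<in> X \<Longrightarrow> k \<in> X \<Longrightarrow> l \<in> X \<Longrightarrow> F i k z l = F z i k l"
      "\<And>i k l. i \<in> X \<Longrightarrow> k \<in> X \<Longrightarrow> l \<in> X \<Longrightarrow> F i k l z = F z i k l"
  shows "sum4 (insert z X) c F = sum4 X c F + 4 * (c z * (\<Sum>i\<in>X. \<Sum>j\<in>X. \<Sum>k\<in>X. c i * c j * c k * F z i j k))"
proof -
  define T where "T = (\<Sum>i\<in>X. \<Sum>j\<in>X. \<Sum>k\<in>X. c i * c j * c k * F z i j k)"
  have Tc: "c z * T = (\<Sum>i\<in>X. \<Sum>j\<in>X. \<Sum>k\<in>X. c z * c i * c j * c k * F z i j k)"
    by (simp add: T_def sum_distrib_left mult.assoc)
  have "(\<Sum>i\<in>X. \<Sum>j\<in>X. \<Sum>k\<in>X. c i * c z * c j * c k * F i z j k) = c z * T"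
    "(\<Sum>i\<in>X. \<Sum>j\<in>X. \<Sum>k\<in>X. c i * c j * c z * c k * F i j z k) = c z * T"
    "(\<Sum>i\<in>X. \<Sum>j\<in>X. \<Sum>k\<in>X. c i * c j * c k * c z * F i j k z) = c z * T"
    unfolding Tc by (intro sum.cong refl, simp add: mv)+
  then show ?thesis
    unfolding T_def[symmetric] using sum4_insert[where F=F, OF assms(1-8), of c] Tc by linarith
qed

text \<open>Only quadruples containing \<open>z\<close> have negative weight. Writing
  \<open>c z\<close> as minus the sum of the other weights introduces a fourth index in X, and
  symmetrization spreads the factor 4 over the four ways of omitting one index. The claim then holds
  quadruple by quadruple, by the five-point inequality.\<close>

lemma sum4_quad_nonpos:
  assumes V: "finite V" "V = insert z X" "z \<notin> X"
    and c: "\<And>i. i \<in> X \<Longrightarrow> c i \<ge> 0" "sum c V = 0"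
  shows "sum4 V c (quad V f) \<le> 0"
proof -
  have fin: "finite X"
    using V by simp
  have cz: "c z = - sum c X"
    using V c by simp
  define F where "F = quad V f"
  define T where "T = (\<Sum>i\<in>X. \<Sum>j\<in>X. \<Sum>k\<in>X. c i * c j * c k * F z i j k)"
  have mv: "F i z k l = F z i k l" "F i k z l = F z i k l" "F i k l z = F z i k l"
    if "i \<in> X" "k \<in> X" "l \<in> X" for i k l
  proof -
    show 1: "F i z k l = F z i k l"
      unfolding F_def by (rule quad_commute(1)) (use that V in auto)
    have 2: "F i k z l = F i z k l"
      unfolding F_def by (rule quad_commute(2)) (use that V in auto)
    have 3: "F i k l z = F i k z l"
      unfolding F_def by (rule quad_commute(3)) (use that V in auto)
    show "F i k z l = F z i k l" "F i k l z = F z i k l"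
      unfolding 3 2 1 by (rule refl)+
  qed
  have "sum4 V c F = sum4 X c F + 4 * (c z * T)"
    unfolding T_def V(2)
    by (rule sum4_insert_symmetric[where F=F, OF fin V(3) _ _ _ _ _ _ mv]) (simp_all only: F_def quad_coincide)
  moreover have "c z * T = - sum4 X c (\<lambda>i j k l. F z i j k)"
    unfolding T_def sum4_const cz by simp
  moreover have "4 * sum4 X c (\<lambda>i j k l. F z i j k) = sum4 X c (\<lambda>i j k l.
      F z j k l + F z i k l + F z i j l + F z i j k)"
    using sum4_swap34[of X c "\<lambda>i j k l. F z i j k"] sum4_swap23[of X c "\<lambda>i j k l. F z i j l"]
        sum4_swap12[of X c "\<lambda>i j k l. F z i k l"] unfolding sum4_add by linarith
  ultimately have "sum4 V c F = sum4 X c (\<lambda>i j k l. F i j k l - 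
      (F z j k l + F z i k l + F z i j l + F z i j k))"
    unfolding sum4_diff by linarith
  also have "\<dots> \<le> 0"
    unfolding sum4_def
  proof (intro sum_nonpos mult_nonneg_nonpos mult_nonneg_nonneg c)
    fix i j k l assume "i \<in> X" "j \<in> X" "k \<in> X" "l \<in> X"
    then show "F i j k l - (F z j k l + F z i k l + F z i j l + F z i j k) \<le> 0"
      using quad_five_points[of z i j k l V f, folded F_def] V by auto
  qed
  finally show ?thesis unfolding F_def .
qed

text \<open>For weights of total zero the norm terms cancel, so positivity of S says that the sum of
  \<open>d i * d j\<close> times the forms of \<open>1 - swp i j\<close> is nonpositive. Isolating
  the terms with \<open>z\<close>, whose weight is minus the sum of the others, gives the
  inequality.\<close>

lemma octopus:
  assumes V: "finite V" "z \<in> V" and c: "\<And>i. i \<in> V - {z} \<Longrightarrow> c i \<ge> 0"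
  shows "(\<Sum>i\<in>V-{z}. \<Sum>j\<in>V-{z}. c i * c j * (corr V f id - corr V f (swp i j)))
    \<le> 2 * sum c (V - {z}) * (\<Sum>i\<in>V-{z}. c i * (corr V f id - corr V f (swp z i)))"
proof -
  define X where "X = V - {z}"
  have X: "V = insert z X" "z \<notin> X" "finite X"
    using V by (auto simp: X_def)
  define d where "d = c(z := - sum c X)"
  have dX: "d i = c i" if "i \<in> X" for i
    using that X by (auto simp: d_def)
  have sd: "sum d X = sum c X"
    by (intro sum.cong) (auto simp: dX)
  have d0: "sum d V = 0"
    using X sd by (simp add: d_def)
  define q where "q = (\<Sum>k\<in>V. (d k)\<^sup>2)"
  define R where "R = (\<Sum>i\<in>V. \<Sum>j\<in>V. d i * d j * corr V f (swp i j))"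
  \<comment> \<open>From \<open>2 * q * S\<close> dominating the positive semidefinite
    \<open>S * S\<close>, the factor q can be cancelled unless it is zero, and then all weights are
    zero.\<close>
  have "R \<ge> 0"
  proof (cases "q = 0")
    case True
    then have "\<forall>i\<in>V. d i = 0"
      using V(1) by (simp add: q_def sum_nonneg_eq_0_iff)
    then show ?thesis by (simp add: R_def)
  next
    case False
    then have q: "q > 0"
      by (simp add: q_def order_less_le sum_nonneg)
    have "sum4 V d (quad V f) \<le> 0"
      by (rule sum4_quad_nonpos[OF V(1) X(1,2)]) (use c d0 dX in \<open>auto simp: X_def\<close>)
    then have "R * q \<ge> 0"
      using sum4_quad[OF d0, of f, folded R_def q_def] sum4_corr_dbl_nonneg[OF V(1), of d f] by linarith
    then show ?thesis
      using q by (simp add: zero_le_mult_iff)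
  qed
  moreover have "(\<Sum>i\<in>V. \<Sum>j\<in>V. d i * d j * corr V f id) = 0"
    using d0 by (simp add: sum_distrib_right[symmetric] sum_distrib_left[symmetric])
  ultimately have "(\<Sum>i\<in>V. \<Sum>j\<in>V. d i * d j * (corr V f id - corr V f (swp i j))) \<le> 0"
    by (simp add: R_def right_diff_distrib sum_subtractf)
  also have "(\<Sum>i\<in>V. \<Sum>j\<in>V. d i * d j * (corr V f id - corr V f (swp i j))) =
      (\<Sum>i\<in>X. \<Sum>j\<in>X. c i * c j * (corr V f id - corr V f (swp i j)))
      + 2 * d z * (\<Sum>i\<in>X. c i * (corr V f id - corr V f (swp z i)))"
  proof -
    define g where "g i j = d i * d j * (corr V f id - corr V f (swp i j))" for i j
    have "(\<Sum>i\<in>V. \<Sum>j\<in>V. g i j) = g z z + (\<Sum>j\<in>X. g z j) + (\<Sum>i\<in>X. g i z) + (\<Sum>i\<in>X. \<Sum>j\<in>X. g i j)"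
      unfolding X(1) using X(2,3) by (simp add: sum.distrib)
    moreover have "g z z = 0"
      by (simp add: g_def)
    moreover have "(\<Sum>i\<in>X. g i z) = (\<Sum>j\<in>X. g z j)"
      by (simp add: g_def transpose_commute mult.commute)
    moreover have "(\<Sum>j\<in>X. g z j) = d z * (\<Sum>i\<in>X. c i * (corr V f id - corr V f (swp z i)))"
      by (simp add: g_def sum_distrib_left dX mult.assoc)
    moreover have "(\<Sum>i\<in>X. \<Sum>j\<in>X. g i j) = (\<Sum>i\<in>X. \<Sum>j\<in>X. c i * c j * (corr V f id - corr V f (swp i j)))"
      by (simp add: g_def dX)
    ultimately show ?thesis
      unfolding g_def[symmetric] by simp
  qed
  finally show ?thesis
    by (simp add: d_def X_def)
qed

section \<open>Cosets and marginals\<close>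

text \<open>Passing to inverses turns the decomposition with left factors \<open>swp v k\<close>
  into one with right factors. Right factors are wanted because left multiplication by permutations
  of \<open>V - {v}\<close> then stays within each summand.\<close>

lemma sum_Sym_cosets:
  assumes "finite V" "v \<in> V"
  shows "(\<Sum>\<sigma>\<in>Sym V. F \<sigma>) = (\<Sum>k\<in>V. \<Sum>\<sigma>\<in>Sym (V - {v}). F (\<sigma> \<circ> swp k v))"
proof -
  have V: "insert v (V - {v}) = V"
    using assms by auto
  have "(\<Sum>\<sigma>\<in>Sym V. F \<sigma>) = (\<Sum>\<sigma>\<in>Sym (insert v (V - {v})). F (inv \<sigma>))"
    unfolding V by (rule sum_permutations_inverse)
  also have "\<dots> = (\<Sum>k\<in>V. \<Sum>\<sigma>\<in>Sym (V - {v}). F (inv (swp v k \<circ> \<sigma>)))"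
    using assms by (subst sum_over_permutations_insert) (auto simp: insert_absorb)
  also have "\<dots> = (\<Sum>k\<in>V. \<Sum>\<sigma>\<in>Sym (V - {v}). F (inv \<sigma> \<circ> swp k v))"
    by (intro sum.cong refl)
      (auto simp: o_inv_distrib permutes_bij transpose_commute[of v])
  also have "\<dots> = (\<Sum>k\<in>V. \<Sum>\<sigma>\<in>Sym (V - {v}). F (\<sigma> \<circ> swp k v))"
    by (intro sum.cong refl sum_permutations_inverse[symmetric])
  finally show ?thesis .
qed

lemma permutes_coset:
  assumes "\<sigma> permutes (V - {v})" "k \<in> V" "v \<in> V"
  shows "\<sigma> \<circ> swp k v permutes V"
  using assms by (intro permutes_compose permutes_swap_id) (auto intro: permutes_subset)

lemma corr_cosets:
  assumes "finite V" "v \<in> V"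
  shows "corr V f \<tau> = (\<Sum>k\<in>V. corr (V - {v}) (\<lambda>\<sigma>. f (\<sigma> \<circ> swp k v)) \<tau>)"
  unfolding corr_def by (subst sum_Sym_cosets[OF assms]) (simp add: o_assoc)

lemma permutes_eq_coset:
  assumes "\<sigma> permutes V" "k \<in> V" "\<sigma> k = v"
  obtains \<tau> where "\<tau> permutes (V - {v})" "\<sigma> = \<tau> \<circ> swp k v"
proof
  have v: "v \<in> V"
    using assms permutes_in_image by metis
  show "\<sigma> = (\<sigma> \<circ> swp k v) \<circ> swp k v"
    by (simp add: o_assoc[symmetric])
  have "\<sigma> \<circ> swp k v permutes V"
    using assms v by (intro permutes_compose permutes_swap_id)
  then show "\<sigma> \<circ> swp k v permutes V - {v}"
    by (rule permutes_superset) (use assms in auto)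
qed

definition marg :: "'a set \<Rightarrow> (('a \<Rightarrow> 'a) \<Rightarrow> real) \<Rightarrow> 'a \<Rightarrow> 'a \<Rightarrow> real" where
  "marg V f k a = (\<Sum>\<sigma>\<in>Sym V. if \<sigma> k = a then f \<sigma> else 0)"

definition zero_marg :: "'a set \<Rightarrow> (('a \<Rightarrow> 'a) \<Rightarrow> real) \<Rightarrow> bool" where
  "zero_marg V f \<longleftrightarrow> (\<forall>k\<in>V. \<forall>a\<in>V. marg V f k a = 0)"

lemma marg_coset:
  assumes "finite V" "v \<in> V" "k \<in> V"
  shows "marg V f k v = (\<Sum>\<sigma>\<in>Sym (V - {v}). f (\<sigma> \<circ> swp k v))"
proof -
  have "\<sigma> x = v \<longleftrightarrow> x = v" if "\<sigma> permutes (V - {v})" for \<sigma> x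
    using that by (metis DiffD2 insertI1 permutes_inverses(2) permutes_not_in)
  then have "marg V f k v = (\<Sum>b\<in>V. \<Sum>\<sigma>\<in>Sym (V - {v}). if b = k then f (\<sigma> \<circ> swp k v) else 0)"
    unfolding marg_def using assms
    by (subst sum_Sym_cosets[OF assms(1,2)]) (auto intro!: sum.cong simp: swp_app)
  also have "\<dots> = (\<Sum>b\<in>V. if b = k then \<Sum>\<sigma>\<in>Sym (V - {v}). f (\<sigma> \<circ> swp k v) else 0)"
    by (intro sum.cong) auto
  finally show ?thesis
    using assms by simp
qed

text \<open>The permutations taking \<open>i\<close> to \<open>a\<close> are the orbit of any one of
  them under left multiplication by the stabilizer of \<open>a\<close>.\<close>

lemma marg_orbit:
  assumes V: "finite V" and \<rho>: "\<rho> permutes V" and i: "i \<in> V" "\<rho> i = a"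
  shows "marg V D i a = (\<Sum>\<pi>\<in>Sym (V - {a}). D (\<pi> \<circ> \<rho>))"
proof -
  have a: "a \<in> V"
    using \<rho> i permutes_in_image by metis
  obtain \<theta> where \<theta>: "\<theta> permutes (V - {a})" "\<rho> = \<theta> \<circ> swp i a"
    using permutes_eq_coset[OF \<rho> i] .
  have "(\<Sum>\<pi>\<in>Sym (V - {a}). D (\<pi> \<circ> swp i a)) = (\<Sum>\<pi>\<in>Sym (V - {a}). D (\<pi> \<circ> \<rho>))"
  proof (rule sum.reindex_bij_witness[of _ "\<lambda>\<pi>. \<pi> \<circ> \<theta>" "\<lambda>\<pi>. \<pi> \<circ> inv \<theta>"])
    fix \<pi> :: "'a \<Rightarrow> 'a"
    have "(\<pi> \<circ> inv \<theta>) \<circ> \<rho> = \<pi> \<circ> (inv \<theta> \<circ> \<theta>) \<circ> swp i a"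
      unfolding \<theta>(2) by (simp only: o_assoc)
    then show "D ((\<pi> \<circ> inv \<theta>) \<circ> \<rho>) = D (\<pi> \<circ> swp i a)"
      by (simp only: permutes_inv_o[OF \<theta>(1)] comp_id)
    show "\<pi> \<circ> inv \<theta> \<circ> \<theta> = \<pi>" "\<pi> \<circ> \<theta> \<circ> inv \<theta> = \<pi>"
      by (simp_all only: o_assoc[symmetric] permutes_inv_o[OF \<theta>(1)] comp_id)
  qed (use \<theta> in \<open>auto intro!: permutes_compose permutes_inv\<close>)
  then show ?thesis
    by (simp add: marg_coset[OF V a i(1)])
qed

lemma sum_marg:
  assumes "finite V" "k \<in> V"
  shows "(\<Sum>a\<in>V. x a * marg V f k a) = (\<Sum>\<sigma>\<in>Sym V. x (\<sigma> k) * f \<sigma>)"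
proof -
  have "(\<Sum>a\<in>V. x a * marg V f k a) = (\<Sum>\<sigma>\<in>Sym V. \<Sum>a\<in>V. if \<sigma> k = a then x a * f \<sigma> else 0)"
    unfolding marg_def sum_distrib_left by (subst sum.swap) (intro sum.cong, auto)
  also have "\<dots> = (\<Sum>\<sigma>\<in>Sym V. x (\<sigma> k) * f \<sigma>)"
    using assms by (intro sum.cong refl) (simp add: permutes_in_image)
  finally show ?thesis .
qed

lemma sum_marg_position:
  assumes "finite V" "a \<in> V"
  shows "(\<Sum>k\<in>V. marg V f k a) = (\<Sum>\<sigma>\<in>Sym V. f \<sigma>)"
  using sum_Sym_cosets[OF assms, of f] marg_coset[OF assms, of _ f] by simp

text \<open>In terms of the irreducibles occurring in \<open>f\<close>, this relation excludes Young
  diagrams with two boxes in the second row, and \<open>triple_alt\<close> excludes those with a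
  third row. What is left are the trivial and the standard representation, that is, the additive
  functions.\<close>

definition square_alt :: "'a set \<Rightarrow> (('a \<Rightarrow> 'a) \<Rightarrow> real) \<Rightarrow> bool" where
  "square_alt V f \<longleftrightarrow> (\<forall>a\<in>V. \<forall>b\<in>V. \<forall>c\<in>V. \<forall>d\<in>V. \<forall>\<sigma>\<in>Sym V. distinct [a, b, c, d] \<longrightarrow>
     f \<sigma> + f (swp a b \<circ> (swp c d \<circ> \<sigma>)) = f (swp a b \<circ> \<sigma>) + f (swp c d \<circ> \<sigma>))"

definition triple_alt :: "'a set \<Rightarrow> (('a \<Rightarrow> 'a) \<Rightarrow> real) \<Rightarrow> bool" where
  "triple_alt V f \<longleftrightarrow> (\<forall>a\<in>V. \<forall>b\<in>V. \<forall>c\<in>V. \<forall>\<sigma>\<in>Sym V. distinct [a, b, c] \<longrightarrow>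
     f \<sigma> + f (cyc a b c \<circ> \<sigma>) + f (cyc a c b \<circ> \<sigma>) =
     f (swp a b \<circ> \<sigma>) + f (swp b c \<circ> \<sigma>) + f (swp a c \<circ> \<sigma>))"

lemma card_Sym_minus: "finite V \<Longrightarrow> card (Sym V) = fact (card V)"
  using card_permutations by blast

text \<open>
  For fixed \<open>a \<noteq> b\<close> the difference \<open>D \<sigma> = f \<sigma> - f (swp a b \<circ> \<sigma>)\<close> depends only on the positions of \<open>a\<close>
  and \<open>b\<close>; summing the triple relation over the third value and using the vanishing marginals gives
  \<open>card V * D \<sigma> = 0\<close>.
\<close>

lemma alt_zero_marg_swp:
  assumes V: "finite V" and zm: "zero_marg V f" and sq: "square_alt V f" and tr: "triple_alt V f"
    and ab: "a \<in> V" "b \<in> V" "a \<noteq> b" and \<sigma>: "\<sigma> permutes V"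
  shows "f (swp a b \<circ> \<sigma>) = f \<sigma>"
proof -
  define D where "D \<rho> = f \<rho> - f (swp a b \<circ> \<rho>)" for \<rho>
  define W where "W = V - {a} - {b}"
  have fW: "finite W"
    using V by (simp add: W_def)
  have inv: "D (\<pi> \<circ> \<rho>) = D \<rho>" if \<pi>: "\<pi> permutes W" and \<rho>: "\<rho> permutes V" for \<pi> \<rho>
    using \<pi> fW
  proof (induction rule: permutes_induct)
    case (swap c d p)
    have "p permutes V"
      using swap.hyps by (auto simp: W_def intro: permutes_subset)
    then have "p \<circ> \<rho> permutes V"
      using \<rho> by (rule permutes_compose[rotated])
    then have "f (p \<circ> \<rho>) + f (swp a b \<circ> (swp c d \<circ> (p \<circ> \<rho>))) = f (swp a b \<circ> (p \<circ> \<rho>)) + f (swp c d \<circ> (p \<circ> \<rho>))"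
      using sq swap.hyps ab unfolding square_alt_def W_def by auto
    then have "D (swp c d \<circ> (p \<circ> \<rho>)) = D (p \<circ> \<rho>)"
      unfolding D_def by simp
    then show ?case
      unfolding o_assoc using swap.IH by (rule trans)
  qed simp
  have D_sum: "D \<rho> + (\<Sum>c\<in>W. D (swp b c \<circ> \<rho>)) = 0" if \<rho>: "\<rho> permutes V" for \<rho>
  proof -
    define i where "i = inv \<rho> a"
    have i: "i \<in> V" "\<rho> i = a"
      using \<rho> ab by (auto simp: i_def permutes_inverses permutes_in_image[OF permutes_inv[OF \<rho>]])
    have iD: "(\<Sum>\<pi>\<in>Sym (V - {a}). D (\<pi> \<circ> swp i a)) = 0"
    proof -
      have "(\<Sum>\<pi>\<in>Sym (V - {a}). f (swp a b \<circ> (\<pi> \<circ> swp i a))) = marg V (\<lambda>\<sigma>. f (swp a b \<circ> \<sigma>)) i a"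
        using marg_coset[OF V ab(1) i(1), of "\<lambda>\<sigma>. f (swp a b \<circ> \<sigma>)"] by simp
      also have "\<dots> = marg V f i b"
      proof -
        have "marg V f i b = (\<Sum>\<sigma>\<in>Sym V. if (swp a b \<circ> \<sigma>) i = b then f (swp a b \<circ> \<sigma>) else 0)"
          unfolding marg_def
          by (rule sum_Sym_shift[symmetric, where h="\<lambda>\<sigma>. if \<sigma> i = b then f \<sigma> else 0"])
            (simp add: permutes_swap_id ab)
        also have "\<dots> = marg V (\<lambda>\<sigma>. f (swp a b \<circ> \<sigma>)) i a"
          unfolding marg_def using ab by (intro sum.cong refl) (auto simp: swp_app)
        finally show ?thesis ..
      qed
      finally show ?thesis
        using zm marg_coset[OF V ab(1) i(1), of f] i ab
        by (simp add: D_def sum_subtractf zero_marg_def)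
    qed
    \<comment> \<open>The orbit sum \<open>iD\<close> splits into cosets of \<open>Sym W\<close>, on
      each of which D is constant by \<open>inv\<close>. The coset with \<open>c = b\<close>
      contributes \<open>D \<rho>\<close>, the others the sum over W.\<close>
    have "(\<Sum>\<pi>\<in>Sym (V - {a}). D (\<pi> \<circ> swp i a)) = (\<Sum>\<pi>\<in>Sym (V - {a}). D (\<pi> \<circ> \<rho>))"
      using marg_orbit[OF V \<rho> i, of D] marg_coset[OF V ab(1) i(1), of D] by simp
    also have "\<dots> = (\<Sum>c\<in>V-{a}. \<Sum>\<pi>\<in>Sym W. D ((\<pi> \<circ> swp c b) \<circ> \<rho>))"
      unfolding W_def using V ab by (intro sum_Sym_cosets) auto
    also have "\<dots> = (\<Sum>c\<in>V-{a}. \<Sum>\<pi>\<in>Sym W. D (swp c b \<circ> \<rho>))"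
    proof (intro sum.cong refl)
      fix c \<pi> assume "c \<in> V - {a}" "\<pi> \<in> Sym W"
      then show "D ((\<pi> \<circ> swp c b) \<circ> \<rho>) = D (swp c b \<circ> \<rho>)"
        unfolding o_assoc[symmetric] using \<rho> ab
        by (intro inv permutes_compose permutes_swap_id) auto
    qed
    also have "\<dots> = fact (card W) * (\<Sum>c\<in>V-{a}. D (swp c b \<circ> \<rho>))"
      by (simp add: card_Sym_minus[OF fW] sum_distrib_left)
    finally have "(\<Sum>c\<in>V-{a}. D (swp c b \<circ> \<rho>)) = 0"
      using iD by simp
    moreover have "V - {a} = insert b W" "b \<notin> W"
      using ab by (auto simp: W_def)
    ultimately show ?thesis
      using fW by (simp add: transpose_commute)
  qed
  have anti: "D (swp a b \<circ> \<rho>) = - D \<rho>" for \<rho>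
    by (simp add: D_def o_assoc)
  have tri: "D \<sigma> - D (swp b c \<circ> \<sigma>) + D (swp b c \<circ> (swp a b \<circ> \<sigma>)) = 0" if "c \<in> W" for c
  proof -
    have d: "c \<in> V" "distinct [a, b, c]"
      using that ab by (auto simp: W_def)
    have "swp a b \<circ> (swp b c \<circ> \<sigma>) = cyc a b c \<circ> \<sigma>" "swp b c \<circ> (swp a b \<circ> \<sigma>) = cyc a c b \<circ> \<sigma>"
      "swp a b \<circ> (swp b c \<circ> (swp a b \<circ> \<sigma>)) = swp a c \<circ> \<sigma>"
      using d by (auto simp: cyc_def fun_eq_iff swp_app)
    moreover have "f \<sigma> + f (cyc a b c \<circ> \<sigma>) + f (cyc a c b \<circ> \<sigma>) =
        f (swp a b \<circ> \<sigma>) + f (swp b c \<circ> \<sigma>) + f (swp a c \<circ> \<sigma>)"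
      using tr d ab \<sigma> by (simp add: triple_alt_def)
    ultimately show ?thesis
      unfolding D_def by simp
  qed
  have \<sigma>': "swp a b \<circ> \<sigma> permutes V"
    using \<sigma> ab by (intro permutes_compose permutes_swap_id)
  have "(\<Sum>c\<in>W. D \<sigma> - D (swp b c \<circ> \<sigma>) + D (swp b c \<circ> (swp a b \<circ> \<sigma>))) = 0"
    by (intro sum.neutral ballI tri)
  \<comment> \<open>By \<open>D_sum\<close> the second terms add up to \<open>- D \<sigma>\<close>
    and the third to \<open>- D (swp a b \<circ> \<sigma>) = D \<sigma>\<close>; hence the total
    coefficient \<open>card W + 2 = card V\<close>.\<close>
  then have "real (card W) * D \<sigma> + D \<sigma> + D \<sigma> = 0"
    using D_sum[OF \<sigma>] D_sum[OF \<sigma>'] anti[of \<sigma>] by (simp add: sum.distrib sum_subtractf)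
  then have "(real (card W) + 2) * D \<sigma> = 0"
    by (simp add: algebra_simps)
  then have "D \<sigma> = 0"
    by (simp add: add_nonneg_eq_0_iff)
  then show ?thesis
    by (simp add: D_def)
qed

lemma alt_zero_marg_zero:
  assumes V: "finite V" "V \<noteq> {}" and zm: "zero_marg V f" and sq: "square_alt V f" and tr: "triple_alt V f"
    and \<sigma>: "\<sigma> permutes V"
  shows "f \<sigma> = 0"
proof -
  have const: "f \<rho> = f id" if "\<rho> permutes V" for \<rho>
    using that V(1)
  proof (induction rule: permutes_induct)
    case (swap a b p)
    then show ?case
      using alt_zero_marg_swp[OF V(1) zm sq tr swap.hyps(1-3), of p] by (metis trans)
  qed simp
  obtain v where v: "v \<in> V"
    using V by auto
  have "0 = marg V f v v"
    using zm v by (simp add: zero_marg_def)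
  also have "\<dots> = (\<Sum>\<sigma>\<in>Sym (V - {v}). f (\<sigma> \<circ> swp v v))"
    using V v by (intro marg_coset)
  also have "\<dots> = (\<Sum>\<sigma>\<in>Sym (V - {v}). f id)"
    by (intro sum.cong refl const permutes_coset) (use v in auto)
  also have "\<dots> = fact (card (V - {v})) * f id"
    using V by (simp add: card_Sym_minus)
  finally show ?thesis
    using const[OF \<sigma>] by simp
qed

lemma square_alt_add:
  assumes "square_alt V f" "square_alt V g"
  shows "square_alt V (\<lambda>\<sigma>. f \<sigma> + g \<sigma>)"
  unfolding square_alt_def
proof (intro ballI impI)
  fix a b c d \<sigma> assume *: "a \<in> V" "b \<in> V" "c \<in> V" "d \<in> V" "\<sigma> \<in> Sym V" "distinct [a, b, c, d]"
  show "f \<sigma> + g \<sigma> + (f (swp a b \<circ> (swp c d \<circ> \<sigma>)) + g (swp a b \<circ> (swp c d \<circ> \<sigma>))) =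
    f (swp a b \<circ> \<sigma>) + g (swp a b \<circ> \<sigma>) + (f (swp c d \<circ> \<sigma>) + g (swp c d \<circ> \<sigma>))"
    using assms[unfolded square_alt_def, rule_format, OF *] by linarith
qed

lemma triple_alt_add:
  assumes "triple_alt V f" "triple_alt V g"
  shows "triple_alt V (\<lambda>\<sigma>. f \<sigma> + g \<sigma>)"
  unfolding triple_alt_def
proof (intro ballI impI)
  fix a b c \<sigma> assume *: "a \<in> V" "b \<in> V" "c \<in> V" "\<sigma> \<in> Sym V" "distinct [a, b, c]"
  show "f \<sigma> + g \<sigma> + (f (cyc a b c \<circ> \<sigma>) + g (cyc a b c \<circ> \<sigma>)) + (f (cyc a c b \<circ> \<sigma>) + g (cyc a c b \<circ> \<sigma>)) =
    f (swp a b \<circ> \<sigma>) + g (swp a b \<circ> \<sigma>) + (f (swp b c \<circ> \<sigma>) + g (swp b c \<circ> \<sigma>)) + (f (swp a c \<circ> \<sigma>) + g (swp a c \<circ> \<sigma>))"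
    using assms[unfolded triple_alt_def, rule_format, OF *] by linarith
qed

lemma square_alt_additive: "square_alt V (\<lambda>\<sigma>. \<Sum>k\<in>V. x k (\<sigma> k))"
proof -
  have "(\<Sum>k\<in>V. x k (\<sigma> k)) + (\<Sum>k\<in>V. x k (swp a b (swp c d (\<sigma> k)))) =
      (\<Sum>k\<in>V. x k (swp a b (\<sigma> k))) + (\<Sum>k\<in>V. x k (swp c d (\<sigma> k)))"
    if "distinct [a, b, c, d]" for a b c d \<sigma>
    unfolding sum.distrib[symmetric] by (intro sum.cong refl) (use that in \<open>auto simp: swp_app\<close>)
  then show ?thesis
    by (simp add: square_alt_def)
qed

lemma triple_alt_additive: "triple_alt V (\<lambda>\<sigma>. \<Sum>k\<in>V. x k (\<sigma> k))"
proof -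
  have "(\<Sum>k\<in>V. x k (\<sigma> k)) + (\<Sum>k\<in>V. x k (cyc a b c (\<sigma> k))) + (\<Sum>k\<in>V. x k (cyc a c b (\<sigma> k))) =
      (\<Sum>k\<in>V. x k (swp a b (\<sigma> k))) + (\<Sum>k\<in>V. x k (swp b c (\<sigma> k))) + (\<Sum>k\<in>V. x k (swp a c (\<sigma> k)))"
    if "distinct [a, b, c]" for a b c \<sigma>
    unfolding sum.distrib[symmetric] by (intro sum.cong refl) (use that in \<open>auto simp: cyc_def swp_app\<close>)
  then show ?thesis
    by (simp add: triple_alt_def)
qed

section \<open>Reduction to vanishing marginals\<close>

text \<open>Loops are allowed because \<open>red\<close> puts weight on the diagonal; in the
  operators and forms below they are multiplied by 0.\<close>

definition wgraph :: "'a set \<Rightarrow> ('a \<Rightarrow> 'a \<Rightarrow> real) \<Rightarrow> bool" where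
  "wgraph V c \<longleftrightarrow> (\<forall>i\<in>V. \<forall>j\<in>V. c i j = c j i \<and> 0 \<le> c i j)"

text \<open>
  Since the sums run over ordered pairs, \<open>Lop\<close> and \<open>lap\<close> are twice the interchange operator and twice
  the graph Laplacian, and \<open>Q\<close> and \<open>Ev\<close> are twice their quadratic forms.
\<close>

definition Lop :: "'a set \<Rightarrow> ('a \<Rightarrow> 'a \<Rightarrow> real) \<Rightarrow> (('a \<Rightarrow> 'a) \<Rightarrow> real) \<Rightarrow> ('a \<Rightarrow> 'a) \<Rightarrow> real" where
  "Lop V c f \<sigma> = (\<Sum>i\<in>V. \<Sum>j\<in>V. c i j * (f \<sigma> - f (swp i j \<circ> \<sigma>)))"

definition lap :: "'a set \<Rightarrow> ('a \<Rightarrow> 'a \<Rightarrow> real) \<Rightarrow> ('a \<Rightarrow> real) \<Rightarrow> 'a \<Rightarrow> real" where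
  "lap V c x a = 2 * (\<Sum>j\<in>V. c a j * (x a - x j))"

definition Ev :: "'a set \<Rightarrow> ('a \<Rightarrow> 'a \<Rightarrow> real) \<Rightarrow> ('a \<Rightarrow> real) \<Rightarrow> real" where
  "Ev V c x = (\<Sum>i\<in>V. \<Sum>j\<in>V. c i j * (x i - x j)\<^sup>2)"

definition Q :: "'a set \<Rightarrow> ('a \<Rightarrow> 'a \<Rightarrow> real) \<Rightarrow> (('a \<Rightarrow> 'a) \<Rightarrow> real) \<Rightarrow> real" where
  "Q V c f = (\<Sum>i\<in>V. \<Sum>j\<in>V. c i j * (corr V f id - corr V f (swp i j)))"

text \<open>The gap bound in variational form, which passes to reduced graphs without mention of
  eigenvalues. The factor 2 matches the normalization of \<open>Ev\<close>.\<close>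

definition gap_ge :: "'a set \<Rightarrow> ('a \<Rightarrow> 'a \<Rightarrow> real) \<Rightarrow> real \<Rightarrow> bool" where
  "gap_ge V c \<mu> \<longleftrightarrow> (\<forall>x. sum x V = 0 \<longrightarrow> 2 * \<mu> * (\<Sum>i\<in>V. (x i)\<^sup>2) \<le> Ev V c x)"

lemma ip_Lop_aux:
  "ip (Sym V) f (Lop V c g) = (\<Sum>i\<in>V. \<Sum>j\<in>V. c i j * (ip (Sym V) f g - (\<Sum>\<sigma>\<in>Sym V. f \<sigma> * g (swp i j \<circ> \<sigma>))))"
proof -
  have "ip (Sym V) f (Lop V c g) =
      (\<Sum>\<sigma>\<in>Sym V. \<Sum>i\<in>V. \<Sum>j\<in>V. c i j * (f \<sigma> * g \<sigma> - f \<sigma> * g (swp i j \<circ> \<sigma>)))"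
    by (simp add: ip_def Lop_def sum_distrib_left algebra_simps)
  also have "\<dots> = (\<Sum>i\<in>V. \<Sum>j\<in>V. \<Sum>\<sigma>\<in>Sym V. c i j * (f \<sigma> * g \<sigma> - f \<sigma> * g (swp i j \<circ> \<sigma>)))"
    by (subst sum.swap) (intro sum.cong refl sum.swap)
  finally show ?thesis
    by (simp add: ip_def sum_subtractf sum_distrib_left[symmetric])
qed

lemma ip_Lop: "ip (Sym V) f (Lop V c f) = Q V c f"
  unfolding ip_Lop_aux Q_def corr_id by (simp add: ip_def corr_def power2_eq_square)

lemma ip_commute: "ip X f g = ip X g f"
  by (simp add: ip_def mult.commute)

lemma ip_add_left: "ip X (\<lambda>x. f x + g x) h = ip X f h + ip X g h"
  by (simp add: ip_def distrib_right sum.distrib)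

lemma ip_add_right: "ip X h (\<lambda>x. f x + g x) = ip X h f + ip X h g"
  by (simp add: ip_def distrib_left sum.distrib)

lemma ip_Lop_commute: "ip (Sym V) f (Lop V c g) = ip (Sym V) (Lop V c f) g"
proof -
  have "(\<Sum>\<sigma>\<in>Sym V. f \<sigma> * g (swp i j \<circ> \<sigma>)) = (\<Sum>\<sigma>\<in>Sym V. g \<sigma> * f (swp i j \<circ> \<sigma>))"
    if "i \<in> V" "j \<in> V" for i j
    unfolding sum_Sym_swp[OF that, of f g] by (simp add: mult.commute)
  then show ?thesis
    unfolding ip_commute[of _ "Lop V c f" g] ip_Lop_aux ip_commute[of _ g f] by simp
qed

lemma Q_nonneg:
  assumes "wgraph V c"
  shows "Q V c f \<ge> 0"
  unfolding Q_def using assms corr_swp_le[of _ V _ f]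
  by (intro sum_nonneg mult_nonneg_nonneg) (auto simp: wgraph_def)

text \<open>A function of \<open>\<sigma> k\<close> alone follows a single particle: only
  transpositions moving \<open>\<sigma> k\<close> contribute, and each occurs as two ordered pairs,
  which is the factor 2 in \<open>lap\<close>.\<close>

lemma Lop_additive:
  assumes V: "finite V" "wgraph V c" and "\<sigma> permutes V" "k \<in> V"
  shows "Lop V c (\<lambda>\<sigma>. x (\<sigma> k)) \<sigma> = lap V c x (\<sigma> k)"
proof -
  define a where "a = \<sigma> k"
  have a: "a \<in> V"
    using assms by (simp add: a_def permutes_in_image)
  have "Lop V c (\<lambda>\<sigma>. x (\<sigma> k)) \<sigma> =
      (\<Sum>i\<in>V. \<Sum>j\<in>V. (if i = a then c a j * (x a - x j) else 0) + (if j = a then c i a * (x a - x i) else 0))"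
    unfolding Lop_def by (intro sum.cong refl) (auto simp: a_def swp_app)
  also have "\<dots> = (\<Sum>i\<in>V. \<Sum>j\<in>V. if i = a then c a j * (x a - x j) else 0) + (\<Sum>i\<in>V. c i a * (x a - x i))"
    using V a by (simp add: sum.distrib)
  also have "(\<Sum>i\<in>V. \<Sum>j\<in>V. if i = a then c a j * (x a - x j) else 0) = (\<Sum>j\<in>V. c a j * (x a - x j))"
    using V a by (subst sum.swap) simp
  also have "(\<Sum>i\<in>V. c i a * (x a - x i)) = (\<Sum>j\<in>V. c a j * (x a - x j))"
    using V a by (intro sum.cong) (auto simp: wgraph_def)
  finally show ?thesis
    by (simp add: lap_def a_def)
qed

lemma sum_lap:
  assumes "wgraph V c"
  shows "(\<Sum>a\<in>V. lap V c x a * x a) = Ev V c x"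
proof -
  have "(\<Sum>i\<in>V. \<Sum>j\<in>V. c i j * (x i * x i)) = (\<Sum>i\<in>V. \<Sum>j\<in>V. c i j * (x j * x j))"
    by (subst sum.swap) (use assms in \<open>auto simp: wgraph_def intro!: sum.cong\<close>)
  moreover have "Ev V c x = (\<Sum>i\<in>V. \<Sum>j\<in>V. 2 * (c i j * (x i - x j)) * x i + (c i j * (x j * x j) - c i j * (x i * x i)))"
    unfolding Ev_def by (intro sum.cong refl) (simp add: power2_eq_square algebra_simps)
  moreover have "(\<Sum>a\<in>V. lap V c x a * x a) = (\<Sum>i\<in>V. \<Sum>j\<in>V. 2 * (c i j * (x i - x j)) * x i)"
    by (simp add: lap_def sum_distrib_left sum_distrib_right)
  ultimately show ?thesis
    by (simp only: sum.distrib sum_subtractf diff_self add_0_right)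
qed

text \<open>For functions of total sum zero, the orthogonal projection onto the additive functions.
  With n points the denominator is \<open>fact (n - 1) + fact (n - 2)\<close>: by
  \<open>marg_point\<close> the marginal at l of the summand k = l carries the first factor, while
  the other summands, since the marginals at a fixed value add up to zero over all positions,
  contribute the second.\<close>

definition proj :: "'a set \<Rightarrow> (('a \<Rightarrow> 'a) \<Rightarrow> real) \<Rightarrow> ('a \<Rightarrow> 'a) \<Rightarrow> real" where
  "proj V f \<sigma> = (\<Sum>k\<in>V. marg V f k (\<sigma> k) / (real (card V) * fact (card V - 2)))"

lemma marg_sum: "marg V (\<lambda>\<sigma>. \<Sum>k\<in>S. F k \<sigma>) l a = (\<Sum>k\<in>S. marg V (F k) l a)"
proof -
  have "marg V (\<lambda>\<sigma>. \<Sum>k\<in>S. F k \<sigma>) l a = (\<Sum>\<sigma>\<in>Sym V. \<Sum>k\<in>S. if \<sigma> l = a then F k \<sigma> else 0)"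
    unfolding marg_def by (intro sum.cong) auto
  then show ?thesis
    unfolding marg_def by (subst sum.swap) 
qed

lemma marg_diff: "marg V (\<lambda>\<sigma>. f \<sigma> - g \<sigma>) k a = marg V f k a - marg V g k a"
  unfolding marg_def sum_subtractf[symmetric] by (intro sum.cong) auto

lemma sum_Sym_point:
  fixes G :: "'a \<Rightarrow> real"
  assumes "finite V" "k \<in> V"
  shows "(\<Sum>\<sigma>\<in>Sym V. G (\<sigma> k)) = fact (card V - 1) * sum G V"
proof -
  have "(\<Sum>\<sigma>\<in>Sym V. G (\<sigma> k)) = (\<Sum>a\<in>V. G a * marg V (\<lambda>_. 1) k a)"
    using sum_marg[OF assms, of G "\<lambda>_. 1"] by simp
  also have "\<dots> = (\<Sum>a\<in>V. G a * fact (card V - 1))"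
    using assms by (intro sum.cong refl) (simp add: marg_coset card_Sym_minus)
  finally show ?thesis
    by (simp add: sum_distrib_right[symmetric] mult.commute)
qed

lemma marg_point:
  assumes V: "finite V" "k \<in> V" "l \<in> V" "a \<in> V"
  shows "marg V (\<lambda>\<sigma>. G (\<sigma> k)) l a =
    (if k = l then fact (card V - 1) * G a else fact (card V - 2) * (sum G V - G a))"
proof (cases "k = l")
  case True
  have "marg V (\<lambda>\<sigma>. G (\<sigma> k)) l a = (\<Sum>\<sigma>\<in>Sym (V - {a}). G a)"
    unfolding marg_coset[OF V(1,4,3)] using True
    by (intro sum.cong refl) (auto simp: permutes_not_in)
  then show ?thesis
    using True V by (simp add: card_Sym_minus)
next
  case False
  have k: "swp l a k \<in> V - {a}"
    using False V by (auto simp: swp_app)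
  have "marg V (\<lambda>\<sigma>. G (\<sigma> k)) l a = (\<Sum>\<sigma>\<in>Sym (V - {a}). G (\<sigma> (swp l a k)))"
    unfolding marg_coset[OF V(1,4,3)] by simp
  also have "\<dots> = fact (card V - 2) * sum G (V - {a})"
    using V k by (subst sum_Sym_point) (auto simp: numeral_2_eq_2)
  finally show ?thesis
    using False V by (simp add: sum_diff1)
qed

lemma zero_marg_diff_proj:
  assumes V: "finite V" "2 \<le> card V" and f: "(\<Sum>\<sigma>\<in>Sym V. f \<sigma>) = 0"
  shows "zero_marg V (\<lambda>\<sigma>. f \<sigma> - proj V f \<sigma>)"
  unfolding zero_marg_def
proof (intro ballI)
  fix l a assume la: "l \<in> V" "a \<in> V"
  define r where "r = real (card V) * fact (card V - 2)"
  define M where "M = marg V f"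
  obtain n where n: "card V = Suc (Suc n)"
    using V(2) by (metis Suc_le_D numeral_2_eq_2 Suc_le_mono)
  have r: "r \<noteq> 0"
    using n by (simp add: r_def)
  have Mtot: "(\<Sum>b\<in>V. M k b / r) = 0" if "k \<in> V" for k
    using sum_marg[OF V(1) that, of "\<lambda>_. 1" f] f by (simp add: M_def sum_divide_distrib[symmetric])
  have "marg V (proj V f) l a = (\<Sum>k\<in>V. marg V (\<lambda>\<sigma>. M k (\<sigma> k) / r) l a)"
    unfolding proj_def marg_sum M_def r_def ..
  also have "\<dots> = (\<Sum>k\<in>V. if k = l then fact (card V - 1) * (M l a / r) else - fact (card V - 2) * (M k a / r))"
    using marg_point[OF V(1) _ la, of _ "\<lambda>b. M _ b / r"] by (intro sum.cong refl) (simp add: Mtot)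
  also have "\<dots> = (\<Sum>k\<in>V. (if k = l then (fact (card V - 1) + fact (card V - 2)) * (M l a / r) else 0)
      - fact (card V - 2) * (M k a / r))"
    by (intro sum.cong refl) (auto simp: algebra_simps)
  also have "\<dots> = (fact (card V - 1) + fact (card V - 2)) * (M l a / r) - fact (card V - 2) * ((\<Sum>k\<in>V. M k a) / r)"
    using V la by (simp add: sum_subtractf sum_distrib_left sum_divide_distrib)
  also have "(\<Sum>k\<in>V. M k a) = 0"
    unfolding M_def using sum_marg_position[OF V(1) la(2)] f by simp
  also have "fact (card V - 1) + fact (card V - 2) = r"
    by (simp add: r_def n algebra_simps)
  finally show "marg V (\<lambda>\<sigma>. f \<sigma> - proj V f \<sigma>) l a = 0"
    using r by (simp add: marg_diff M_def)
qed

lemma ip_additive: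
  assumes "finite V"
  shows "ip (Sym V) (\<lambda>\<sigma>. \<Sum>k\<in>V. X k (\<sigma> k)) g = (\<Sum>k\<in>V. \<Sum>a\<in>V. X k a * marg V g k a)"
proof -
  have "ip (Sym V) (\<lambda>\<sigma>. \<Sum>k\<in>V. X k (\<sigma> k)) g = (\<Sum>k\<in>V. \<Sum>\<sigma>\<in>Sym V. X k (\<sigma> k) * g \<sigma>)"
    unfolding ip_def sum_distrib_right by (rule sum.swap)
  then show ?thesis
    using sum_marg[OF assms] by simp
qed

lemma Lop_sum: "Lop V c (\<lambda>\<sigma>. \<Sum>k\<in>S. F k \<sigma>) \<sigma> = (\<Sum>k\<in>S. Lop V c (F k) \<sigma>)"
proof -
  have "Lop V c (\<lambda>\<sigma>. \<Sum>k\<in>S. F k \<sigma>) \<sigma> = (\<Sum>i\<in>V. \<Sum>j\<in>V. \<Sum>k\<in>S. c i j * (F k \<sigma> - F k (swp i j \<circ> \<sigma>)))"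
    by (simp add: Lop_def sum_subtractf[symmetric] sum_distrib_left)
  also have "\<dots> = (\<Sum>k\<in>S. \<Sum>i\<in>V. \<Sum>j\<in>V. c i j * (F k \<sigma> - F k (swp i j \<circ> \<sigma>)))"
    by (subst sum.swap[of _ V S], subst sum.swap[of _ V S]) (rule refl)
  finally show ?thesis
    by (simp add: Lop_def)
qed

lemma lap_divide: "lap V c (\<lambda>a. x a / r) b = lap V c x b / r"
  by (simp add: lap_def sum_divide_distrib[symmetric] diff_divide_distrib[symmetric])

lemma Lop_proj:
  assumes "finite V" "wgraph V c" "\<sigma> permutes V"
  shows "Lop V c (proj V f) \<sigma> = (\<Sum>k\<in>V. lap V c (marg V f k) (\<sigma> k) / (real (card V) * fact (card V - 2)))"
proof -
  have "Lop V c (proj V f) \<sigma> =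
      (\<Sum>k\<in>V. Lop V c (\<lambda>\<sigma>. marg V f k (\<sigma> k) / (real (card V) * fact (card V - 2))) \<sigma>)"
    unfolding proj_def by (rule Lop_sum)
  also have "\<dots> = (\<Sum>k\<in>V. lap V c (\<lambda>a. marg V f k a / (real (card V) * fact (card V - 2))) (\<sigma> k))"
    by (intro sum.cong refl Lop_additive assms)
  finally show ?thesis
    by (simp add: lap_divide)
qed

lemma Lop_add: "Lop V c (\<lambda>\<sigma>. f \<sigma> + g \<sigma>) \<sigma> = Lop V c f \<sigma> + Lop V c g \<sigma>"
  by (simp add: Lop_def algebra_simps sum.distrib sum_subtractf)

lemma ip_proj_zero_marg:
  assumes "finite V" "zero_marg V g"
  shows "ip (Sym V) (proj V f) g = 0"
proof -
  have "ip (Sym V) (\<lambda>\<sigma>. \<Sum>k\<in>V. marg V f k (\<sigma> k) / (real (card V) * fact (card V - 2))) g = 0"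
    using assms by (subst ip_additive) (auto simp: zero_marg_def)
  then show ?thesis
    by (simp add: proj_def[abs_def])
qed

lemma ip_Lop_proj:
  assumes "finite V" "wgraph V c"
  shows "ip (Sym V) (Lop V c (proj V f)) g =
    (\<Sum>k\<in>V. \<Sum>a\<in>V. lap V c (marg V f k) a / (real (card V) * fact (card V - 2)) * marg V g k a)"
proof -
  have "ip (Sym V) (Lop V c (proj V f)) g =
      ip (Sym V) (\<lambda>\<sigma>. \<Sum>k\<in>V. lap V c (marg V f k) (\<sigma> k) / (real (card V) * fact (card V - 2))) g"
    unfolding ip_def by (intro sum.cong refl) (simp add: Lop_proj[OF assms])
  also have "\<dots> = (\<Sum>k\<in>V. \<Sum>a\<in>V. lap V c (marg V f k) a / (real (card V) * fact (card V - 2)) * marg V g k a)"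
    by (rule ip_additive[OF assms(1), of "\<lambda>k b. lap V c (marg V f k) b / (real (card V) * fact (card V - 2))"])
  finally show ?thesis .
qed

text \<open>The splitting of \<open>f\<close> into \<open>w = proj V f\<close> and \<open>g\<close>
  is orthogonal for the inner product and for \<open>Q\<close>. On \<open>w\<close> the operator
  acts on every marginal as the Laplacian, so \<open>w\<close> itself satisfies the gap inequality,
  and removing it cannot increase the excess of \<open>Q\<close>.\<close>

lemma Q_diff_proj_le:
  assumes V: "finite V" "2 \<le> card V" "wgraph V c" and gap: "gap_ge V c \<mu>"
    and f: "(\<Sum>\<sigma>\<in>Sym V. f \<sigma>) = 0"
  defines "g \<equiv> \<lambda>\<sigma>. f \<sigma> - proj V f \<sigma>"
  shows "Q V c g - 2 * \<mu> * corr V g id \<le> Q V c f - 2 * \<mu> * corr V f id"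
proof -
  define w where "w = proj V f"
  define r where "r = real (card V) * fact (card V - 2)"
  have r: "r > 0"
    using V by (simp add: r_def)
  have zg: "zero_marg V g"
    unfolding g_def by (rule zero_marg_diff_proj[OF V(1,2) f])
  have f_eq: "f = (\<lambda>\<sigma>. w \<sigma> + g \<sigma>)"
    by (simp add: w_def g_def)
  have wg: "ip (Sym V) w g = 0"
    unfolding w_def by (rule ip_proj_zero_marg[OF V(1) zg])
  have Lwg: "ip (Sym V) (Lop V c w) g = 0"
    using zg unfolding w_def ip_Lop_proj[OF V(1,3)] by (simp add: zero_marg_def)
  have Lf: "Lop V c f = (\<lambda>\<sigma>. Lop V c w \<sigma> + Lop V c g \<sigma>)"
    unfolding f_eq by (rule ext) (rule Lop_add)
  have "ip (Sym V) f (Lop V c f) = ip (Sym V) w (Lop V c w) + ip (Sym V) w (Lop V c g)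
      + (ip (Sym V) g (Lop V c w) + ip (Sym V) g (Lop V c g))"
    unfolding Lf by (subst f_eq) (simp only: ip_add_left ip_add_right)
  moreover have "ip (Sym V) w (Lop V c g) = 0" "ip (Sym V) g (Lop V c w) = 0"
    using Lwg ip_Lop_commute[of V w c g] ip_commute[of "Sym V" g] by simp_all
  ultimately have Qf: "Q V c f = ip (Sym V) (Lop V c w) w + Q V c g"
    using ip_Lop[of V f c] ip_Lop[of V g c] ip_commute[of "Sym V" w "Lop V c w"] by linarith
  have "ip (Sym V) f f = ip (Sym V) w w + ip (Sym V) g g"
    using wg by (subst (1 2) f_eq) (simp add: ip_add_left ip_add_right ip_commute[of _ g w])
  then have Nf: "corr V f id = ip (Sym V) w w + corr V g id"
    by (simp add: corr_id ip_def power2_eq_square)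
  have Lww: "ip (Sym V) (Lop V c w) w = (\<Sum>k\<in>V. Ev V c (marg V f k)) / r"
  proof -
    have "ip (Sym V) (Lop V c w) w = ip (Sym V) (Lop V c w) f"
      unfolding f_eq using Lwg by (simp add: ip_add_right)
    also have "\<dots> = (\<Sum>k\<in>V. Ev V c (marg V f k)) / r"
      unfolding w_def ip_Lop_proj[OF V(1,3)] sum_lap[OF V(3), symmetric] r_def
      by (simp add: sum_divide_distrib)
    finally show ?thesis .
  qed
  have ww: "ip (Sym V) w w = (\<Sum>k\<in>V. \<Sum>a\<in>V. (marg V f k a)\<^sup>2) / r"
  proof -
    have "ip (Sym V) w w = ip (Sym V) w f"
      unfolding f_eq using wg by (simp add: ip_add_right)
    also have "\<dots> = ip (Sym V) (\<lambda>\<sigma>. \<Sum>k\<in>V. marg V f k (\<sigma> k) / r) f"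
      by (simp add: w_def proj_def[abs_def] r_def)
    also have "\<dots> = (\<Sum>k\<in>V. \<Sum>a\<in>V. marg V f k a / r * marg V f k a)"
      by (rule ip_additive[OF V(1), of "\<lambda>k b. marg V f k b / r"])
    finally show ?thesis
      by (simp add: power2_eq_square sum_divide_distrib)
  qed
  have "2 * \<mu> * (\<Sum>a\<in>V. (marg V f k a)\<^sup>2) \<le> Ev V c (marg V f k)" if "k \<in> V" for k
    using gap that sum_marg[OF V(1) that, of "\<lambda>_. 1" f] f by (simp add: gap_ge_def)
  then have "2 * \<mu> * (\<Sum>k\<in>V. \<Sum>a\<in>V. (marg V f k a)\<^sup>2) \<le> (\<Sum>k\<in>V. Ev V c (marg V f k))"
    unfolding sum_distrib_left[of "2 * \<mu>"] by (intro sum_mono) (simp add: sum_distrib_left)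
  then have "2 * \<mu> * ip (Sym V) w w \<le> ip (Sym V) (Lop V c w) w"
    unfolding Lww ww using r by (simp add: divide_right_mono)
  then show ?thesis
    unfolding Qf Nf by (simp add: algebra_simps)
qed

section \<open>Removing a vertex\<close>

text \<open>The star-mesh transformation of electrical networks, that is, the Schur complement of
  the Laplacian at \<open>v\<close>. If \<open>v\<close> is isolated the quotient is 0 by convention
  and nothing is added.\<close>

definition red :: "'a set \<Rightarrow> ('a \<Rightarrow> 'a \<Rightarrow> real) \<Rightarrow> 'a \<Rightarrow> 'a \<Rightarrow> 'a \<Rightarrow> real" where
  "red V c v i j = c i j + c v i * c v j / sum (c v) (V - {v})"

text \<open>The restriction of \<open>f\<close> to the permutations taking \<open>k\<close> to
  \<open>v\<close>, transported to \<open>V - {v}\<close> by a right factor so that it commutes with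
  the left translations in the operators.\<close>

abbreviation coset :: "'a \<Rightarrow> 'a \<Rightarrow> (('a \<Rightarrow> 'a) \<Rightarrow> real) \<Rightarrow> ('a \<Rightarrow> 'a) \<Rightarrow> real" where
  "coset v k f \<equiv> \<lambda>\<sigma>. f (\<sigma> \<circ> swp k v)"

lemma sum_sum_remove:
  fixes g :: "'a \<Rightarrow> 'a \<Rightarrow> real"
  assumes "finite V" "v \<in> V"
  shows "(\<Sum>i\<in>V. \<Sum>j\<in>V. g i j) = g v v + (\<Sum>j\<in>V-{v}. g v j) + (\<Sum>i\<in>V-{v}. g i v) + (\<Sum>i\<in>V-{v}. \<Sum>j\<in>V-{v}. g i j)"
  using assms by (simp add: sum.remove[of V v] sum.distrib)

lemma wgraph_red:
  assumes "wgraph V c" "v \<in> V"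
  shows "wgraph (V - {v}) (red V c v)"
proof -
  have "sum (c v) (V - {v}) \<ge> 0"
    using assms by (intro sum_nonneg) (auto simp: wgraph_def)
  then show ?thesis
    using assms by (auto simp: wgraph_def red_def mult.commute intro!: add_nonneg_nonneg divide_nonneg_nonneg)
qed

lemma sum_weights_zero:
  assumes "finite V" "wgraph V c" "v \<in> V" "sum (c v) (V - {v}) = 0" "i \<in> V - {v}"
  shows "c v i = 0"
  using assms sum_nonneg_eq_0_iff[of "V - {v}" "c v"] by (auto simp: wgraph_def)

text \<open>Summing over the cosets restores the correlations on V. The edges away from
  \<open>v\<close> contribute equally on both sides, and the octopus inequality, divided by C,
  compares the added mesh weights with the star of \<open>v\<close>, whose edges are counted in both
  orientations.\<close>

lemma sum_Q_red_le:
  assumes V: "finite V" "wgraph V c" "v \<in> V"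
  shows "(\<Sum>k\<in>V. Q (V - {v}) (red V c v) (coset v k f)) \<le> Q V c f"
proof -
  define W where "W = V - {v}"
  define C where "C = sum (c v) W"
  define p where "p i j = corr V f id - corr V f (swp i j)" for i j
  have C: "C \<ge> 0"
    unfolding C_def W_def using V by (intro sum_nonneg) (auto simp: wgraph_def)
  have "Q V c f = (\<Sum>j\<in>W. c v j * p v j) + (\<Sum>i\<in>W. c i v * p i v) + (\<Sum>i\<in>W. \<Sum>j\<in>W. c i j * p i j)"
    unfolding Q_def p_def[symmetric] sum_sum_remove[OF V(1,3)] W_def by (simp add: p_def)
  also have "(\<Sum>i\<in>W. c i v * p i v) = (\<Sum>j\<in>W. c v j * p v j)"
    using V by (intro sum.cong) (auto simp: wgraph_def W_def p_def transpose_commute)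
  finally have 1: "Q V c f = 2 * (\<Sum>j\<in>W. c v j * p v j) + (\<Sum>i\<in>W. \<Sum>j\<in>W. c i j * p i j)"
    by simp
  have "(\<Sum>k\<in>V. Q W (red V c v) (coset v k f)) = (\<Sum>i\<in>W. \<Sum>j\<in>W. \<Sum>k\<in>V.
      red V c v i j * (corr W (coset v k f) id - corr W (coset v k f) (swp i j)))"
    unfolding Q_def by (subst sum.swap) (intro sum.cong refl sum.swap)
  also have "\<dots> = (\<Sum>i\<in>W. \<Sum>j\<in>W. red V c v i j * p i j)"
    unfolding W_def p_def corr_cosets[OF V(1,3), of f] by (simp add: sum_distrib_left[symmetric] sum_subtractf)
  finally have 2: "(\<Sum>k\<in>V. Q W (red V c v) (coset v k f)) =
      (\<Sum>i\<in>W. \<Sum>j\<in>W. c i j * p i j) + (\<Sum>i\<in>W. \<Sum>j\<in>W. c v i * c v j * p i j) / C"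
    by (simp add: red_def C_def W_def distrib_right sum.distrib sum_divide_distrib)
  have "(\<Sum>i\<in>W. \<Sum>j\<in>W. c v i * c v j * p i j) \<le> 2 * C * (\<Sum>i\<in>W. c v i * p v i)"
    unfolding W_def C_def p_def by (rule octopus[OF V(1,3)]) (use V in \<open>auto simp: wgraph_def\<close>)
  then have "(\<Sum>i\<in>W. \<Sum>j\<in>W. c v i * c v j * p i j) / C \<le> 2 * (\<Sum>j\<in>W. c v j * p v j)"
  proof (cases "C = 0")
    case True
    then have "c v i = 0" if "i \<in> W" for i
      using sum_weights_zero[OF V(1,2,3)] that unfolding W_def C_def by auto
    then show ?thesis using True by simp
  next
    case False
    then show ?thesis
      using C \<open>_ \<le> 2 * C * _\<close> by (simp add: field_simps)
  qed
  then show ?thesis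
    using 1 2 unfolding W_def by linarith
qed

text \<open>
  The reduced form is the minimum over \<open>h\<close> of the form on \<open>V\<close>, attained at the weighted mean below.
\<close>

lemma gap_ge_red_strong:
  assumes V: "finite V" "wgraph V c" "v \<in> V" and gap: "gap_ge V c \<mu>"
    and x: "sum x (V - {v}) = 0"
  defines "h \<equiv> (\<Sum>i\<in>V-{v}. c v i * x i) / sum (c v) (V - {v})"
  shows "2 * \<mu> * ((\<Sum>i\<in>V-{v}. (x i)\<^sup>2) + h\<^sup>2 * (1 - 1 / card V)) \<le> Ev (V - {v}) (red V c v) x"
proof -
  define W where "W = V - {v}"
  define C where "C = sum (c v) W"
  define S where "S = (\<Sum>i\<in>W. c v i * x i)"
  \<comment> \<open>The extension of \<open>x\<close> by \<open>h\<close>, shifted to sum zero. Its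
    mean is \<open>h / card V\<close>, so the shift lowers the squared norm by
    \<open>h\<^sup>2 / card V\<close>. The surplus that remains decides the case of a reduced
    uniform cycle.\<close>
  define y where "y = (\<lambda>i. (if i = v then h else x i) - h / card V)"
  have W: "finite W" "v \<notin> W" "V = insert v W"
    using V by (auto simp: W_def)
  have n: "card V > 0"
    using V by (auto simp: card_gt_0_iff)
  have yW: "y i = x i - h / card V" if "i \<in> W" for i
    using that W by (auto simp: y_def)
  have cW: "real (card W) = real (card V) - 1"
    using W by simp
  have xW: "sum x W = 0"
    using x by (simp add: W_def)
  have "sum y V = y v + sum y W"
    using W by simp
  also have "sum y W = - (real (card W) * (h / card V))"
    using yW xW by (simp add: sum_subtractf)
  finally have "sum y V = 0"
    unfolding cW using n by (simp add: y_def field_simps)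
  then have "2 * \<mu> * (\<Sum>i\<in>V. (y i)\<^sup>2) \<le> Ev V c y"
    using gap by (simp add: gap_ge_def)
  also have "(\<Sum>i\<in>V. (y i)\<^sup>2) = (\<Sum>i\<in>W. (x i)\<^sup>2) + h\<^sup>2 * (1 - 1 / card V)"
  proof -
    have "(\<Sum>i\<in>V. (y i)\<^sup>2) = (y v)\<^sup>2 + (\<Sum>i\<in>W. (y i)\<^sup>2)"
      using W by simp
    also have "(\<Sum>i\<in>W. (y i)\<^sup>2) = (\<Sum>i\<in>W. (x i)\<^sup>2 - 2 * (h / card V) * x i + (h / card V)\<^sup>2)"
      by (intro sum.cong refl) (simp add: yW power2_diff)
    also have "\<dots> = (\<Sum>i\<in>W. (x i)\<^sup>2) + (real (card V) - 1) * (h / card V)\<^sup>2"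
      unfolding sum.distrib sum_subtractf sum_distrib_left[symmetric] xW by (simp add: cW)
    also have "(y v)\<^sup>2 + ((\<Sum>i\<in>W. (x i)\<^sup>2) + (real (card V) - 1) * (h / card V)\<^sup>2) =
        (\<Sum>i\<in>W. (x i)\<^sup>2) + h\<^sup>2 * (1 - 1 / card V)"
      using n by (simp add: y_def field_simps power2_eq_square)
    finally show ?thesis .
  qed
  also have "Ev V c y = 2 * (\<Sum>i\<in>W. c v i * (x i - h)\<^sup>2) + Ev W c x"
  proof -
    have "(\<Sum>i\<in>W. c i v * (y i - y v)\<^sup>2) = (\<Sum>i\<in>W. c v i * (x i - h)\<^sup>2)"
      "(\<Sum>i\<in>W. c v i * (y v - y i)\<^sup>2) = (\<Sum>i\<in>W. c v i * (x i - h)\<^sup>2)"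
      using V by (auto intro!: sum.cong simp: W_def wgraph_def y_def power2_commute)
    moreover have "(\<Sum>i\<in>W. \<Sum>j\<in>W. c i j * (y i - y j)\<^sup>2) = Ev W c x"
      unfolding Ev_def by (intro sum.cong refl) (simp add: yW)
    ultimately show ?thesis
      unfolding Ev_def sum_sum_remove[OF V(1,3)] W_def[symmetric] by simp
  qed
  also have "2 * (\<Sum>i\<in>W. c v i * (x i - h)\<^sup>2) = (\<Sum>i\<in>W. \<Sum>j\<in>W. c v i * c v j * (x i - x j)\<^sup>2) / C"
  proof (cases "C = 0")
    case True
    then have "c v i = 0" if "i \<in> W" for i
      using sum_weights_zero[OF V(1,2,3)] that unfolding W_def C_def by auto
    then show ?thesis by simp
  next
    case False
    have "(\<Sum>i\<in>W. c v i * (x i - h)\<^sup>2) = (\<Sum>i\<in>W. c v i * (x i)\<^sup>2) - 2 * h * S + h\<^sup>2 * C"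
      by (simp add: S_def C_def power2_diff algebra_simps sum.distrib sum_subtractf sum_distrib_left sum_distrib_right)
    moreover have "h * C = S"
      using False by (simp add: h_def C_def S_def W_def)
    moreover have "C * (A - 2 * h * S + h\<^sup>2 * C) = C * A - 2 * (h * C) * S + (h * C)\<^sup>2" for A
      by (simp add: algebra_simps power2_eq_square)
    ultimately have 1: "C * (\<Sum>i\<in>W. c v i * (x i - h)\<^sup>2) = C * (\<Sum>i\<in>W. c v i * (x i)\<^sup>2) - S\<^sup>2"
      by (simp add: power2_eq_square)
    have "(\<Sum>i\<in>W. \<Sum>j\<in>W. c v i * c v j * (x i - x j)\<^sup>2) =
        (\<Sum>i\<in>W. \<Sum>j\<in>W. (c v i * (x i)\<^sup>2) * c v j + c v i * (c v j * (x j)\<^sup>2) - 2 * ((c v i * x i) * (c v j * x j)))"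
      by (intro sum.cong refl) (simp add: power2_diff algebra_simps)
    also have "\<dots> = 2 * (C * (\<Sum>i\<in>W. c v i * (x i)\<^sup>2)) - 2 * S\<^sup>2"
      by (simp add: sum.distrib sum_subtractf sum_distrib_left[symmetric] sum_distrib_right[symmetric]
          C_def S_def power2_eq_square)
    finally show ?thesis
      using 1 False by (simp add: field_simps)
  qed
  finally show ?thesis
    by (simp add: Ev_def red_def distrib_right sum.distrib sum_divide_distrib W_def C_def)
qed

lemma gap_ge_red:
  assumes V: "finite V" "wgraph V c" "v \<in> V" and gap: "gap_ge V c \<mu>" "\<mu> \<ge> 0"
  shows "gap_ge (V - {v}) (red V c v) \<mu>"
  unfolding gap_ge_def
proof (intro allI impI)
  fix x :: "'a \<Rightarrow> real" assume x: "sum x (V - {v}) = 0"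
  define h where "h = (\<Sum>i\<in>V-{v}. c v i * x i) / sum (c v) (V - {v})"
  have "card V \<ge> 1"
    using V by (metis One_nat_def Suc_leI card_gt_0_iff empty_iff)
  then have "h\<^sup>2 * (1 - 1 / card V) \<ge> 0"
    by simp
  then have "2 * \<mu> * (\<Sum>i\<in>V-{v}. (x i)\<^sup>2) \<le> 2 * \<mu> * ((\<Sum>i\<in>V-{v}. (x i)\<^sup>2) + h\<^sup>2 * (1 - 1 / card V))"
    using gap(2) by (intro mult_left_mono) auto
  also have "\<dots> \<le> Ev (V - {v}) (red V c v) x"
    unfolding h_def by (rule gap_ge_red_strong[OF V gap(1) x])
  finally show "2 * \<mu> * (\<Sum>i\<in>V-{v}. (x i)\<^sup>2) \<le> Ev (V - {v}) (red V c v) x" .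
qed

lemma coset_sum_zero:
  assumes "finite V" "v \<in> V" "k \<in> V" "zero_marg V f"
  shows "(\<Sum>\<sigma>\<in>Sym (V - {v}). coset v k f \<sigma>) = 0"
  using assms marg_coset[of V v k f] by (simp add: zero_marg_def)

lemma Sym_small:
  assumes "finite V" "card V < 2"
  shows "Sym V = {id}"
proof -
  have "card V = 0 \<or> card V = 1"
    using assms by linarith
  then show ?thesis
    using assms by (auto simp: card_1_singleton_iff)
qed

theorem aldous_gap:
  assumes "finite V" "wgraph V c" "gap_ge V c \<mu>" "\<mu> \<ge> 0" "(\<Sum>\<sigma>\<in>Sym V. f \<sigma>) = 0"
  shows "2 * \<mu> * corr V f id \<le> Q V c f"
  using assms
proof (induction "card V" arbitrary: V c f)
  case 0
  then have S: "Sym V = {id}"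
    using Sym_small[of V] by simp
  have "f id = 0"
    using 0(6) unfolding S by (simp add: id_def)
  then have "corr V f id = 0"
    unfolding corr_id S by (simp add: id_def)
  then show ?case
    using Q_nonneg[OF 0(3), of f] by (simp add: id_def)
next
  case (Suc n)
  show ?case
  proof (cases "card V < 2")
    case True
    then have S: "Sym V = {id}"
      using Sym_small[of V] Suc by simp
    have "f id = 0"
      using Suc(7) unfolding S by (simp add: id_def)
    then have "corr V f id = 0"
      unfolding corr_id S by (simp add: id_def)
    then show ?thesis
      using Q_nonneg[OF Suc(4), of f] by (simp add: id_def)
  next
  case False
    \<comment> \<open>The coset functions of \<open>f\<close> itself need not have sum zero. Those
      of \<open>g\<close> do, so the induction hypothesis applies to them, and
      \<open>Q_diff_proj_le\<close> returns from \<open>g\<close> to \<open>f\<close>.\<close>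
    define g where "g = (\<lambda>\<sigma>. f \<sigma> - proj V f \<sigma>)"
    have zg: "zero_marg V g"
      unfolding g_def by (rule zero_marg_diff_proj) (use False Suc in auto)
    obtain v where v: "v \<in> V"
      using Suc(2) by fastforce
    have "2 * \<mu> * corr (V - {v}) (coset v k g) id \<le> Q (V - {v}) (red V c v) (coset v k g)" if "k \<in> V" for k
    proof (rule Suc(1))
      show "n = card (V - {v})"
        using Suc v by simp
    qed (use Suc v that zg in \<open>auto intro: wgraph_red gap_ge_red coset_sum_zero\<close>)
    then have "2 * \<mu> * corr V g id \<le> (\<Sum>k\<in>V. Q (V - {v}) (red V c v) (coset v k g))"
      unfolding corr_cosets[OF Suc(3) v, of g] sum_distrib_left by (rule sum_mono)
    also have "\<dots> \<le> Q V c g"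
      by (rule sum_Q_red_le) (use Suc v in auto)
    finally show ?thesis
      using Q_diff_proj_le[of V c \<mu> f] Suc False unfolding g_def by simp
  qed
qed

section \<open>The equality case\<close>

text \<open>Connectedness by cuts instead of paths: this is the form used in \<open>conn_red\<close>
  and, for level sets, in \<open>Ev_zero_const\<close>.\<close>

definition conn :: "'a set \<Rightarrow> ('a \<Rightarrow> 'a \<Rightarrow> real) \<Rightarrow> bool" where
  "conn V c \<longleftrightarrow> (\<forall>A. A \<noteq> {} \<and> A \<subset> V \<longrightarrow> (\<exists>i\<in>A. \<exists>j\<in>V-A. c i j > 0))"

definition uniform_C4 :: "'a set \<Rightarrow> ('a \<Rightarrow> 'a \<Rightarrow> real) \<Rightarrow> bool" where
  "uniform_C4 V c \<longleftrightarrow> (\<exists>p q r s w. distinct [p, q, r, s] \<and> V = {p, q, r, s} \<and> w > 0 \<and>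
     c p q = w \<and> c q r = w \<and> c r s = w \<and> c s p = w \<and> c p r = 0 \<and> c q s = 0)"

lemma wgraph_sym: "wgraph V c \<Longrightarrow> i \<in> V \<Longrightarrow> j \<in> V \<Longrightarrow> c i j = c j i"
  and wgraph_nonneg: "wgraph V c \<Longrightarrow> i \<in> V \<Longrightarrow> j \<in> V \<Longrightarrow> c i j \<ge> 0"
  by (auto simp: wgraph_def)

lemma red_ge:
  assumes "finite V" "wgraph V c" "v \<in> V" "i \<in> V - {v}" "j \<in> V - {v}"
  shows "red V c v i j \<ge> c i j" "c v i > 0 \<Longrightarrow> c v j > 0 \<Longrightarrow> red V c v i j > 0"
proof -
  have C: "sum (c v) (V - {v}) \<ge> 0"
    using assms by (intro sum_nonneg) (auto simp: wgraph_def)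
  have n: "c v i \<ge> 0" "c v j \<ge> 0" "c i j \<ge> 0"
    using assms by (auto simp: wgraph_def)
  then show "red V c v i j \<ge> c i j"
    using C by (simp add: red_def)
  assume pos: "c v i > 0" "c v j > 0"
  have "c v i \<le> sum (c v) (V - {v})"
    using assms by (intro member_le_sum) (auto simp: wgraph_def)
  then show "red V c v i j > 0"
    using pos n by (simp add: red_def add_nonneg_pos)
qed

text \<open>If no edge of the old graph crosses the cut directly, then \<open>v\<close> has
  neighbours on both sides, and the mesh replacing its star joins them.\<close>

lemma conn_red:
  assumes V: "finite V" "wgraph V c" "v \<in> V" and conn: "conn V c"
  shows "conn (V - {v}) (red V c v)"
  unfolding conn_def
proof (intro allI impI)
  fix A assume A: "A \<noteq> {} \<and> A \<subset> V - {v}"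
  show "\<exists>i\<in>A. \<exists>j\<in>V - {v} - A. 0 < red V c v i j"
  proof (cases "\<exists>i\<in>A. \<exists>j\<in>V - {v} - A. c i j > 0")
    case True
    then obtain i j where ij: "i \<in> A" "j \<in> V - {v} - A" "c i j > 0"
      by blast
    then have "red V c v i j > 0"
      using red_ge(1)[OF V, of i j] A by force
    then show ?thesis using ij by blast
  next
    case False
    have "A \<subset> V"
      using A by auto
    then obtain i j where ij: "i \<in> A" "j \<in> V - A" "c i j > 0"
      using conn A unfolding conn_def by meson
    then have "j = v"
      using False by blast
    then have i: "c v i > 0"
      using ij V A by (auto simp: wgraph_def)
    have "insert v A \<subset> V"
      using A V by auto
    then obtain i' j' where ij': "i' \<in> insert v A" "j' \<in> V - insert v A" "c i' j' > 0"
      using conn unfolding conn_def by (meson insert_not_empty)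
    then have "i' = v"
      using False by blast
    then have "red V c v i j' > 0"
      using red_ge(2)[OF V, of i j'] i ij ij' A by auto
    then show ?thesis
      using ij ij' by blast
  qed
qed

text \<open>\<open>aldous_gap\<close> on the cosets and \<open>sum_Q_red_le\<close> squeeze the sum
  of the reduced forms between two equal quantities, so the inequality is tight on each coset
  separately.\<close>

lemma slice_equality:
  assumes V: "finite V" "wgraph V c" "v \<in> V" "k \<in> V" and gap: "gap_ge V c \<mu>" "\<mu> \<ge> 0"
    and zm: "zero_marg V f" and eq: "Q V c f \<le> 2 * \<mu> * corr V f id"
  shows "Q (V - {v}) (red V c v) (coset v k f) \<le> 2 * \<mu> * corr (V - {v}) (coset v k f) id"
proof -
  define l where "l k = 2 * \<mu> * corr (V - {v}) (coset v k f) id" for k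
  define u where "u k = Q (V - {v}) (red V c v) (coset v k f)" for k
  have le: "l k \<le> u k" if "k \<in> V" for k
    unfolding l_def u_def using V gap zm that
    by (intro aldous_gap wgraph_red gap_ge_red coset_sum_zero) auto
  have "sum u V \<le> Q V c f"
    unfolding u_def by (rule sum_Q_red_le[OF V(1-3)])
  also have "\<dots> \<le> sum l V"
    using eq unfolding l_def corr_cosets[OF V(1,3), of f] by (simp add: sum_distrib_left)
  finally have "sum l V = sum u V"
    using sum_mono[of V l u] le by force
  then have "l k = u k"
    using sum_mono_inv[of l V u k] le V by auto
  then show ?thesis
    by (simp add: l_def u_def)
qed

text \<open>Some \<open>v\<close> lies outside the three points, and all six permutations in the
  relation agree in which position takes the value \<open>v\<close>, so the relation lives in one
  coset. The relation on four points requires a fifth one for the same purpose, which is why four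
  vertices are special.\<close>

lemma triple_alt_slices:
  assumes V: "finite V" "card V \<ge> 4"
    and sl: "\<And>v k. v \<in> V \<Longrightarrow> k \<in> V \<Longrightarrow> triple_alt (V - {v}) (coset v k f)"
  shows "triple_alt V f"
  unfolding triple_alt_def
proof (intro ballI impI)
  fix a b c \<sigma> assume *: "a \<in> V" "b \<in> V" "c \<in> V" "\<sigma> \<in> Sym V" "distinct [a, b, c]"
  have "card {a, b, c} < card V"
    using * V by simp
  then have "V - {a, b, c} \<noteq> {}"
    by (metis V(1) Diff_eq_empty_iff card_mono finite.emptyI finite.insertI leD)
  then obtain v where v: "v \<in> V" "v \<notin> {a, b, c}"
    by blast
  have \<sigma>: "\<sigma> permutes V"
    using * by simp
  define k where "k = inv \<sigma> v"
  have k: "k \<in> V" "\<sigma> k = v"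
    using * v by (auto simp: k_def permutes_inverses permutes_in_image[OF permutes_inv])
  obtain \<tau> where \<tau>: "\<tau> permutes (V - {v})" "\<sigma> = \<tau> \<circ> swp k v"
    using permutes_eq_coset[OF \<sigma> k] by blast
  have "a \<in> V - {v}" "b \<in> V - {v}" "c \<in> V - {v}" "\<tau> \<in> Sym (V - {v})"
    using * v \<tau> by auto
  from sl[OF v(1) k(1), unfolded triple_alt_def, rule_format, OF this *(5)]
  show "f \<sigma> + f (cyc a b c \<circ> \<sigma>) + f (cyc a c b \<circ> \<sigma>) =
      f (swp a b \<circ> \<sigma>) + f (swp b c \<circ> \<sigma>) + f (swp a c \<circ> \<sigma>)"
    unfolding \<tau>(2) o_assoc .
qed

lemma square_alt_slices:
  assumes V: "finite V" "card V \<ge> 5"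
    and sl: "\<And>v k. v \<in> V \<Longrightarrow> k \<in> V \<Longrightarrow> square_alt (V - {v}) (coset v k f)"
  shows "square_alt V f"
  unfolding square_alt_def
proof (intro ballI impI)
  fix a b c d \<sigma> assume *: "a \<in> V" "b \<in> V" "c \<in> V" "d \<in> V" "\<sigma> \<in> Sym V" "distinct [a, b, c, d]"
  have "card {a, b, c, d} < card V"
    using * V by simp
  then have "V - {a, b, c, d} \<noteq> {}"
    by (metis V(1) Diff_eq_empty_iff card_mono finite.emptyI finite.insertI leD)
  then obtain v where v: "v \<in> V" "v \<notin> {a, b, c, d}"
    by blast
  have \<sigma>: "\<sigma> permutes V"
    using * by simp
  define k where "k = inv \<sigma> v"
  have k: "k \<in> V" "\<sigma> k = v"
    using * v by (auto simp: k_def permutes_inverses permutes_in_image[OF permutes_inv])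
  obtain \<tau> where \<tau>: "\<tau> permutes (V - {v})" "\<sigma> = \<tau> \<circ> swp k v"
    using permutes_eq_coset[OF \<sigma> k] by blast
  have "a \<in> V - {v}" "b \<in> V - {v}" "c \<in> V - {v}" "d \<in> V - {v}" "\<tau> \<in> Sym (V - {v})"
    using * v \<tau> by auto
  from sl[OF v(1) k(1), unfolded square_alt_def, rule_format, OF this *(6)]
  show "f \<sigma> + f (swp a b \<circ> (swp c d \<circ> \<sigma>)) = f (swp a b \<circ> \<sigma>) + f (swp c d \<circ> \<sigma>)"
    unfolding \<tau>(2) o_assoc .
qed

lemma corr_id_eq_0:
  assumes "finite V" "corr V f id = 0" "\<sigma> permutes V"
  shows "f \<sigma> = 0"
  using assms finite_permutations[OF assms(1)] by (simp add: corr_id sum_nonneg_eq_0_iff)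

section \<open>Equality on three and four points\<close>

lemma sum_Sym_fixing:
  assumes V: "finite V" "x \<in> V" and zm: "zero_marg V f" and \<sigma>: "\<sigma> permutes V"
  shows "(\<Sum>\<pi>\<in>Sym (V - {x}). f (\<pi> \<circ> \<sigma>)) = 0"
proof -
  define k where "k = inv \<sigma> x"
  have k: "k \<in> V" "\<sigma> k = x"
    using \<sigma> V by (auto simp: k_def permutes_inverses permutes_in_image[OF permutes_inv])
  show ?thesis
    using marg_orbit[OF V(1) \<sigma> k, of f] zm k V by (simp add: zero_marg_def)
qed

lemma sum_Sym3:
  fixes F :: "('a \<Rightarrow> 'a) \<Rightarrow> real"
  assumes "distinct [p, q, r]"
  shows "(\<Sum>\<pi>\<in>Sym {p, q, r}. F \<pi>) =
    F id + F (cyc p q r) + F (cyc p r q) + F (swp p q) + F (swp q r) + F (swp p r)"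
proof -
  have S: "Sym {q, r} = {id, swp q r}"
    by (auto simp: permutes_doubleton_iff)
  have d: "id \<noteq> swp q r"
    using assms transpose_eq_id_iff[of q r] by auto
  have two: "(\<Sum>\<pi>\<in>Sym {q, r}. G \<pi>) = G id + G (swp q r)" for G :: "('a \<Rightarrow> 'a) \<Rightarrow> real"
    unfolding S using d by simp
  have "(\<Sum>\<pi>\<in>Sym {p, q, r}. F \<pi>) = (\<Sum>b\<in>{p, q, r}. F (swp p b \<circ> id) + F (swp p b \<circ> swp q r))"
    using assms by (subst sum_over_permutations_insert) (auto simp only: two, auto)
  also have "\<dots> = F (swp p p \<circ> id) + F (swp p p \<circ> swp q r) + F (swp p q \<circ> id) + F (swp p q \<circ> swp q r)
      + F (swp p r \<circ> id) + F (swp p r \<circ> swp q r)"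
    using assms by simp
  finally show ?thesis
    by (simp add: cyc_def transpose_commute[of r q])
qed

text \<open>Here a marginal is a sum of two values exchanged by a transposition, so \<open>f\<close>
  changes sign under each transposition and is a multiple of the sign function. Its interchange
  eigenvalue is twice the total weight T, which is also the sum of the two nontrivial Laplacian
  eigenvalues; the smaller of these is at most T.\<close>

lemma three_point:
  assumes V: "V = {a, b, c}" "distinct [a, b, c]" and w: "wgraph V w" and conn: "conn V w"
    and gap: "gap_ge V w \<mu>" and zm: "zero_marg V f" and eq: "Q V w f \<le> 2 * \<mu> * corr V f id"
  shows "corr V f id = 0"
proof -
  have fin: "finite V"
    using V by simp
  define N where "N = corr V f id"
  have anti: "corr V f (swp p q) = - N" if "V - {r} = {p, q}" "r \<in> V" "p \<noteq> q" for p q r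
  proof -
    have "f \<sigma> + f (swp p q \<circ> \<sigma>) = 0" if "\<sigma> permutes V" for \<sigma>
    proof -
      have S: "Sym {p, q} = {id, swp p q}"
        by (auto simp: permutes_doubleton_iff)
      have d: "id \<noteq> swp p q"
        using \<open>p \<noteq> q\<close> transpose_eq_id_iff[of p q] by auto
      show ?thesis
        using sum_Sym_fixing[OF fin \<open>r \<in> V\<close> zm that] d unfolding \<open>V - {r} = {p, q}\<close> S by simp
    qed
    then have "f (swp p q \<circ> \<sigma>) = - f \<sigma>" if "\<sigma> permutes V" for \<sigma>
      using that by force
    then show ?thesis
      unfolding N_def corr_id by (simp add: corr_def power2_eq_square sum_negf)
  qed
  have ab: "corr V f (swp a b) = - N" "corr V f (swp a c) = - N" "corr V f (swp b c) = - N"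
    by (rule anti[of c a b] anti[of b a c] anti[of a b c]; use V in auto)+
  define T where "T = w a b + w a c + w b c"
  have sym: "w b a = w a b" "w c a = w a c" "w c b = w b c" "w a b \<ge> 0" "w a c \<ge> 0" "w b c \<ge> 0"
    by (rule wgraph_sym[OF w] wgraph_nonneg[OF w]; use V in simp)+
  have id: "corr V f id = N" "corr V f (\<lambda>x. x) = N"
    by (simp_all add: N_def id_def)
  have sumV: "(\<Sum>i\<in>V. h i) = h a + h b + h c" for h :: "'a \<Rightarrow> real"
    using V by (simp add: add.assoc)
  have QT: "Q V w f = 4 * T * N"
    unfolding Q_def sumV
    by (simp add: T_def algebra_simps transpose_commute[of b a] transpose_commute[of c a]
        transpose_commute[of c b] id sym ab)
  have "\<mu> \<le> T"
  proof -
    have g: "2 * \<mu> * ((x a)\<^sup>2 + (x b)\<^sup>2 + (x c)\<^sup>2) \<le>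
        2 * (w a b * (x a - x b)\<^sup>2 + w a c * (x a - x c)\<^sup>2 + w b c * (x b - x c)\<^sup>2)"
      if "x a + x b + x c = 0" for x
    proof -
      have "2 * \<mu> * (\<Sum>i\<in>V. (x i)\<^sup>2) \<le> Ev V w x"
        using gap that by (simp add: gap_ge_def sumV)
      moreover have "Ev V w x = 2 * (w a b * (x a - x b)\<^sup>2 + w a c * (x a - x c)\<^sup>2 + w b c * (x b - x c)\<^sup>2)"
        unfolding Ev_def sumV by (simp add: sym power2_commute[of "x b" "x a"] power2_commute[of "x c" "x a"]
            power2_commute[of "x c" "x b"])
      ultimately show ?thesis
        by (simp add: sumV)
    qed
    \<comment> \<open>Each weight gets coefficient 4 from one test vector and 1 from the other two,
      so adding the three instances yields \<open>12 * \<mu> \<le> 12 * T\<close>.\<close>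
    show ?thesis
      using g[of "(\<lambda>_. 0)(a := 1, b := -1)"] g[of "(\<lambda>_. 0)(a := 1, c := -1)"] g[of "(\<lambda>_. 0)(b := 1, c := -1)"] V(2) not_sym[of a b] not_sym[of a c] not_sym[of b c]
      by (simp add: T_def power2_eq_square)
  qed
  moreover have "T > 0"
  proof -
    have "{a} \<subset> V"
      using V by auto
    then obtain j where "j \<in> V - {a}" "w a j > 0"
      using conn unfolding conn_def by (metis insert_not_empty singletonD)
    then show ?thesis
      using V sym by (auto simp: T_def)
  qed
  moreover have "N \<ge> 0"
    unfolding N_def by (rule corr_id_nonneg)
  ultimately have *: "\<mu> * N \<le> T * N" "T > 0" "N \<ge> 0"
    by (auto intro: mult_right_mono)
  have "T * N \<le> 0"
    using eq *(1) unfolding QT N_def[symmetric] by linarith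
  then have "N = 0"
    using *(2,3) by (simp add: mult_le_0_iff)
  then show ?thesis
    by (simp add: N_def)
qed

text \<open>On an orbit of the symmetric group of three points, vanishing marginals make the even
  and odd parts opposite and \<open>triple_alt\<close> makes them equal, so both vanish. Adding the
  even relations of the four triples and using the coset structure of the 3-cycles gives
  \<open>klein a b c d f = 4 * f\<close>, hence invariance under the Klein four-group.\<close>

lemma four_point_structure:
  assumes V: "V = {a, b, c, d}" "distinct [a, b, c, d]" and zm: "zero_marg V f" and tr: "triple_alt V f"
    and \<sigma>: "\<sigma> permutes V"
  shows "f \<sigma> + f (cyc a b c \<circ> \<sigma>) + f (cyc a c b \<circ> \<sigma>) = 0"
    and "f (swp a b \<circ> \<sigma>) + f (swp b c \<circ> \<sigma>) + f (swp a c \<circ> \<sigma>) = 0"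
    and "f (dbl a b c d \<circ> \<sigma>) = f \<sigma>"
proof -
  have fin: "finite V"
    using V by simp
  have L: "f \<sigma> + f (cyc p q r \<circ> \<sigma>) + f (cyc p r q \<circ> \<sigma>) = 0 \<and>
      f (swp p q \<circ> \<sigma>) + f (swp q r \<circ> \<sigma>) + f (swp p r \<circ> \<sigma>) = 0"
    if "\<sigma> permutes V" "V - {x} = {p, q, r}" "x \<in> V" "distinct [p, q, r]" for \<sigma> x p q r
  proof -
    have "(\<Sum>\<pi>\<in>Sym {p, q, r}. f (\<pi> \<circ> \<sigma>)) = 0"
      using sum_Sym_fixing[OF fin that(3) zm that(1)] unfolding that(2) .
    moreover have pqr: "p \<in> V" "q \<in> V" "r \<in> V" "\<sigma> \<in> Sym V"
      using that(1,2) by auto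
    have "f \<sigma> + f (cyc p q r \<circ> \<sigma>) + f (cyc p r q \<circ> \<sigma>) =
        f (swp p q \<circ> \<sigma>) + f (swp q r \<circ> \<sigma>) + f (swp p r \<circ> \<sigma>)"
      by (rule tr[unfolded triple_alt_def, rule_format, OF pqr that(4)])
    ultimately show ?thesis
      unfolding sum_Sym3[OF that(4)] by simp
  qed
  have V': "V - {d} = {a, b, c}" "V - {c} = {a, b, d}" "V - {b} = {a, c, d}" "V - {a} = {b, c, d}"
    using V by auto
  show "f \<sigma> + f (cyc a b c \<circ> \<sigma>) + f (cyc a c b \<circ> \<sigma>) = 0"
    "f (swp a b \<circ> \<sigma>) + f (swp b c \<circ> \<sigma>) + f (swp a c \<circ> \<sigma>) = 0"
    using L[OF \<sigma> V'(1)] V by auto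
  have k: "klein a b c d f \<rho> = 4 * f \<rho>" if \<rho>: "\<rho> permutes V" for \<rho>
  proof -
    have "4 * f \<rho> + cycles4 a b c d f \<rho> = 0"
      using L[OF \<rho> V'(1)] L[OF \<rho> V'(2)] L[OF \<rho> V'(3)] L[OF \<rho> V'(4)] V by (simp add: cycles4_def)
    moreover have "cycles4 a b c d f \<rho> = klein a b c d f (cyc a b c \<circ> \<rho>) + klein a b c d f (cyc a c b \<circ> \<rho>)"
      using Eop_klein[OF V(2), of f \<rho>] by (simp add: Eop_def)
    moreover have "klein a b c d f \<rho> + klein a b c d f (cyc a b c \<circ> \<rho>) + klein a b c d f (cyc a c b \<circ> \<rho>) = 0"
    proof -
      have p: "dbl a b c d \<circ> \<rho> permutes V" "dbl a c b d \<circ> \<rho> permutes V" "dbl a d b c \<circ> \<rho> permutes V"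
        by (rule permutes_compose[OF \<rho> dbl_permutes]; use V in simp)+
      have z: "f \<rho> + f (cyc a b c \<circ> \<rho>) + f (cyc a c b \<circ> \<rho>) = 0" if "\<rho> permutes V" for \<rho>
        using L[OF that V'(1)] V by auto
      show ?thesis
        unfolding klein_def
        using z[OF \<rho>] z[OF p(1)] z[OF p(2)] z[OF p(3)] unfolding cyc_comp_dbl[OF V(2)] by linarith
    qed
    ultimately show ?thesis by linarith
  qed
  have "dbl a b c d \<circ> \<sigma> permutes V"
    by (rule permutes_compose[OF \<sigma> dbl_permutes]; use V in simp)
  then show "f (dbl a b c d \<circ> \<sigma>) = f \<sigma>"
    using k[OF \<sigma>] k[of "dbl a b c d \<circ> \<sigma>"] klein_dbl(1)[OF V(2), of f \<sigma>] by simp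
qed

text \<open>
  On the functions left over, a transposition and the one complementary to it agree. The test vectors
  \<open>(1, 1, -1, -1)\<close> bound \<open>\<mu>\<close> by the sum of the two smaller pair weights, and perturbing them by the
  third sign vector forces uniform weights on the cycle.
\<close>

lemma four_point_ordered:
  assumes V: "V = {a, b, c, d}" "distinct [a, b, c, d]" and w: "wgraph V w" and conn: "conn V w"
    and gap: "gap_ge V w \<mu>" and zm: "zero_marg V f" and tr: "triple_alt V f"
    and eq: "Q V w f \<le> 2 * \<mu> * corr V f id"
    and ord: "w a b + w c d \<ge> w a c + w b d" "w a c + w b d \<ge> w a d + w b c"
    and nu: "\<not> uniform_C4 V w"
  shows "corr V f id = 0"
proof (rule ccontr)
  assume N0: "corr V f id \<noteq> 0"
  define N where "N = corr V f id"
  have N: "N > 0"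
    using N0 corr_id_nonneg[of V f] by (simp add: N_def)
  have sym: "w b a = w a b" "w c a = w a c" "w c b = w b c" "w d a = w a d" "w d b = w b d" "w d c = w c d"
    "w a b \<ge> 0" "w a c \<ge> 0" "w b c \<ge> 0" "w a d \<ge> 0" "w b d \<ge> 0" "w c d \<ge> 0"
    by (rule wgraph_sym[OF w] wgraph_nonneg[OF w]; use V in simp)+
  have id: "corr V f id = N" "corr V f (\<lambda>x. x) = N"
    by (simp_all add: N_def id_def)
  have st: "f (swp a b \<circ> \<sigma>) + f (swp b c \<circ> \<sigma>) + f (swp a c \<circ> \<sigma>) = 0"
    "f (dbl a b c d \<circ> \<sigma>) = f \<sigma>" "f (dbl a c b d \<circ> \<sigma>) = f \<sigma>" "f (dbl a d b c \<circ> \<sigma>) = f \<sigma>"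
    if "\<sigma> permutes V" for \<sigma>
    using four_point_structure[OF V zm tr that]
      four_point_structure(3)[of V a c b d, OF _ _ zm tr that]
      four_point_structure(3)[of V a d b c, OF _ _ zm tr that] V by auto
  have sw: "f (swp c d \<circ> \<sigma>) = f (swp a b \<circ> \<sigma>)" "f (swp b d \<circ> \<sigma>) = f (swp a c \<circ> \<sigma>)"
    "f (swp a d \<circ> \<sigma>) = f (swp b c \<circ> \<sigma>)" if \<sigma>: "\<sigma> permutes V" for \<sigma>
  proof -
    have 1: "dbl a b c d \<circ> (swp c d \<circ> \<sigma>) = swp a b \<circ> \<sigma>" "dbl a c b d \<circ> (swp b d \<circ> \<sigma>) = swp a c \<circ> \<sigma>"
      "dbl a d b c \<circ> (swp b c \<circ> \<sigma>) = swp a d \<circ> \<sigma>"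
      by (simp_all add: dbl_def fun_eq_iff)
    have p: "swp c d \<circ> \<sigma> permutes V" "swp b d \<circ> \<sigma> permutes V" "swp b c \<circ> \<sigma> permutes V"
      by (rule permutes_compose[OF \<sigma> permutes_swap_id]; use V in simp)+
    show "f (swp c d \<circ> \<sigma>) = f (swp a b \<circ> \<sigma>)" "f (swp b d \<circ> \<sigma>) = f (swp a c \<circ> \<sigma>)"
      "f (swp a d \<circ> \<sigma>) = f (swp b c \<circ> \<sigma>)"
      using st(2)[OF p(1)] st(3)[OF p(2)] st(4)[OF p(3)] unfolding 1 by simp_all
  qed
  have cs: "corr V f (swp c d) = corr V f (swp a b)" "corr V f (swp b d) = corr V f (swp a c)"
    "corr V f (swp a d) = corr V f (swp b c)"
    unfolding corr_def by (auto intro!: sum.cong simp: sw)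
  have "corr V f (swp a b) + corr V f (swp b c) + corr V f (swp a c) =
      (\<Sum>\<sigma>\<in>Sym V. f \<sigma> * (f (swp a b \<circ> \<sigma>) + f (swp b c \<circ> \<sigma>) + f (swp a c \<circ> \<sigma>)))"
    by (simp add: corr_def distrib_left sum.distrib)
  also have "\<dots> = 0"
    using st(1) by (intro sum.neutral) auto
  finally have tot: "corr V f (swp a b) + corr V f (swp b c) + corr V f (swp a c) = 0" .
  define x1 where "x1 = N - corr V f (swp a b)"
  define x2 where "x2 = N - corr V f (swp a c)"
  define x3 where "x3 = N - corr V f (swp b c)"
  have x2: "x2 = 3 * N - x1 - x3"
    using tot by (simp add: x1_def x2_def x3_def)
  have x1: "x1 \<ge> 0"
    using corr_swp_le[of a V b f] V by (simp add: x1_def N_def)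
  have x3: "x3 \<le> 2 * N"
    using corr_swp_ge[of b V c f] V by (simp add: x3_def N_def)
  define \<alpha> where "\<alpha> = w a b + w c d"
  define \<beta> where "\<beta> = w a c + w b d"
  define \<gamma> where "\<gamma> = w a d + w b c"
  have ord': "\<alpha> \<ge> \<beta>" "\<beta> \<ge> \<gamma>" "\<gamma> \<ge> 0"
    using ord sym by (auto simp: \<alpha>_def \<beta>_def \<gamma>_def)
  have sumV: "(\<Sum>i\<in>V. h i) = h a + h b + h c + h d" for h :: "'a \<Rightarrow> real"
    using V by (simp add: add.assoc)
  have "Q V w f = 2 * (\<alpha> * x1 + \<beta> * x2 + \<gamma> * x3)"
    unfolding Q_def sumV
    by (simp add: \<alpha>_def \<beta>_def \<gamma>_def x1_def x2_def x3_def id sym cs transpose_commute[of b a]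
        transpose_commute[of c a] transpose_commute[of d a] transpose_commute[of c b]
        transpose_commute[of d b] transpose_commute[of d c] algebra_simps)
  then have Qle: "\<alpha> * x1 + \<beta> * x2 + \<gamma> * x3 \<le> \<mu> * N"
    using eq by (simp add: N_def)
  have g: "\<mu> * ((x a)\<^sup>2 + (x b)\<^sup>2 + (x c)\<^sup>2 + (x d)\<^sup>2) \<le> w a b * (x a - x b)\<^sup>2 + w a c * (x a - x c)\<^sup>2
      + w b c * (x b - x c)\<^sup>2 + w a d * (x a - x d)\<^sup>2 + w b d * (x b - x d)\<^sup>2 + w c d * (x c - x d)\<^sup>2"
    if "x a + x b + x c + x d = 0" for x
  proof -
    have "2 * \<mu> * (\<Sum>i\<in>V. (x i)\<^sup>2) \<le> Ev V w x"
      using gap that by (simp add: gap_ge_def sumV)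
    moreover have "Ev V w x = 2 * (w a b * (x a - x b)\<^sup>2 + w a c * (x a - x c)\<^sup>2
      + w b c * (x b - x c)\<^sup>2 + w a d * (x a - x d)\<^sup>2 + w b d * (x b - x d)\<^sup>2 + w c d * (x c - x d)\<^sup>2)"
      unfolding Ev_def sumV by (simp add: sym power2_commute[of "x b" "x a"] power2_commute[of "x c" "x a"]
          power2_commute[of "x c" "x b"] power2_commute[of "x d"])
    ultimately show ?thesis
      by (simp add: sumV)
  qed
  define X where "X p q r s = ((\<lambda>_. 0)(a := p, b := q, c := r, d := s))" for p q r s :: real
  have X: "X p q r s a = p" "X p q r s b = q" "X p q r s c = r" "X p q r s d = s" for p q r s
    using V by (auto simp: X_def)
  have "\<mu> \<le> \<beta> + \<gamma>"
    using g[of "X 1 1 (-1) (-1)"] by (simp add: X \<beta>_def \<gamma>_def)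
  then have "\<mu> * N \<le> (\<beta> + \<gamma>) * N"
    using N by simp
  \<comment> \<open>By the ordering of the pair sums and the bounds on x1 and x3 every summand on
    the right is nonnegative, while \<open>Qle\<close> makes their sum nonpositive; all three must
    vanish.\<close>
  moreover have "\<alpha> * x1 + \<beta> * x2 + \<gamma> * x3 - (\<beta> + \<gamma>) * N =
      (\<alpha> - \<beta>) * x1 + (\<beta> - \<gamma>) * (2 * N - x3) + \<gamma> * N"
    unfolding x2 by (simp add: algebra_simps)
  moreover have nn: "(\<alpha> - \<beta>) * x1 \<ge> 0" "(\<beta> - \<gamma>) * (2 * N - x3) \<ge> 0" "\<gamma> * N \<ge> 0"
    using ord' x1 x3 N by simp_all
  ultimately have z: "(\<alpha> - \<beta>) * x1 = 0" "(\<beta> - \<gamma>) * (2 * N - x3) = 0" "\<gamma> * N = 0"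
    using Qle by linarith+
  have \<gamma>: "\<gamma> = 0"
    using z(3) N by simp
  have \<beta>: "\<beta> > 0"
  proof (rule ccontr)
    assume "\<not> \<beta> > 0"
    then have "w a c = 0" "w b d = 0" "w a d = 0" "w b c = 0"
      using \<gamma> ord' sym by (auto simp: \<beta>_def \<gamma>_def)
    moreover have ab: "{a, b} \<subset> V" "V - {a, b} = {c, d}"
      using V by auto
    have "\<exists>i\<in>{a, b}. \<exists>j\<in>V - {a, b}. w i j > 0"
      by (rule conn[unfolded conn_def, rule_format]) (use ab in simp)
    ultimately show False
      unfolding ab(2) by auto
  qed
  have x3': "x3 = 2 * N"
    using z(2) \<gamma> \<beta> by simp
  \<comment> \<open>Otherwise \<open>f\<close> would be invariant under \<open>swp a b\<close> and
    change sign under \<open>swp b c\<close>; the relation \<open>st(1)\<close> between the three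
    transpositions would then annihilate it.\<close>
  have "x1 \<noteq> 0"
  proof
    assume "x1 = 0"
    then have "(\<Sum>\<sigma>\<in>Sym V. (f \<sigma> - f (swp a b \<circ> \<sigma>))\<^sup>2) = 0"
      using corr_swp_diff[of a V b f] V by (simp add: x1_def N_def)
    moreover have fS: "finite (Sym V)"
      using V by (intro finite_permutations) simp
    ultimately have i1: "f (swp a b \<circ> \<sigma>) = f \<sigma>" if "\<sigma> permutes V" for \<sigma>
      using that by (simp add: sum_nonneg_eq_0_iff)
    have "(\<Sum>\<sigma>\<in>Sym V. (f \<sigma> + f (swp b c \<circ> \<sigma>))\<^sup>2) = 0"
      using corr_swp_add[of b V c f] V x3' by (simp add: x3_def N_def)
    then have i3: "f (swp b c \<circ> \<sigma>) = - f \<sigma>" if "\<sigma> permutes V" for \<sigma>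
      using fS that by (simp add: sum_nonneg_eq_0_iff add_eq_0_iff)
    have "f (swp a c \<circ> \<sigma>) = 0" if "\<sigma> permutes V" for \<sigma>
      using st(1)[OF that] i1[OF that] i3[OF that] by simp
    moreover have "swp a c \<circ> \<sigma> permutes V" if "\<sigma> permutes V" for \<sigma>
      by (rule permutes_compose[OF that permutes_swap_id]; use V in simp)
    ultimately have "f (swp a c \<circ> (swp a c \<circ> \<sigma>)) = 0" if "\<sigma> permutes V" for \<sigma>
      using that by blast
    then have "corr V f id = 0"
      by (simp add: corr_id o_assoc)
    with N0 show False ..
  qed
  then have \<alpha>: "\<alpha> = \<beta>"
    using z(1) by simp
  have g0: "w a d = 0" "w b c = 0"
    using \<gamma> sym by (auto simp: \<gamma>_def)
  have "\<alpha> * N \<le> \<mu> * N"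
    using Qle \<gamma> unfolding x2 x3' \<alpha> by (simp add: algebra_simps)
  then have \<mu>: "\<alpha> \<le> \<mu>"
    using N by simp
  \<comment> \<open>Since \<open>\<alpha> \<le> \<mu>\<close>, the bound implies
    \<open>0 \<le> 4 * \<alpha> * e\<^sup>2 + 8 * e * p\<close> for all e, so the linear coefficient
    must vanish; the right side is minimal at \<open>e = - p / \<alpha>\<close>.\<close>
  have pert: "p = 0" if "\<And>e. \<mu> * (4 + 4 * e\<^sup>2) \<le> 4 * \<alpha> + 8 * \<alpha> * e\<^sup>2 + 8 * e * p" for p
  proof -
    have "\<alpha> * (4 + 4 * (p / \<alpha>)\<^sup>2) \<le> \<mu> * (4 + 4 * (p / \<alpha>)\<^sup>2)"
      using \<mu> by (intro mult_right_mono) auto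
    also have "\<dots> \<le> 4 * \<alpha> + 8 * \<alpha> * (p / \<alpha>)\<^sup>2 - 8 * (p / \<alpha>) * p"
      using that[of "- (p / \<alpha>)"] by simp
    finally have "4 * \<alpha> * (p / \<alpha>)\<^sup>2 \<le> 0"
      using \<beta> \<alpha> by (simp add: field_simps power2_eq_square mult_le_0_iff)
    then show ?thesis
      using \<beta> \<alpha> by (simp add: mult_le_0_iff)
  qed
  have "w a c - w b d = 0"
  proof (rule pert)
    fix e :: real
    show "\<mu> * (4 + 4 * e\<^sup>2) \<le> 4 * \<alpha> + 8 * \<alpha> * e\<^sup>2 + 8 * e * (w a c - w b d)"
    proof -
      have "\<mu> * (4 + 4 * e\<^sup>2) \<le> 4 * \<beta> + 4 * (\<alpha> + \<beta>) * e\<^sup>2 + 8 * e * (w a c - w b d)"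
        using g[of "X (1 + e) (1 - e) (-1 - e) (-1 + e)"]
        by (simp add: X g0 \<alpha>_def \<beta>_def power2_eq_square algebra_simps)
      then show ?thesis
        unfolding \<alpha> by simp
    qed
  qed
  moreover have "w a b - w c d = 0"
  proof (rule pert)
    fix e :: real
    show "\<mu> * (4 + 4 * e\<^sup>2) \<le> 4 * \<alpha> + 8 * \<alpha> * e\<^sup>2 + 8 * e * (w a b - w c d)"
    proof -
      have "\<mu> * (4 + 4 * e\<^sup>2) \<le> 4 * \<alpha> + 4 * (\<alpha> + \<beta>) * e\<^sup>2 + 8 * e * (w a b - w c d)"
        using g[of "X (1 + e) (-1 - e) (1 - e) (-1 + e)"]
        by (simp add: X g0 \<alpha>_def \<beta>_def power2_eq_square algebra_simps)
      then show ?thesis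
        unfolding \<alpha> by simp
    qed
  qed
  ultimately have "w a b = w a c" "w c d = w a c" "w b d = w a c" "w a c > 0"
    using \<alpha> \<beta> by (auto simp: \<alpha>_def \<beta>_def)
  then have "distinct [a, b, d, c] \<and> V = {a, b, d, c} \<and> w a c > 0 \<and> w a b = w a c \<and> w b d = w a c
      \<and> w d c = w a c \<and> w c a = w a c \<and> w a d = 0 \<and> w b c = 0"
    using V sym g0 by auto
  then have "uniform_C4 V w"
    unfolding uniform_C4_def by blast
  with nu show False ..
qed

lemma four_point:
  assumes V: "finite V" "card V = 4" and w: "wgraph V w" "conn V w" "gap_ge V w \<mu>"
    and f: "zero_marg V f" "triple_alt V f" "Q V w f \<le> 2 * \<mu> * corr V f id" and nu: "\<not> uniform_C4 V w"
  shows "corr V f id = 0"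
proof -
  obtain a b c d where abcd: "V = {a, b, c, d}" "distinct [a, b, c, d]"
  proof -
    obtain a A where A: "V = insert a A" "a \<notin> A" "card A = 3"
      using V by (metis card_Suc_eq eval_nat_numeral(2) semiring_norm(26,27,28))
    then obtain b c d where "A = {b, c, d}" "b \<noteq> c" "b \<noteq> d" "c \<noteq> d"
      using card_3_iff by metis
    with A show ?thesis
      using that[of a b c d] by auto
  qed
  define \<alpha> where "\<alpha> = w a b + w c d"
  define \<beta> where "\<beta> = w a c + w b d"
  define \<gamma> where "\<gamma> = w a d + w b c"
  have sym: "w b a = w a b" "w c a = w a c" "w c b = w b c" "w d a = w a d" "w d b = w b d" "w d c = w c d"
    by (rule wgraph_sym[OF w(1)]; use abcd in simp)+
  have four: ?thesis if "V = {p, q, r, s}" "distinct [p, q, r, s]"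
    "w p q + w r s \<ge> w p r + w q s" "w p r + w q s \<ge> w p s + w q r" for p q r s
    by (rule four_point_ordered[OF that(1,2) w f that(3,4) nu])
  have sets: "V = {a, b, d, c}" "V = {a, c, b, d}" "V = {a, c, d, b}" "V = {a, d, b, c}" "V = {a, d, c, b}"
    using abcd by auto
  consider "\<alpha> \<ge> \<beta>" "\<beta> \<ge> \<gamma>" | "\<alpha> \<ge> \<gamma>" "\<gamma> \<ge> \<beta>" | "\<beta> \<ge> \<alpha>" "\<alpha> \<ge> \<gamma>" | "\<beta> \<ge> \<gamma>" "\<gamma> \<ge> \<alpha>"
    | "\<gamma> \<ge> \<alpha>" "\<alpha> \<ge> \<beta>" | "\<gamma> \<ge> \<beta>" "\<beta> \<ge> \<alpha>"
    by linarith
  then show ?thesis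
  proof cases
    case 1
    then show ?thesis
      by (intro four[OF abcd(1)]) (use abcd in \<open>auto simp: \<alpha>_def \<beta>_def \<gamma>_def sym\<close>)
  next
    case 2
    then show ?thesis
      by (intro four[OF sets(1)]) (use abcd in \<open>auto simp: \<alpha>_def \<beta>_def \<gamma>_def sym\<close>)
  next
    case 3
    then show ?thesis
      by (intro four[OF sets(2)]) (use abcd in \<open>auto simp: \<alpha>_def \<beta>_def \<gamma>_def sym\<close>)
  next
    case 4
    then show ?thesis
      by (intro four[OF sets(3)]) (use abcd in \<open>auto simp: \<alpha>_def \<beta>_def \<gamma>_def sym\<close>)
  next
    case 5
    then show ?thesis
      by (intro four[OF sets(4)]) (use abcd in \<open>auto simp: \<alpha>_def \<beta>_def \<gamma>_def sym\<close>)
  next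
    case 6
    then show ?thesis
      by (intro four[OF sets(5)]) (use abcd in \<open>auto simp: \<alpha>_def \<beta>_def \<gamma>_def sym\<close>)
  qed
qed

text \<open>For vectors of sum zero the excess of \<open>Ev\<close> over the bound is
  \<open>4 * w * (x p + x r)\<^sup>2\<close>. Thus the bound is attained when the values at opposite
  vertices cancel.\<close>

lemma gap_ge_uniform_C4:
  assumes W: "W = {p, q, r, s}" "distinct [p, q, r, s]" and c: "wgraph W c"
    "c p q = w" "c q r = w" "c r s = w" "c s p = w" "c p r = 0" "c q s = 0"
  shows "Ev W c x = 2 * w * ((x p - x q)\<^sup>2 + (x q - x r)\<^sup>2 + (x r - x s)\<^sup>2 + (x s - x p)\<^sup>2)"
    and "gap_ge W c (2 * w)"
proof -
  have sym: "c q p = w" "c r q = w" "c s r = w" "c p s = w" "c r p = 0" "c s q = 0" and w: "w \<ge> 0"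
    using wgraph_sym[OF c(1), of q p] wgraph_sym[OF c(1), of r q] wgraph_sym[OF c(1), of s r]
      wgraph_sym[OF c(1), of p s] wgraph_sym[OF c(1), of r p] wgraph_sym[OF c(1), of s q]
      wgraph_nonneg[OF c(1), of p q] c(2-) W(1) by auto
  have sumW: "(\<Sum>i\<in>W. h i) = h p + h q + h r + h s" for h :: "'a \<Rightarrow> real"
    using W by (simp add: add.assoc)
  show Ev: "Ev W c x = 2 * w * ((x p - x q)\<^sup>2 + (x q - x r)\<^sup>2 + (x r - x s)\<^sup>2 + (x s - x p)\<^sup>2)" for x
    unfolding Ev_def sumW by (simp add: sym c(2-) power2_eq_square algebra_simps)
  show "gap_ge W c (2 * w)"
    unfolding gap_ge_def
  proof (intro allI impI)
    fix x :: "'a \<Rightarrow> real" assume "sum x W = 0"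
    then have s: "x s = - x p - x q - x r"
      by (simp add: sumW)
    have "Ev W c x - 2 * (2 * w) * (\<Sum>i\<in>W. (x i)\<^sup>2) = 4 * w * (x p + x r)\<^sup>2"
      unfolding Ev sumW s by (simp add: power2_eq_square algebra_simps)
    moreover have "4 * w * (x p + x r)\<^sup>2 \<ge> 0"
      using w by simp
    ultimately show "2 * (2 * w) * (\<Sum>i\<in>W. (x i)\<^sup>2) \<le> Ev W c x"
      by linarith
  qed
qed

text \<open>
  The gap eigenspace of the reduced cycle would have to consist of vectors with vanishing harmonic
  extension to \<open>v\<close>; this forces equal, hence vanishing, weights from \<open>v\<close> to opposite vertices.
\<close>

lemma red_uniform_C4:
  assumes V: "finite V" "wgraph V c" "v \<in> V" and conn: "conn V c" and gap: "gap_ge V c \<mu>" "\<mu> \<ge> 0"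
    and u4: "uniform_C4 (V - {v}) (red V c v)"
    and zm: "zero_marg V f" and eq: "Q V c f \<le> 2 * \<mu> * corr V f id"
  shows "corr V f id = 0"
proof (rule ccontr)
  assume N0: "corr V f id \<noteq> 0"
  then have N: "corr V f id > 0"
    using corr_id_nonneg[of V f] by simp
  define W where "W = V - {v}"
  define d where "d = red V c v"
  obtain p q r s w where W: "distinct [p, q, r, s]" "W = {p, q, r, s}" and w: "w > 0"
    and d: "d p q = w" "d q r = w" "d r s = w" "d s p = w" "d p r = 0" "d q s = 0"
    using u4 unfolding uniform_C4_def W_def d_def by metis
  have wd: "wgraph W d"
    unfolding W_def d_def by (rule wgraph_red[OF V(2,3)])
  note C4 = gap_ge_uniform_C4[OF W(2,1) wd d]
  \<comment> \<open>The cosets are estimated with the gap \<open>2 * w\<close> of the reduced cycle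
    instead of \<mu>. As \<open>f\<close> is nonzero and attains equality with \<mu>, this yields
    \<open>2 * w \<le> \<mu>\<close>.\<close>
  have "2 * (2 * w) * corr W (coset v k f) id \<le> Q W d (coset v k f)" if "k \<in> V" for k
  proof (rule aldous_gap[OF _ wd C4(2)])
    show "(\<Sum>\<sigma>\<in>Sym W. coset v k f \<sigma>) = 0"
      unfolding W_def using V zm that by (intro coset_sum_zero)
  qed (use V w in \<open>auto simp: W_def\<close>)
  then have "2 * (2 * w) * corr V f id \<le> (\<Sum>k\<in>V. Q W d (coset v k f))"
    unfolding corr_cosets[OF V(1,3), of f] sum_distrib_left W_def by (rule sum_mono)
  also have "\<dots> \<le> Q V c f"
    unfolding W_def d_def by (rule sum_Q_red_le[OF V])
  finally have "2 * (2 * w) * corr V f id \<le> 2 * \<mu> * corr V f id"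
    using eq by linarith
  then have \<mu>: "2 * w \<le> \<mu>"
    using N by simp
  define C where "C = sum (c v) W"
  have sumW: "(\<Sum>i\<in>W. h i) = h p + h q + h r + h s" for h :: "'a \<Rightarrow> real"
    using W by (simp add: add.assoc)
  have cv: "c v i \<ge> 0" if "i \<in> W" for i
    using that V by (intro wgraph_nonneg[OF V(2)]) (auto simp: W_def)
  have Cpos: "C > 0"
  proof (rule ccontr)
    assume "\<not> C > 0"
    then have "C = 0"
      using cv unfolding C_def by (meson not_less order_antisym sum_nonneg)
    then have z: "c v i = 0" if "i \<in> V - {v}" for i
      using sum_weights_zero[OF V] that unfolding C_def W_def by blast
    have "p \<in> V - {v}"
      using W unfolding W_def by auto
    then have "{v} \<noteq> {} \<and> {v} \<subset> V"
      using V by auto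
    then have "\<exists>i\<in>{v}. \<exists>j\<in>V - {v}. c i j > 0"
      using conn unfolding conn_def by blast
    then show False
      using z by auto
  qed
  have n: "card V \<ge> 2"
  proof -
    have "V = insert v W" "v \<notin> W" "finite W"
      using V by (auto simp: W_def)
    then show ?thesis
      using W by simp
  qed
  \<comment> \<open>For a vector attaining the gap of the reduced cycle,
    \<open>2 * w \<le> \<mu>\<close> leaves no room for the surplus term with
    \<open>h\<^sup>2\<close> in \<open>gap_ge_red_strong\<close>, so its harmonic extension vanishes
    at \<open>v\<close>.\<close>
  have harm: "(\<Sum>i\<in>W. c v i * x i) = 0" if "sum x W = 0" "Ev W d x = 4 * w * (\<Sum>i\<in>W. (x i)\<^sup>2)" for x
  proof -
    define h where "h = (\<Sum>i\<in>W. c v i * x i) / C"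
    have "2 * \<mu> * ((\<Sum>i\<in>W. (x i)\<^sup>2) + h\<^sup>2 * (1 - 1 / card V)) \<le> Ev W d x"
      unfolding h_def C_def W_def d_def
      by (rule gap_ge_red_strong[OF V gap(1)]) (use that in \<open>simp add: W_def\<close>)
    also have "\<dots> \<le> 2 * \<mu> * (\<Sum>i\<in>W. (x i)\<^sup>2)"
      unfolding that(2) using \<mu> by (intro mult_right_mono sum_nonneg) auto
    finally have "\<mu> * (h\<^sup>2 * (1 - 1 / card V)) \<le> 0"
      unfolding distrib_left by linarith
    moreover have "\<mu> > 0" "1 - 1 / real (card V) > 0"
      using \<mu> w n by simp_all
    ultimately have "h = 0"
      by (simp add: mult_le_0_iff)
    then show ?thesis
      using Cpos by (simp add: h_def)
  qed
  have ne: "p \<noteq> q" "p \<noteq> r" "p \<noteq> s" "q \<noteq> r" "q \<noteq> s" "r \<noteq> s" "q \<noteq> p" "r \<noteq> p" "s \<noteq> p" "r \<noteq> q" "s \<noteq> q" "s \<noteq> r"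
    using W by auto
  have 1: "c v p = c v r"
    using harm[of "(\<lambda>_. 0)(p := 1, r := -1)"] by (simp add: sumW C4(1) ne)
  have 2: "c v q = c v s"
    using harm[of "(\<lambda>_. 0)(q := 1, s := -1)"] by (simp add: sumW C4(1) ne)
  have in_V: "p \<in> V" "q \<in> V" "r \<in> V" "s \<in> V"
    using W unfolding W_def by auto
  have nonneg: "c p r \<ge> 0" "c q s \<ge> 0"
    using in_V by (auto intro: wgraph_nonneg[OF V(2)])
  have "c v p * c v r / C \<ge> 0" "c v q * c v s / C \<ge> 0"
    using cv W Cpos by simp_all
  then have "c v p * c v r / C = 0" "c v q * c v s / C = 0"
    using nonneg d(5,6) unfolding d_def red_def C_def W_def by linarith+
  then have "c v p = 0" "c v r = 0" "c v q = 0" "c v s = 0"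
    using 1 2 Cpos by simp_all
  then show False
    using Cpos by (simp add: C_def sumW)
qed

lemma alt_small:
  assumes "finite V" "card V \<le> 2"
  shows "square_alt V f" "triple_alt V f"
proof -
  have no3: False if "a \<in> V" "b \<in> V" "c \<in> V" "distinct [a, b, c]" for a b c
  proof -
    have "card {a, b, c} \<le> card V"
      using assms that by (intro card_mono) auto
    then show False
      using that assms by simp
  qed
  show "triple_alt V f"
    unfolding triple_alt_def using no3 by blast
  have "distinct [a, b, c, d] \<Longrightarrow> distinct [a, b, c]" for a b c d :: 'a
    by auto
  then show "square_alt V f"
    unfolding square_alt_def using no3 by blast
qed

lemma square_alt_cong:
  assumes eq: "\<And>\<sigma>. \<sigma> permutes V \<Longrightarrow> f \<sigma> = p \<sigma>" and p: "square_alt V p"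
  shows "square_alt V f"
  unfolding square_alt_def
proof (intro ballI impI)
  fix a b c d \<sigma> assume *: "a \<in> V" "b \<in> V" "c \<in> V" "d \<in> V" "\<sigma> \<in> Sym V" "distinct [a, b, c, d]"
  then have s: "swp a b permutes V" "swp c d permutes V" "\<sigma> permutes V"
    by (auto intro: permutes_swap_id)
  note pp = permutes_compose[OF s(3,1)] permutes_compose[OF s(3,2)] permutes_compose[OF permutes_compose[OF s(3,2)] s(1)]
  show "f \<sigma> + f (swp a b \<circ> (swp c d \<circ> \<sigma>)) = f (swp a b \<circ> \<sigma>) + f (swp c d \<circ> \<sigma>)"
    unfolding eq[OF s(3)] eq[OF pp(1)] eq[OF pp(2)] eq[OF pp(3)]
    by (rule p[unfolded square_alt_def, rule_format, OF *])
qed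

lemma triple_alt_cong:
  assumes eq: "\<And>\<sigma>. \<sigma> permutes V \<Longrightarrow> f \<sigma> = p \<sigma>" and p: "triple_alt V p"
  shows "triple_alt V f"
  unfolding triple_alt_def
proof (intro ballI impI)
  fix a b c \<sigma> assume *: "a \<in> V" "b \<in> V" "c \<in> V" "\<sigma> \<in> Sym V" "distinct [a, b, c]"
  then have s: "\<sigma> permutes V"
    by simp
  note pp = permutes_compose[OF s cyc_permutes[OF *(1-3)]] permutes_compose[OF s cyc_permutes[OF *(1,3,2)]]
    permutes_compose[OF s permutes_swap_id[OF *(1,2)]] permutes_compose[OF s permutes_swap_id[OF *(2,3)]]
    permutes_compose[OF s permutes_swap_id[OF *(1,3)]]
  show "f \<sigma> + f (cyc a b c \<circ> \<sigma>) + f (cyc a c b \<circ> \<sigma>) =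
    f (swp a b \<circ> \<sigma>) + f (swp b c \<circ> \<sigma>) + f (swp a c \<circ> \<sigma>)"
    unfolding eq[OF s] eq[OF pp(1)] eq[OF pp(2)] eq[OF pp(3)] eq[OF pp(4)] eq[OF pp(5)]
    by (rule p[unfolded triple_alt_def, rule_format, OF *])
qed

lemma alt_proj: "square_alt V (proj V f)" "triple_alt V (proj V f)"
  unfolding proj_def[abs_def] by (rule square_alt_additive triple_alt_additive)+

text \<open>Additivity is stated through its two local relations because these can be read off from
  cosets. With at least five points the cosets supply both relations and \<open>g\<close> vanishes;
  with four they supply \<open>triple_alt\<close> only, with three neither, and the explicit
  arguments take over.\<close>

lemma equality_alt:
  assumes "finite V" "wgraph V c" "conn V c" "gap_ge V c \<mu>" "\<mu> \<ge> 0" "\<not> uniform_C4 V c"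
    "(\<Sum>\<sigma>\<in>Sym V. f \<sigma>) = 0" "Q V c f \<le> 2 * \<mu> * corr V f id"
  shows "square_alt V f \<and> triple_alt V f"
  using assms
proof (induction "card V" arbitrary: V c f rule: less_induct)
  case less
  note V = less.prems(1) and w = less.prems(2) and conn = less.prems(3) and gap = less.prems(4,5)
    and nu = less.prems(6)
  show ?case
  proof (cases "card V \<le> 2")
    case True
    then show ?thesis
      using alt_small[OF V] by simp
  next
    case False
    define g where "g = (\<lambda>\<sigma>. f \<sigma> - proj V f \<sigma>)"
    have zg: "zero_marg V g"
      unfolding g_def by (rule zero_marg_diff_proj) (use False less.prems in auto)
    have eq: "Q V c g \<le> 2 * \<mu> * corr V g id"
      using Q_diff_proj_le[OF V _ w gap(1) less.prems(7)] less.prems(8) False unfolding g_def by simp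
    have slices: "square_alt (V - {v}) (coset v k g) \<and> triple_alt (V - {v}) (coset v k g)"
      if "v \<in> V" "k \<in> V" "\<not> uniform_C4 (V - {v}) (red V c v)" for v k
    proof (rule less.hyps)
      show "card (V - {v}) < card V"
        using V that by (intro card_Diff1_less)
      show "Q (V - {v}) (red V c v) (coset v k g) \<le> 2 * \<mu> * corr (V - {v}) (coset v k g) id"
        using slice_equality[OF V w that(1,2) gap zg eq] .
      show "(\<Sum>\<sigma>\<in>Sym (V - {v}). coset v k g \<sigma>) = 0"
        using coset_sum_zero[OF V that(1,2) zg] .
    qed (use V w that conn gap in \<open>auto intro: wgraph_red conn_red gap_ge_red\<close>)
    have "corr V g id = 0"
    proof (rule ccontr)
      assume N: "corr V g id \<noteq> 0"
      then have no_C4: "\<not> uniform_C4 (V - {v}) (red V c v)" if "v \<in> V" for v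
        using red_uniform_C4[OF V w that conn gap _ zg eq] by blast
      consider "card V = 3" | "card V = 4" | "card V \<ge> 5"
        using False by linarith
      then show False
      proof cases
        case 1
        then obtain x y z where "V = {x, y, z}" "distinct [x, y, z]"
          by (auto simp: card_3_iff)
        then show ?thesis
          using three_point[OF _ _ w conn gap(1) zg eq] N by blast
      next
        case 2
        have "triple_alt V g"
          by (rule triple_alt_slices) (use V 2 slices no_C4 in auto)
        then show ?thesis
          using four_point[OF V 2 w conn gap(1) zg _ eq nu] N by blast
      next
        case 3
        have "triple_alt V g" "square_alt V g"
          using V 3 slices no_C4 by (auto intro: triple_alt_slices square_alt_slices)
        then have "g \<sigma> = 0" if "\<sigma> permutes V" for \<sigma>
          using alt_zero_marg_zero[OF V _ zg] that 3 by fastforce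
        then have "corr V g id = 0"
          by (simp add: corr_id)
        then show ?thesis
          using N by simp
      qed
    qed
    then have "g \<sigma> = 0" if "\<sigma> permutes V" for \<sigma>
      by (rule corr_id_eq_0[OF V _ that])
    then have "f \<sigma> = proj V f \<sigma>" if "\<sigma> permutes V" for \<sigma>
      using that by (simp add: g_def)
    then show ?thesis
      using square_alt_cong[OF _ alt_proj(1)] triple_alt_cong[OF _ alt_proj(2)] by blast
  qed
qed

section \<open>Eigenvalues of symmetric operators on finitely supported functions\<close>

lemma sum_fun_apply: "(\<Sum>i\<in>A. F i) x = (\<Sum>i\<in>A. F i x)"
  for F :: "'i \<Rightarrow> 'x \<Rightarrow> 'b::comm_monoid_add"
  by (induction A rule: infinite_finite_induct) auto

lemma scaleR_fun_apply: "(r *\<^sub>R f) x = r *\<^sub>R f x"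
  by (simp add: scaleR_fun_def)

lemma subspace_vectors_on: "subspace (vectors_on X)"
  by (auto simp: subspace_def vectors_on_def scaleR_fun_apply)

lemma vectors_on_span:
  assumes "finite X"
  shows "vectors_on X \<subseteq> span ((\<lambda>x y. if y = x then 1 else 0) ` X)"
proof
  fix f assume f: "f \<in> vectors_on X"
  have "f = (\<Sum>x\<in>X. f x *\<^sub>R (\<lambda>y. if y = x then 1 else 0))"
  proof
    fix y
    show "f y = (\<Sum>x\<in>X. f x *\<^sub>R (\<lambda>y. if y = x then 1 else 0)) y"
      using assms f by (cases "y \<in> X") (auto simp: sum_fun_apply scaleR_fun_apply vectors_on_def if_distrib cong: if_cong)
  qed
  also have "\<dots> \<in> span ((\<lambda>x y. if y = x then 1 else 0) ` X)"
    by (intro span_sum span_scale span_base) auto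
  finally show "f \<in> span ((\<lambda>x y. if y = x then 1 else 0) ` X)" .
qed

lemma independent_vectors_on_finite:
  assumes "finite X" "independent B" "B \<subseteq> vectors_on X"
  shows "finite B" "card B \<le> card X"
proof -
  have "B \<subseteq> span ((\<lambda>x y. if y = x then 1 else 0 :: real) ` X)"
    using vectors_on_span[OF assms(1)] assms(3) by blast
  then have "finite B \<and> card B \<le> card ((\<lambda>x y. if y = x then 1 else 0 :: real) ` X)"
    using assms by (intro independent_span_bound) auto
  then show "finite B" "card B \<le> card X"
    using card_image_le[OF assms(1), of "\<lambda>x y. if y = x then 1 else 0 :: real"] by auto
qed

text \<open>Indexing the basis allows parametrization by pairs or disjoint sums; injectivity of the
  indexing follows from independence.\<close>

lemma dim_family:
  fixes g :: "'i \<Rightarrow> 'v::real_vector"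
  assumes I: "finite I" and S: "g ` I \<subseteq> S" "S \<subseteq> span (g ` I)"
    and indep: "\<And>a i. (\<Sum>i\<in>I. a i *\<^sub>R g i) = 0 \<Longrightarrow> i \<in> I \<Longrightarrow> a i = 0"
  shows "dim S = card I"
proof -
  have inj: "inj_on g I"
  proof
    fix i j assume ij: "i \<in> I" "j \<in> I" "g i = g j"
    show "i = j"
    proof (rule ccontr)
      assume "i \<noteq> j"
      define a where "a k = (if k = i then 1 else if k = j then -1 else 0 :: real)" for k
      have "(\<Sum>k\<in>I. a k *\<^sub>R g k) = (\<Sum>k\<in>{i, j}. a k *\<^sub>R g k)"
        using I ij by (intro sum.mono_neutral_right) (auto simp: a_def)
      also have "\<dots> = 0"
        using ij \<open>i \<noteq> j\<close> by (simp add: a_def)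
      finally have "a i = 0"
        using indep ij by blast
      then show False
        by (simp add: a_def)
    qed
  qed
  have "independent (g ` I)"
  proof -
    have "u v = 0" if uv: "(\<Sum>v\<in>g ` I. u v *\<^sub>R v) = 0" "v \<in> g ` I" for u v
    proof -
      obtain i where i: "i \<in> I" "v = g i"
        using uv(2) by auto
      have "(\<Sum>i\<in>I. u (g i) *\<^sub>R g i) = 0"
        using uv(1) by (simp add: sum.reindex[OF inj])
      then show ?thesis
        using indep[of "\<lambda>i. u (g i)" i] i by simp
    qed
    then show ?thesis
      using I by (auto simp: dependent_finite)
  qed
  then have "dim S = card (g ` I)"
    using S by (intro dim_unique[OF _ _ _ refl])
  then show ?thesis
    using card_image[OF inj] by simp
qed

lemma eigenspace_vectors_on: "eigenspace_on (vectors_on X) T \<mu> \<subseteq> vectors_on X"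
  by (auto simp: eigenspace_on_def)

lemma ip_self_eq_0:
  assumes "finite X" "f \<in> vectors_on X" "ip X f f = 0"
  shows "f = 0"
proof
  fix x
  have "x \<in> X \<Longrightarrow> f x = 0"
    using assms(1,3) by (simp add: ip_def sum_nonneg_eq_0_iff)
  then show "f x = 0 x"
    using assms(2) by (auto simp: vectors_on_def)
qed

text \<open>Symmetry makes eigenvectors for distinct eigenvalues orthogonal, hence independent, so
  there are at most \<open>card X\<close> eigenvalues.\<close>

lemma finite_eigenvalues:
  assumes X: "finite X"
    and sym: "\<And>f g. f \<in> vectors_on X \<Longrightarrow> g \<in> vectors_on X \<Longrightarrow> ip X f (T g) = ip X (T f) g"
  shows "finite (eigenvalues_on (vectors_on X) T)"
proof (rule ccontr)
  define E where "E = eigenvalues_on (vectors_on X) T"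
  assume "infinite (eigenvalues_on (vectors_on X) T)"
  then obtain F where F: "finite F" "card F = Suc (card X)" "F \<subseteq> E"
    unfolding E_def by (meson infinite_arbitrarily_large)
  have "\<forall>\<mu>\<in>F. \<exists>v. v \<in> eigenspace_on (vectors_on X) T \<mu> \<and> v \<noteq> 0"
    using F(3) by (auto simp: E_def eigenvalues_on_def)
  then obtain e where e: "\<And>\<mu>. \<mu> \<in> F \<Longrightarrow> e \<mu> \<in> eigenspace_on (vectors_on X) T \<mu>"
    "\<And>\<mu>. \<mu> \<in> F \<Longrightarrow> e \<mu> \<noteq> 0"
    by metis
  have eV: "e \<mu> \<in> vectors_on X" "T (e \<mu>) = \<mu> *\<^sub>R e \<mu>" if "\<mu> \<in> F" for \<mu>
    using e(1)[OF that] by (auto simp: eigenspace_on_def)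
  have orth: "ip X (e \<mu>) (e \<nu>) = 0" if "\<mu> \<in> F" "\<nu> \<in> F" "\<mu> \<noteq> \<nu>" for \<mu> \<nu>
  proof -
    have "ip X (e \<mu>) (T (e \<nu>)) = \<nu> * ip X (e \<mu>) (e \<nu>)" "ip X (T (e \<mu>)) (e \<nu>) = \<mu> * ip X (e \<mu>) (e \<nu>)"
      using that by (simp_all add: eV ip_def scaleR_fun_apply sum_distrib_left ac_simps)
    then have "\<nu> * ip X (e \<mu>) (e \<nu>) = \<mu> * ip X (e \<mu>) (e \<nu>)"
      using sym[OF eV(1)[OF that(1)] eV(1)[OF that(2)]] by metis
    then show ?thesis
      using that(3) by auto
  qed
  have "dim (span (e ` F)) = card F"
  proof (rule dim_family[OF F(1)])
    fix a \<mu> assume a: "(\<Sum>\<mu>\<in>F. a \<mu> *\<^sub>R e \<mu>) = 0" and \<mu>: "\<mu> \<in> F"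
    have "0 = ip X (e \<mu>) (\<Sum>\<mu>\<in>F. a \<mu> *\<^sub>R e \<mu>)"
      by (simp add: a ip_def)
    also have "\<dots> = (\<Sum>\<nu>\<in>F. a \<nu> * ip X (e \<mu>) (e \<nu>))"
      unfolding ip_def sum_fun_apply scaleR_fun_apply sum_distrib_left
      by (subst sum.swap) (simp add: ac_simps)
    also have "\<dots> = (\<Sum>\<nu>\<in>F. if \<nu> = \<mu> then a \<mu> * ip X (e \<mu>) (e \<mu>) else 0)"
      using orth \<mu> by (intro sum.cong) auto
    finally have "a \<mu> * ip X (e \<mu>) (e \<mu>) = 0"
      using F(1) \<mu> by simp
    then show "a \<mu> = 0"
      using ip_self_eq_0[OF X eV(1)[OF \<mu>]] e(2)[OF \<mu>] by auto
  qed (auto intro: span_base)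
  moreover obtain B where B: "B \<subseteq> span (e ` F)" "independent B" "card B = dim (span (e ` F))"
    by (metis basis_exists)
  moreover have "span (e ` F) \<subseteq> vectors_on X"
    using eV(1) by (intro span_minimal subspace_vectors_on) auto
  ultimately show False
    using independent_vectors_on_finite(2)[OF X B(2)] F(2) by auto
qed

lemma eigenvalue_mult_pos:
  assumes X: "finite X" and "\<mu> \<in> eigenvalues_on (vectors_on X) T"
  shows "eigenvalue_mult (vectors_on X) T \<mu> > 0"
proof -
  define S where "S = eigenspace_on (vectors_on X) T \<mu>"
  obtain v where v: "v \<in> S" "v \<noteq> 0"
    using assms(2) by (auto simp: eigenvalues_on_def S_def)
  obtain B where B: "B \<subseteq> S" "independent B" "S \<subseteq> span B" "card B = dim S"
    by (metis basis_exists)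
  have "finite B"
    using B eigenspace_vectors_on[of X T \<mu>] by (intro independent_vectors_on_finite[OF X B(2)]) (auto simp: S_def)
  moreover have "B \<noteq> {}"
    using B(3) v by auto
  ultimately show ?thesis
    using B(4) unfolding eigenvalue_mult_def S_def by (metis card_gt_0_iff)
qed

text \<open>The simple eigenvalue 0 fills exactly the position 0 of the list, so position 1 holds
  the smallest of the others.\<close>

lemma second_eigenvalue_eqI:
  assumes X: "finite X"
    and sym: "\<And>f g. f \<in> vectors_on X \<Longrightarrow> g \<in> vectors_on X \<Longrightarrow> ip X f (T g) = ip X (T f) g"
    and mult0: "eigenvalue_mult (vectors_on X) T 0 = 1" and zero: "0 \<in> eigenvalues_on (vectors_on X) T"
    and l: "l > 0" "l \<in> eigenvalues_on (vectors_on X) T"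
    and ge: "\<And>\<mu>. \<mu> \<in> eigenvalues_on (vectors_on X) T \<Longrightarrow> \<mu> \<noteq> 0 \<Longrightarrow> l \<le> \<mu>"
  shows "second_eigenvalue (vectors_on X) T = l"
proof -
  define E where "E = eigenvalues_on (vectors_on X) T"
  have fin: "finite E"
    unfolding E_def by (rule finite_eigenvalues[OF X sym])
  have "Min E = 0"
    using fin zero l ge by (intro Min_eqI) (force simp: E_def)+
  then have 1: "sorted_list_of_set E = 0 # sorted_list_of_set (E - {0})"
    using sorted_list_of_set_nonempty[OF fin] zero by (metis E_def empty_iff)
  have "Min (E - {0}) = l"
    using fin l ge by (intro Min_eqI) (auto simp: E_def)
  then have 2: "sorted_list_of_set (E - {0}) = l # sorted_list_of_set (E - {0} - {l})"
    using sorted_list_of_set_nonempty[OF finite_Diff[OF fin], of "{0}"] l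
    by (metis Diff_iff E_def empty_iff order_less_irrefl singletonD)
  obtain m where m: "eigenvalue_mult (vectors_on X) T l = Suc m"
    using eigenvalue_mult_pos[OF X l(2)] gr0_implies_Suc by blast
  show ?thesis
    by (simp add: second_eigenvalue_def eigenvalue_list_def E_def[symmetric] 1 2 mult0 m)
qed

section \<open>Attainment of the spectral gap\<close>

text \<open>Bolzano-Weierstrass in finitely many coordinates, refining the subsequence once for
  every coordinate.\<close>

lemma finite_family_convergent_subsequence:
  fixes u :: "nat \<Rightarrow> 'i \<Rightarrow> real"
  assumes "finite F" "\<And>n i. i \<in> F \<Longrightarrow> \<bar>u n i\<bar> \<le> B"
  shows "\<exists>r l. strict_mono r \<and> (\<forall>i\<in>F. (\<lambda>n. u (r n) i) \<longlonglongrightarrow> l i)"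
  using assms
proof (induction F rule: finite_induct)
  case empty
  show ?case
    using strict_mono_id by auto
next
  case (insert j F)
  obtain r l where r: "strict_mono r" "\<And>i. i \<in> F \<Longrightarrow> (\<lambda>n. u (r n) i) \<longlonglongrightarrow> l i"
    using insert.IH insert.prems by (metis insertCI)
  obtain s :: "nat \<Rightarrow> nat" where s: "strict_mono s" "monoseq (\<lambda>n. u (r (s n)) j)"
    using seq_monosub[of "\<lambda>n. u (r n) j"] by (auto simp: o_def)
  have "Bseq (\<lambda>n. u (r (s n)) j)"
    using insert.prems by (intro BseqI'[of _ B]) auto
  then obtain L where L: "(\<lambda>n. u (r (s n)) j) \<longlonglongrightarrow> L"
    using Bseq_monoseq_convergent s(2) unfolding convergent_def by blast
  have "(\<lambda>n. u ((r \<circ> s) n) i) \<longlonglongrightarrow> (l(j := L)) i" if "i \<in> insert j F" for i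
  proof (cases "i = j")
    case False
    then have "((\<lambda>n. u (r n) i) \<circ> s) \<longlonglongrightarrow> l i"
      using that by (intro LIMSEQ_subseq_LIMSEQ r(2) s(1)) auto
    then show ?thesis
      using False by (simp add: o_def)
  qed (use L in simp)
  moreover have "strict_mono (r \<circ> s)"
    using r(1) s(1) by (rule strict_mono_o)
  ultimately show ?case
    by blast
qed

lemma sum_lap_commute:
  assumes "wgraph V c"
  shows "(\<Sum>a\<in>V. lap V c x a * y a) = (\<Sum>a\<in>V. x a * lap V c y a)"
proof -
  have "(\<Sum>i\<in>V. \<Sum>j\<in>V. c i j * x j * y i) = (\<Sum>i\<in>V. \<Sum>j\<in>V. c i j * x i * y j)"
    by (subst sum.swap) (use assms in \<open>auto simp: wgraph_def intro!: sum.cong\<close>)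
  moreover have "(\<Sum>a\<in>V. lap V c x a * y a) =
      2 * (\<Sum>i\<in>V. \<Sum>j\<in>V. c i j * x i * y i) - 2 * (\<Sum>i\<in>V. \<Sum>j\<in>V. c i j * x j * y i)"
    by (simp add: lap_def algebra_simps sum_subtractf sum_distrib_left sum_distrib_right)
  moreover have "(\<Sum>a\<in>V. x a * lap V c y a) =
      2 * (\<Sum>i\<in>V. \<Sum>j\<in>V. c i j * x i * y i) - 2 * (\<Sum>i\<in>V. \<Sum>j\<in>V. c i j * x i * y j)"
    by (simp add: lap_def algebra_simps sum_subtractf sum_distrib_left sum_distrib_right)
  ultimately show ?thesis
    by simp
qed

lemma Ev_add:
  assumes "wgraph V c"
  shows "Ev V c (\<lambda>i. x i + t * y i) = Ev V c x + 2 * t * (\<Sum>a\<in>V. lap V c x a * y a) + t\<^sup>2 * Ev V c y"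
proof -
  have lap: "lap V c (\<lambda>i. x i + t * y i) a = lap V c x a + t * lap V c y a" for a
    by (simp add: lap_def algebra_simps sum.distrib sum_subtractf sum_distrib_left)
  have "Ev V c (\<lambda>i. x i + t * y i) = (\<Sum>a\<in>V. lap V c x a * x a) + t * (\<Sum>a\<in>V. lap V c x a * y a)
      + t * (\<Sum>a\<in>V. x a * lap V c y a) + t\<^sup>2 * (\<Sum>a\<in>V. lap V c y a * y a)"
    unfolding sum_lap[OF assms, symmetric] lap
    by (simp add: algebra_simps sum.distrib sum_distrib_left power2_eq_square)
  then show ?thesis
    unfolding sum_lap_commute[OF assms, symmetric] sum_lap[OF assms] by simp
qed

lemma Ev_nonneg: "wgraph V c \<Longrightarrow> Ev V c x \<ge> 0"
  unfolding Ev_def by (intro sum_nonneg mult_nonneg_nonneg) (auto simp: wgraph_def)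

text \<open>A level set that is not all of V has an edge leaving it, and that edge contributes a
  positive term.\<close>

lemma Ev_zero_const:
  assumes V: "finite V" "wgraph V c" "conn V c" and "Ev V c x = 0" "a \<in> V" "b \<in> V"
  shows "x a = x b"
proof (rule ccontr)
  assume "x a \<noteq> x b"
  define A where "A = {i \<in> V. x i = x a}"
  have "a \<in> A" "b \<in> V" "b \<notin> A" "A \<subseteq> V"
    using assms(5,6) not_sym[OF \<open>x a \<noteq> x b\<close>] by (simp_all add: A_def)
  then have "A \<noteq> {} \<and> A \<subset> V"
    by auto
  then obtain i j where ij: "i \<in> A" "j \<in> V - A" "c i j > 0"
    using V(3) unfolding conn_def by blast
  have nn: "c i j * (x i - x j)\<^sup>2 \<ge> 0" if "i \<in> V" "j \<in> V" for i j
    using that V(2) by (auto simp: wgraph_def)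
  have "(\<Sum>j\<in>V. c i j * (x i - x j)\<^sup>2) = 0"
    using assms(4) V(1) ij nn unfolding Ev_def
    by (subst (asm) sum_nonneg_eq_0_iff) (auto simp: A_def intro!: sum_nonneg)
  moreover have iV: "i \<in> V" "j \<in> V" "x i \<noteq> x j"
    using ij by (simp_all add: A_def, metis)
  ultimately have "c i j * (x i - x j)\<^sup>2 = 0"
    using sum_nonneg_eq_0_iff[OF V(1), of "\<lambda>j. c i j * (x i - x j)\<^sup>2"] nn[OF iV(1)] by blast
  then show False
    using ij(3) iV(3) by simp
qed

text \<open>The Rayleigh quotient attains its infimum on the unit sphere of the sum-zero vectors by
  compactness, and the first variation makes the minimizer an eigenvector. Connectedness enters
  through positivity of the minimum.\<close>

lemma gap_attained:
  assumes V: "finite V" "card V \<ge> 2" "wgraph V c" "conn V c"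
  obtains \<mu> x where "\<mu> > 0" "gap_ge V c \<mu>" "\<And>i. i \<notin> V \<Longrightarrow> x i = 0" "sum x V = 0" "(\<Sum>i\<in>V. (x i)\<^sup>2) = 1"
    "\<And>a. a \<in> V \<Longrightarrow> lap V c x a = 2 * \<mu> * x a"
proof -
  define S where "S = {x :: 'a \<Rightarrow> real. sum x V = 0 \<and> (\<Sum>i\<in>V. (x i)\<^sup>2) = 1}"
  define m where "m = (INF x\<in>S. Ev V c x)"
  have bdd: "bdd_below (Ev V c ` S)"
    using Ev_nonneg[OF V(3)] by (intro bdd_belowI[of _ 0]) auto
  have ne: "S \<noteq> {}"
  proof -
    obtain a b where ab: "a \<in> V" "b \<in> V" "a \<noteq> b"
      using V(1,2) by (metis card_2_iff' obtain_subset_with_card_n subsetD)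
    define x where "x i = (if i = a then 1 / sqrt 2 else if i = b then - 1 / sqrt 2 else 0)" for i
    have s: "sum h V = sum h {a, b}" if "\<And>i. i \<noteq> a \<Longrightarrow> i \<noteq> b \<Longrightarrow> h i = 0" for h :: "'a \<Rightarrow> real"
      using ab V(1) that by (intro sum.mono_neutral_right) auto
    have "x \<in> S"
      using ab by (simp add: S_def s x_def power_divide)
    then show ?thesis by auto
  qed
  have "\<exists>x\<in>S. Ev V c x < m + 1 / Suc k" for k
  proof (rule ccontr)
    assume "\<not> ?thesis"
    then have "m + 1 / Suc k \<le> m"
      unfolding m_def using ne by (intro cINF_greatest) (auto simp: not_less m_def)
    then show False by simp
  qed
  then obtain u where u: "\<And>k. u k \<in> S" "\<And>k. Ev V c (u k) < m + 1 / Suc k"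
    by metis
  have "\<bar>u k i\<bar> \<le> 1" if "i \<in> V" for k i
  proof -
    have "(u k i)\<^sup>2 \<le> (\<Sum>i\<in>V. (u k i)\<^sup>2)"
      using V(1) that by (intro member_le_sum) auto
    then show ?thesis
      using u(1)[of k] by (simp add: S_def abs_square_le_1)
  qed
  then obtain r l where r: "strict_mono r" and l: "\<And>i. i \<in> V \<Longrightarrow> (\<lambda>k. u (r k) i) \<longlonglongrightarrow> l i"
    using finite_family_convergent_subsequence[OF V(1), of u 1] by metis
  have "(\<lambda>k. sum (u (r k)) V) \<longlonglongrightarrow> sum l V"
    by (intro tendsto_sum l)
  moreover have "(\<lambda>k. \<Sum>i\<in>V. (u (r k) i)\<^sup>2) \<longlonglongrightarrow> (\<Sum>i\<in>V. (l i)\<^sup>2)"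
    by (intro tendsto_sum tendsto_power l)
  ultimately have lS: "sum l V = 0" "(\<Sum>i\<in>V. (l i)\<^sup>2) = 1"
    using u(1) by (auto simp: S_def LIMSEQ_const_iff)
  have El: "(\<lambda>k. Ev V c (u (r k))) \<longlonglongrightarrow> Ev V c l"
    unfolding Ev_def by (intro tendsto_intros l)
  have "Ev V c l \<le> m"
  proof (rule LIMSEQ_le[OF El])
    have "(\<lambda>k. 1 / real (Suc k)) \<longlonglongrightarrow> 0"
      using LIMSEQ_inverse_real_of_nat by (simp add: inverse_eq_divide)
    from LIMSEQ_subseq_LIMSEQ[OF this r]
    have "(\<lambda>k. m + 1 / real (Suc (r k))) \<longlonglongrightarrow> m + 0"
      by (intro tendsto_add tendsto_const) (simp add: o_def)
    then show "(\<lambda>k. m + 1 / real (Suc (r k))) \<longlonglongrightarrow> m"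
      by simp
    show "\<exists>N. \<forall>k\<ge>N. Ev V c (u (r k)) \<le> m + 1 / real (Suc (r k))"
      using u(2) less_imp_le by blast
  qed
  moreover have "m \<le> Ev V c l"
    unfolding m_def using lS bdd by (intro cINF_lower) (auto simp: S_def)
  ultimately have m: "Ev V c l = m"
    by simp
  have gap: "m * (\<Sum>i\<in>V. (x i)\<^sup>2) \<le> Ev V c x" if "sum x V = 0" for x
  proof (cases "(\<Sum>i\<in>V. (x i)\<^sup>2) = 0")
    case True
    then show ?thesis
      using Ev_nonneg[OF V(3)] by simp
  next
    case False
    define t where "t = sqrt (\<Sum>i\<in>V. (x i)\<^sup>2)"
    have t: "t > 0" "t\<^sup>2 = (\<Sum>i\<in>V. (x i)\<^sup>2)"
      using False by (auto simp: t_def order_less_le sum_nonneg)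
    have "(\<lambda>i. x i / t) \<in> S"
      using that t(1) by (simp add: S_def sum_divide_distrib[symmetric] power_divide t(2)[symmetric])
    then have "m \<le> Ev V c (\<lambda>i. x i / t)"
      unfolding m_def using bdd by (intro cINF_lower)
    also have "\<dots> = Ev V c x / t\<^sup>2"
      by (simp add: Ev_def sum_divide_distrib diff_divide_distrib[symmetric] power_divide)
    finally have "m * t\<^sup>2 \<le> Ev V c x"
      using t(1) by (simp add: pos_le_divide_eq)
    then show ?thesis
      unfolding t(2) .
  qed
  have "m \<noteq> 0"
  proof
    assume "m = 0"
    then have c: "l a = l b" if "a \<in> V" "b \<in> V" for a b
      using Ev_zero_const[OF V(1,3,4)] m that by simp
    have "l a = 0" if "a \<in> V" for a
    proof -
      have "sum l V = (\<Sum>i\<in>V. l a)"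
        by (intro sum.cong refl c that)
      then show ?thesis
        using lS(1) V(2) by simp
    qed
    then show False
      using lS(2) by simp
  qed
  then have mpos: "m > 0"
    using Ev_nonneg[OF V(3), of l] m by simp
  \<comment> \<open>The residual of the eigenvalue equation has sum zero and is therefore an
    admissible direction; the first variation along it is \<open>2 * B\<close>, twice its own
    squared norm.\<close>
  define y where "y a = lap V c l a - m * l a" for a
  have "(\<Sum>a\<in>V. lap V c l a * 1) = (\<Sum>a\<in>V. l a * lap V c (\<lambda>_. 1) a)"
    by (rule sum_lap_commute[OF V(3)])
  then have "(\<Sum>a\<in>V. lap V c l a) = 0"
    by (simp add: lap_def)
  then have ysum: "sum y V = 0"
    using lS(1) by (simp add: y_def sum_subtractf sum_distrib_left[symmetric])
  define B where "B = (\<Sum>a\<in>V. (y a)\<^sup>2)"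
  define D where "D = Ev V c y - m * B"
  have var: "0 \<le> 2 * t * B + t\<^sup>2 * D" for t
  proof -
    have "m * (\<Sum>i\<in>V. (l i + t * y i)\<^sup>2) \<le> Ev V c (\<lambda>i. l i + t * y i)"
      using lS(1) ysum by (intro gap) (simp add: sum.distrib sum_distrib_left[symmetric])
    moreover have "(\<Sum>i\<in>V. (l i + t * y i)\<^sup>2) = 1 + 2 * t * (\<Sum>i\<in>V. l i * y i) + t\<^sup>2 * B"
      unfolding lS(2)[symmetric] B_def
      by (simp add: power2_eq_square algebra_simps sum.distrib sum_distrib_left)
    moreover have "(\<Sum>a\<in>V. lap V c l a * y a) - m * (\<Sum>i\<in>V. l i * y i) = B"
      by (simp add: B_def y_def power2_eq_square algebra_simps sum.distrib sum_subtractf sum_distrib_left)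
    ultimately show ?thesis
      unfolding Ev_add[OF V(3)] m D_def by (simp add: algebra_simps)
  qed
  have "D \<ge> 0"
    using gap[OF ysum] by (simp add: D_def B_def)
  have "B = 0"
  proof (rule ccontr)
    assume "B \<noteq> 0"
    then have "B > 0"
      by (simp add: B_def order_less_le sum_nonneg)
    \<comment> \<open>At \<open>t = - s\<close> the quadratic in \<open>var\<close> equals
      \<open>- s\<^sup>2 * (D + 2)\<close>; the 1 in the denominator covers
      \<open>D = 0\<close>.\<close>
    define s where "s = B / (D + 1)"
    have s: "s > 0" "B = s * (D + 1)"
      using \<open>D \<ge> 0\<close> \<open>B > 0\<close> by (simp_all add: s_def)
    have "2 * (- s) * (s * (D + 1)) + (- s)\<^sup>2 * D = - (s\<^sup>2 * (D + 2))"
      by (simp add: power2_eq_square algebra_simps)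
    then have "s\<^sup>2 * (D + 2) \<le> 0"
      using var[of "- s"] s(2) by simp
    moreover have "s\<^sup>2 * (D + 2) > 0"
      using s(1) \<open>D \<ge> 0\<close> by simp
    ultimately show False
      by simp
  qed
  then have y0: "y a = 0" if "a \<in> V" for a
    using V(1) that by (simp add: B_def sum_nonneg_eq_0_iff)
  \<comment> \<open>Truncation places the eigenvector among the functions vanishing outside V; on V
    it is unchanged, and \<open>lap\<close> reads nothing else.\<close>
  define x where "x i = (if i \<in> V then l i else 0)" for i
  have lapx: "lap V c x a = lap V c l a" if "a \<in> V" for a
    unfolding lap_def using that by (simp add: x_def)
  \<comment> \<open>Since \<open>Ev\<close> counts every edge twice, the gap is half of the infimum
    m.\<close>
  show ?thesis
  proof (rule that[of "m / 2" x])
    show "lap V c x a = 2 * (m / 2) * x a" if "a \<in> V" for a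
      using lapx[OF that] y0[OF that] that by (simp add: y_def x_def)
  qed (use mpos gap lS in \<open>auto simp: gap_ge_def x_def\<close>)
qed

section \<open>Eigenspaces\<close>

definition ES :: "'a set \<Rightarrow> ('a \<Rightarrow> 'a \<Rightarrow> real) \<Rightarrow> real \<Rightarrow> (('a \<Rightarrow> 'a) \<Rightarrow> real) set" where
  "ES V c \<mu> = {f \<in> vectors_on (Sym V). \<forall>\<sigma>\<in>Sym V. Lop V c f \<sigma> = 2 * \<mu> * f \<sigma>}"

definition EL :: "'a set \<Rightarrow> ('a \<Rightarrow> 'a \<Rightarrow> real) \<Rightarrow> real \<Rightarrow> ('a \<Rightarrow> real) set" where
  "EL V c \<mu> = {x \<in> vectors_on V. \<forall>a\<in>V. lap V c x a = 2 * \<mu> * x a}"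

definition LL :: "'a set \<Rightarrow> ('a \<Rightarrow> 'a \<Rightarrow> real) \<Rightarrow> (('a \<Rightarrow> 'a) \<Rightarrow> real) \<Rightarrow> ('a \<Rightarrow> 'a) \<Rightarrow> real" where
  "LL V c f \<sigma> = (if \<sigma> \<in> Sym V then Lop V c f \<sigma> / 2 else 0)"

definition lapl :: "'a set \<Rightarrow> ('a \<Rightarrow> 'a \<Rightarrow> real) \<Rightarrow> ('a \<Rightarrow> real) \<Rightarrow> 'a \<Rightarrow> real" where
  "lapl V c x a = (if a \<in> V then lap V c x a / 2 else 0)"

lemma eigenspace_LL: "eigenspace_on (vectors_on (Sym V)) (LL V c) \<mu> = ES V c \<mu>"
  by (force simp: eigenspace_on_def ES_def LL_def fun_eq_iff scaleR_fun_apply vectors_on_def)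

lemma eigenspace_lapl: "eigenspace_on (vectors_on V) (lapl V c) \<mu> = EL V c \<mu>"
  by (force simp: eigenspace_on_def EL_def lapl_def fun_eq_iff scaleR_fun_apply vectors_on_def)

lemma sum_Lop_zero:
  assumes "finite V"
  shows "(\<Sum>\<sigma>\<in>Sym V. Lop V c f \<sigma>) = 0"
proof -
  have "(\<Sum>\<sigma>\<in>Sym V. Lop V c f \<sigma>) = (\<Sum>i\<in>V. \<Sum>j\<in>V. \<Sum>\<sigma>\<in>Sym V. c i j * (f \<sigma> - f (swp i j \<circ> \<sigma>)))"
    unfolding Lop_def by (subst sum.swap) (intro sum.cong refl sum.swap)
  also have "\<dots> = 0"
  proof (rule sum.neutral, rule ballI, rule sum.neutral, rule ballI)
    fix i j assume "i \<in> V" "j \<in> V"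
    then show "(\<Sum>\<sigma>\<in>Sym V. c i j * (f \<sigma> - f (swp i j \<circ> \<sigma>))) = 0"
      using sum_Sym_shift[of "swp i j" V f]
      by (simp add: permutes_swap_id sum_distrib_left[symmetric] sum_subtractf)
  qed
  finally show ?thesis .
qed

lemma sum_lap_zero:
  assumes "wgraph V c"
  shows "(\<Sum>a\<in>V. lap V c x a) = 0"
  using sum_lap_commute[OF assms, of x "\<lambda>_. 1"] by (simp add: lap_def)

lemma ES_sum_zero:
  assumes "finite V" "f \<in> ES V c \<mu>" "\<mu> \<noteq> 0"
  shows "(\<Sum>\<sigma>\<in>Sym V. f \<sigma>) = 0"
proof -
  have "(\<Sum>\<sigma>\<in>Sym V. 2 * \<mu> * f \<sigma>) = 0"
    using sum_Lop_zero[OF assms(1), of c f] assms(2) by (simp add: ES_def)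
  then show ?thesis
    using assms(3) by (simp add: sum_distrib_left[symmetric])
qed

lemma EL_sum_zero:
  assumes "wgraph V c" "x \<in> EL V c \<mu>" "\<mu> \<noteq> 0"
  shows "sum x V = 0"
proof -
  have "(\<Sum>a\<in>V. 2 * \<mu> * x a) = 0"
    using sum_lap_zero[OF assms(1), of x] assms(2) by (simp add: EL_def)
  then show ?thesis
    using assms(3) by (simp add: sum_distrib_left[symmetric])
qed

lemma ES_Q:
  assumes "f \<in> ES V c \<mu>"
  shows "Q V c f = 2 * \<mu> * corr V f id"
  unfolding ip_Lop[symmetric] corr_id using assms
  by (simp add: ip_def ES_def sum_distrib_left power2_eq_square ac_simps)

lemma EL_Ev:
  assumes "wgraph V c" "x \<in> EL V c \<mu>"
  shows "Ev V c x = 2 * \<mu> * (\<Sum>a\<in>V. (x a)\<^sup>2)"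
  unfolding sum_lap[OF assms(1), symmetric] using assms(2)
  by (simp add: EL_def sum_distrib_left power2_eq_square ac_simps)

lemma vectors_on_sum_sq_pos:
  assumes "finite X" "f \<in> vectors_on X" "f \<noteq> 0"
  shows "(\<Sum>x\<in>X. (f x)\<^sup>2) > 0"
  using ip_self_eq_0[OF assms(1,2)] assms(3)
  by (auto simp: ip_def power2_eq_square[symmetric] order_less_le sum_nonneg)

lemma Lop_cong:
  assumes "\<And>\<sigma>. \<sigma> \<in> Sym V \<Longrightarrow> f \<sigma> = g \<sigma>" "\<sigma> \<in> Sym V"
  shows "Lop V c f \<sigma> = Lop V c g \<sigma>"
  unfolding Lop_def
proof (intro sum.cong refl)
  fix i j assume "i \<in> V" "j \<in> V"
  then have "swp i j \<circ> \<sigma> \<in> Sym V"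
    using assms(2) by (simp add: permutes_compose permutes_swap_id)
  then show "c i j * (f \<sigma> - f (swp i j \<circ> \<sigma>)) = c i j * (g \<sigma> - g (swp i j \<circ> \<sigma>))"
    using assms by simp
qed

definition lift :: "'a set \<Rightarrow> 'a \<Rightarrow> ('a \<Rightarrow> real) \<Rightarrow> ('a \<Rightarrow> 'a) \<Rightarrow> real" where
  "lift V k x \<sigma> = (if \<sigma> \<in> Sym V then x (\<sigma> k) else 0)"

lemma lift_in_ES:
  assumes "finite V" "wgraph V c" "x \<in> EL V c \<mu>" "k \<in> V"
  shows "lift V k x \<in> ES V c \<mu>"
proof -
  have "Lop V c (lift V k x) \<sigma> = 2 * \<mu> * lift V k x \<sigma>" if \<sigma>: "\<sigma> \<in> Sym V" for \<sigma>
  proof -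
    have "Lop V c (lift V k x) \<sigma> = Lop V c (\<lambda>\<sigma>. x (\<sigma> k)) \<sigma>"
      by (rule Lop_cong[OF _ \<sigma>]) (simp add: lift_def)
    also have "\<dots> = lap V c x (\<sigma> k)"
      using assms \<sigma> by (intro Lop_additive) auto
    finally show ?thesis
      using assms \<sigma> by (simp add: EL_def lift_def permutes_in_image)
  qed
  then show ?thesis
    by (auto simp: ES_def vectors_on_def lift_def)
qed

lemma EL_bound:
  assumes V: "finite V" "wgraph V c" "gap_ge V c l" and x: "x \<in> EL V c \<mu>" "x \<noteq> 0" "\<mu> \<noteq> 0"
  shows "l \<le> \<mu>"
proof -
  have "(\<Sum>a\<in>V. (x a)\<^sup>2) > 0"
    using x by (intro vectors_on_sum_sq_pos V(1)) (auto simp: EL_def)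
  moreover have "2 * l * (\<Sum>a\<in>V. (x a)\<^sup>2) \<le> 2 * \<mu> * (\<Sum>a\<in>V. (x a)\<^sup>2)"
    using V(3)[unfolded gap_ge_def, rule_format, OF EL_sum_zero[OF V(2) x(1,3)]] EL_Ev[OF V(2) x(1)] by simp
  ultimately show ?thesis
    by simp
qed

lemma ES_bound:
  assumes V: "finite V" "wgraph V c" "gap_ge V c l" "l \<ge> 0" and f: "f \<in> ES V c \<mu>" "f \<noteq> 0" "\<mu> \<noteq> 0"
  shows "l \<le> \<mu>"
proof -
  have "corr V f id > 0"
    unfolding corr_id using f
    by (intro vectors_on_sum_sq_pos finite_permutations V(1)) (auto simp: ES_def)
  moreover have "2 * l * corr V f id \<le> 2 * \<mu> * corr V f id"
    using aldous_gap[OF V ES_sum_zero[OF V(1) f(1,3)]] ES_Q[OF f(1)] by simp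
  ultimately show ?thesis
    by simp
qed

definition ones :: "'x set \<Rightarrow> 'x \<Rightarrow> real" where
  "ones X x = (if x \<in> X then 1 else 0)"

lemma dim_ones:
  assumes "X \<noteq> {}" "ones X \<in> S" "\<And>f. f \<in> S \<Longrightarrow> \<exists>m. f = m *\<^sub>R ones X"
  shows "dim S = 1"
proof -
  have "dim S = card {()}"
  proof (rule dim_family)
    show "S \<subseteq> span ((\<lambda>_. ones X) ` {()})"
      using assms(3) by (fastforce simp: span_singleton)
    fix a :: "unit \<Rightarrow> real" and i assume "(\<Sum>i\<in>{()}. a i *\<^sub>R ones X) = 0"
    moreover obtain x where "x \<in> X"
      using assms(1) by auto
    ultimately show "a i = 0"
      by (auto simp: fun_eq_iff scaleR_fun_apply ones_def split: if_splits)
  qed (use assms in auto)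
  then show ?thesis
    by simp
qed

lemma EL_zero:
  assumes V: "finite V" "V \<noteq> {}" "wgraph V c" "gap_ge V c l" "l > 0"
  shows "dim (EL V c 0) = 1" "ones V \<in> EL V c 0"
proof -
  show 1: "ones V \<in> EL V c 0"
    by (auto simp: EL_def ones_def vectors_on_def lap_def)
  show "dim (EL V c 0) = 1"
  proof (rule dim_ones[OF V(2) 1])
    fix x assume x: "x \<in> EL V c 0"
    define m where "m = sum x V / card V"
    have "card V > 0"
      using V by (simp add: card_gt_0_iff)
    then have "(\<Sum>a\<in>V. x a - m) = 0"
      by (simp add: sum_subtractf m_def)
    then have "2 * l * (\<Sum>a\<in>V. (x a - m)\<^sup>2) \<le> Ev V c (\<lambda>a. x a - m)"
      using V(4) by (simp add: gap_ge_def)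
    also have "\<dots> = Ev V c x"
      by (simp add: Ev_def)
    also have "\<dots> = 0"
      using EL_Ev[OF V(3) x] by simp
    finally have "(\<Sum>a\<in>V. (x a - m)\<^sup>2) \<le> 0"
      using V(5) by (simp add: mult_le_0_iff)
    then have "(\<Sum>a\<in>V. (x a - m)\<^sup>2) = 0"
      by (intro antisym sum_nonneg) auto
    then have "x a = m" if "a \<in> V" for a
      using V(1) that by (simp add: sum_nonneg_eq_0_iff)
    then have "x = m *\<^sub>R ones V"
      using x by (auto simp: fun_eq_iff scaleR_fun_apply ones_def EL_def vectors_on_def)
    then show "\<exists>m. x = m *\<^sub>R ones V" ..
  qed
qed

text \<open>A function in the kernel has vanishing form. After subtraction of its mean,
  \<open>aldous_gap\<close> with positive gap makes its norm zero, so it is constant.\<close>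

lemma ES_zero:
  assumes V: "finite V" "wgraph V c" "gap_ge V c l" "l > 0"
  shows "dim (ES V c 0) = 1" "ones (Sym V) \<in> ES V c 0"
proof -
  have Lones: "Lop V c (ones (Sym V)) \<sigma> = 0" if "\<sigma> \<in> Sym V" for \<sigma>
  proof -
    have "Lop V c (ones (Sym V)) \<sigma> = Lop V c (\<lambda>_. 1) \<sigma>"
      by (rule Lop_cong[OF _ that]) (simp add: ones_def)
    then show ?thesis
      by (simp add: Lop_def)
  qed
  then show 1: "ones (Sym V) \<in> ES V c 0"
    by (auto simp: ES_def ones_def vectors_on_def)
  have ne: "Sym V \<noteq> {}"
    using permutes_id by blast
  show "dim (ES V c 0) = 1"
  proof (rule dim_ones[OF ne 1])
    fix f assume f: "f \<in> ES V c 0"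
    define m where "m = (\<Sum>\<sigma>\<in>Sym V. f \<sigma>) / card (Sym V)"
    define g where "g = (\<lambda>\<sigma>. f \<sigma> - m)"
    have fS: "finite (Sym V)"
      by (rule finite_permutations[OF V(1)])
    then have "card (Sym V) > 0"
      using ne card_gt_0_iff by blast
    then have "(\<Sum>\<sigma>\<in>Sym V. g \<sigma>) = 0"
      by (simp add: sum_subtractf m_def g_def)
    then have "2 * l * corr V g id \<le> Q V c g"
      using V by (intro aldous_gap) auto
    also have "Lop V c g \<sigma> = Lop V c f \<sigma>" for \<sigma>
      by (simp add: Lop_def g_def)
    then have "Q V c g = 0"
      unfolding ip_Lop[symmetric] ip_def using f by (simp add: ES_def)
    finally have "corr V g id \<le> 0"
      using V(4) by (simp add: mult_le_0_iff)
    then have "corr V g id = 0"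
      using corr_id_nonneg[of V g] by simp
    then have "f \<sigma> = m" if "\<sigma> \<in> Sym V" for \<sigma>
      using corr_id_eq_0[OF V(1), of g \<sigma>] that by (simp add: g_def)
    then have "f = m *\<^sub>R ones (Sym V)"
      using f by (auto simp: fun_eq_iff scaleR_fun_apply ones_def ES_def vectors_on_def)
    then show "\<exists>m. f = m *\<^sub>R ones (Sym V)" ..
  qed
qed

lemma ones_nonzero: "X \<noteq> {} \<Longrightarrow> ones X \<noteq> 0"
  by (auto simp: fun_eq_iff ones_def)

lemma second_eigenvalue_EL:
  assumes V: "finite V" "wgraph V c" "gap_ge V c l" "l > 0" and x: "x \<in> EL V c l" "x \<noteq> 0"
  shows "second_eigenvalue (vectors_on V) (lapl V c) = l"
proof (rule second_eigenvalue_eqI[OF V(1)])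
  have ne: "V \<noteq> {}"
    using x by (auto simp: EL_def vectors_on_def fun_eq_iff)
  show "ip V f (lapl V c g) = ip V (lapl V c f) g" for f g
    using sum_lap_commute[OF V(2), of f g] by (simp add: ip_def lapl_def sum_divide_distrib[symmetric])
  show "eigenvalue_mult (vectors_on V) (lapl V c) 0 = 1"
    unfolding eigenvalue_mult_def eigenspace_lapl by (rule EL_zero[OF V(1) ne V(2-4)])
  show "0 \<in> eigenvalues_on (vectors_on V) (lapl V c)"
    unfolding eigenvalues_on_def eigenspace_lapl using EL_zero(2)[OF V(1) ne V(2-4)] ones_nonzero[OF ne] by auto
  show "l \<in> eigenvalues_on (vectors_on V) (lapl V c)"
    unfolding eigenvalues_on_def eigenspace_lapl using x by auto
  show "l \<le> \<mu>" if "\<mu> \<in> eigenvalues_on (vectors_on V) (lapl V c)" "\<mu> \<noteq> 0" for \<mu>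
    using that EL_bound[OF V(1-3)] unfolding eigenvalues_on_def eigenspace_lapl by auto
qed (rule V(4))

text \<open>\<open>aldous_gap\<close> bounds the nonzero eigenvalues from below, and a lifted
  eigenvector of the Laplacian attains the bound; so both operators have the same second
  eigenvalue.\<close>

lemma second_eigenvalue_ES:
  assumes V: "finite V" "wgraph V c" "gap_ge V c l" "l > 0" and x: "x \<in> EL V c l" "x \<noteq> 0"
  shows "second_eigenvalue (vectors_on (Sym V)) (LL V c) = l"
proof (rule second_eigenvalue_eqI[OF finite_permutations[OF V(1)]])
  have ne: "Sym V \<noteq> {}"
    using permutes_id by blast
  show "ip (Sym V) f (LL V c g) = ip (Sym V) (LL V c f) g" for f g
    using ip_Lop_commute[of V f c g] by (simp add: ip_def LL_def sum_divide_distrib[symmetric])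
  show "eigenvalue_mult (vectors_on (Sym V)) (LL V c) 0 = 1"
    unfolding eigenvalue_mult_def eigenspace_LL by (rule ES_zero[OF V])
  show "0 \<in> eigenvalues_on (vectors_on (Sym V)) (LL V c)"
    unfolding eigenvalues_on_def eigenspace_LL using ES_zero(2)[OF V] ones_nonzero[OF ne] by auto
  obtain a where a: "x a \<noteq> 0" "a \<in> V"
    using x by (auto simp: EL_def vectors_on_def fun_eq_iff)
  have "lift V a x id \<noteq> 0"
    using a by (simp add: lift_def permutes_id)
  then have "lift V a x \<noteq> 0"
    by (metis zero_fun_apply)
  then show "l \<in> eigenvalues_on (vectors_on (Sym V)) (LL V c)"
    unfolding eigenvalues_on_def eigenspace_LL using lift_in_ES[OF V(1,2) x(1) a(2)] by auto
  show "l \<le> \<mu>" if "\<mu> \<in> eigenvalues_on (vectors_on (Sym V)) (LL V c)" "\<mu> \<noteq> 0" for \<mu>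
    using that ES_bound[OF V(1-3)] V(4) unfolding eigenvalues_on_def eigenspace_LL by auto
qed (rule V(4))

text \<open>The adjoint of \<open>Lop_additive\<close>: a marginal is the inner product with the
  indicator of \<open>\<sigma> k = a\<close>, and both operators are symmetric.\<close>

lemma marg_Lop:
  assumes V: "finite V" "wgraph V c" "k \<in> V" "a \<in> V"
  shows "marg V (Lop V c f) k a = lap V c (marg V f k) a"
proof -
  define d where "d b = (if b = a then 1 else 0 :: real)" for b
  have dsum: "(\<Sum>b\<in>V. d b * h b) = h a" for h :: "'a \<Rightarrow> real"
  proof -
    have "(\<Sum>b\<in>V. d b * h b) = (\<Sum>b\<in>V. if b = a then h b else 0)"
      by (intro sum.cong) (auto simp: d_def)
    then show ?thesis using V by simp
  qed
  have "marg V (Lop V c f) k a = ip (Sym V) (\<lambda>\<sigma>. d (\<sigma> k)) (Lop V c f)"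
    unfolding dsum[of "marg V (Lop V c f) k", symmetric] ip_def by (rule sum_marg[OF V(1,3)])
  also have "\<dots> = (\<Sum>\<sigma>\<in>Sym V. lap V c d (\<sigma> k) * f \<sigma>)"
    unfolding ip_Lop_commute unfolding ip_def using V by (intro sum.cong refl) (simp add: Lop_additive)
  also have "\<dots> = (\<Sum>b\<in>V. lap V c d b * marg V f k b)"
    by (rule sum_marg[OF V(1,3), symmetric])
  also have "\<dots> = lap V c (marg V f k) a"
    unfolding sum_lap_commute[OF V(2)] dsum ..
  finally show ?thesis .
qed

lemma marg_in_EL:
  assumes V: "finite V" "wgraph V c" and f: "f \<in> ES V c \<mu>" and k: "k \<in> V"
  shows "marg V f k \<in> EL V c \<mu>"
proof -
  have "lap V c (marg V f k) a = 2 * \<mu> * marg V f k a" if "a \<in> V" for a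
  proof -
    have "marg V (Lop V c f) k a = 2 * \<mu> * marg V f k a"
      unfolding marg_def sum_distrib_left using f by (intro sum.cong) (auto simp: ES_def)
    then show ?thesis
      using marg_Lop[OF V k that, of f] by simp
  qed
  moreover have "marg V f k a = 0" if "a \<notin> V" for a
    unfolding marg_def using that k by (intro sum.neutral) (auto simp: permutes_in_image)
  ultimately show ?thesis
    by (auto simp: EL_def vectors_on_def)
qed

definition additive_part :: "'a set \<Rightarrow> (('a \<Rightarrow> 'a) \<Rightarrow> real) \<Rightarrow> ('a \<Rightarrow> 'a) \<Rightarrow> real" where
  "additive_part V f \<sigma> = (if \<sigma> \<in> Sym V then proj V f \<sigma> else 0)"

lemma additive_part_in_ES:
  assumes V: "finite V" "wgraph V c" and f: "f \<in> ES V c \<mu>"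
  shows "additive_part V f \<in> ES V c \<mu>"
proof -
  have "Lop V c (additive_part V f) \<sigma> = 2 * \<mu> * additive_part V f \<sigma>" if \<sigma>: "\<sigma> \<in> Sym V" for \<sigma>
  proof -
    have "Lop V c (additive_part V f) \<sigma> = Lop V c (proj V f) \<sigma>"
      by (rule Lop_cong[OF _ \<sigma>]) (simp add: additive_part_def)
    also have "\<dots> = 2 * \<mu> * proj V f \<sigma>"
      using \<sigma> marg_in_EL[OF V f] V unfolding Lop_proj[OF V \<sigma>[simplified]] proj_def
      by (simp add: EL_def sum_distrib_left permutes_in_image)
    finally show ?thesis
      using \<sigma> by (simp add: additive_part_def)
  qed
  then show ?thesis
    by (auto simp: ES_def vectors_on_def additive_part_def)
qed

lemma lift_sum_scale:
  "lift V k (\<Sum>b\<in>B. u b *\<^sub>R b) = (\<Sum>b\<in>B. u b *\<^sub>R lift V k b)"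
  by (auto simp: fun_eq_iff lift_def sum_fun_apply scaleR_fun_apply)

text \<open>The sum over k of \<open>y (\<sigma> k)\<close> is the total of \<open>y\<close>, which
  is zero for eigenvectors. So the marginal at \<open>z\<close> can be subtracted at every position,
  which removes position \<open>z\<close> and leaves \<open>n - 1\<close> instead of n.\<close>

lemma additive_part_in_span:
  assumes V: "finite V" "wgraph V c" "z \<in> V" and f: "f \<in> ES V c l" "l \<noteq> 0"
    and B: "finite B" "EL V c l \<subseteq> span B"
  shows "additive_part V f \<in> span ((\<lambda>(k, b). lift V k b) ` ((V - {z}) \<times> B))"
proof -
  define r where "r = real (card V) * fact (card V - 2)"
  define M where "M k = marg V f k" for k
  define x where "x k = (1 / r) *\<^sub>R (M k - M z)" for k
  have M: "M k \<in> EL V c l" if "k \<in> V" for k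
    unfolding M_def by (rule marg_in_EL[OF V(1,2) f(1) that])
  have xB: "x k \<in> span B" if "k \<in> V" for k
    unfolding x_def using M[OF that] M[OF V(3)] B by (intro span_scale span_diff) auto
  have "additive_part V f = (\<Sum>k\<in>V - {z}. lift V k (x k))"
  proof
    fix \<sigma>
    show "additive_part V f \<sigma> = (\<Sum>k\<in>V - {z}. lift V k (x k)) \<sigma>"
    proof (cases "\<sigma> \<in> Sym V")
      case True
      have z: "(\<Sum>k\<in>V. M z (\<sigma> k)) = 0"
      proof -
        have "(\<Sum>k\<in>V. M z (\<sigma> k)) = sum (M z) V"
          using True by (intro sum.reindex_bij_betw) (auto simp: permutes_imp_bij)
        then show ?thesis
          using EL_sum_zero[OF V(2) M[OF V(3)] f(2)] by simp
      qed
      have "(\<Sum>k\<in>V - {z}. lift V k (x k)) \<sigma> = (\<Sum>k\<in>V - {z}. (M k (\<sigma> k) - M z (\<sigma> k)) / r)"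
        using True by (simp add: sum_fun_apply lift_def x_def scaleR_fun_apply)
      also have "\<dots> = (\<Sum>k\<in>V. (M k (\<sigma> k) - M z (\<sigma> k)) / r)"
        using V by (simp add: sum.remove[of V z])
      also have "\<dots> = (\<Sum>k\<in>V. M k (\<sigma> k) / r)"
        using z by (simp add: diff_divide_distrib sum_subtractf sum_divide_distrib[symmetric])
      finally show ?thesis
        using True by (simp add: additive_part_def proj_def M_def r_def)
    qed (simp add: additive_part_def sum_fun_apply lift_def)
  qed
  also have "\<dots> \<in> span ((\<lambda>(k, b). lift V k b) ` ((V - {z}) \<times> B))"
  proof (rule span_sum)
    fix k assume k: "k \<in> V - {z}"
    then obtain u where "x k = (\<Sum>b\<in>B. u b *\<^sub>R b)"
      using xB[of k] span_finite[OF B(1)] by auto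
    then have "lift V k (x k) = (\<Sum>b\<in>B. u b *\<^sub>R lift V k b)"
      by (simp only: lift_sum_scale)
    also have "\<dots> \<in> span ((\<lambda>(k, b). lift V k b) ` ((V - {z}) \<times> B))"
      using k by (intro span_sum span_scale span_base) force
    finally show "lift V k (x k) \<in> span ((\<lambda>(k, b). lift V k b) ` ((V - {z}) \<times> B))" .
  qed
  finally show ?thesis .
qed

lemma permutes_two_points:
  assumes "u \<in> V" "v \<in> V" "k \<in> V" "z \<in> V" "u \<noteq> v" "k \<noteq> z"
  obtains \<rho> where "\<rho> permutes V" "\<rho> k = u" "\<rho> z = v"
proof
  define w where "w = swp k u z"
  have w: "w \<in> V" "w \<noteq> u"
    using assms by (auto simp: w_def swp_app)
  show "swp w v \<circ> swp k u permutes V"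
    using assms w by (intro permutes_compose permutes_swap_id)
  show "(swp w v \<circ> swp k u) k = u" "(swp w v \<circ> swp k u) z = v"
    using assms w by (auto simp: w_def)
qed

text \<open>Position \<open>z\<close> does not occur in the sum, so composing with
  \<open>swp k z\<close> changes only the value read by \<open>y k\<close>. Hence \<open>y k\<close>
  is constant, and its sum is zero.\<close>

lemma additive_unique:
  assumes V: "finite V" "z \<in> V"
    and y: "\<And>k. k \<in> V - {z} \<Longrightarrow> y k \<in> vectors_on V" "\<And>k. k \<in> V - {z} \<Longrightarrow> sum (y k) V = 0"
    and zero: "\<And>\<sigma>. \<sigma> permutes V \<Longrightarrow> (\<Sum>k\<in>V - {z}. y k (\<sigma> k)) = (0 :: real)"
    and k: "k \<in> V - {z}"
  shows "y k = 0"
proof -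
  have const: "y k u = y k v" if uv: "u \<in> V" "v \<in> V" for u v
  proof (cases "u = v")
    case False
    obtain \<rho> where \<rho>: "\<rho> permutes V" "\<rho> k = u" "\<rho> z = v"
      using permutes_two_points[OF uv _ V(2) False] k by blast
    have \<rho>': "\<rho> \<circ> swp k z permutes V"
      using \<rho> k V by (intro permutes_compose permutes_swap_id) auto
    have "(\<Sum>i\<in>V - {z}. y i (\<rho> i)) = y k u + (\<Sum>i\<in>V - {z} - {k}. y i (\<rho> i))"
      using V k \<rho> by (simp add: sum.remove[of "V - {z}" k])
    moreover have "(\<Sum>i\<in>V - {z}. y i ((\<rho> \<circ> swp k z) i)) = y k v + (\<Sum>i\<in>V - {z} - {k}. y i (\<rho> i))"
      using V k \<rho> by (simp add: sum.remove[of "V - {z}" k])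
    ultimately show ?thesis
      using zero[OF \<rho>(1)] zero[OF \<rho>'] by simp
  qed simp
  have "y k u = 0" if "u \<in> V" for u
  proof -
    have "sum (y k) V = (\<Sum>i\<in>V. y k u)"
      by (intro sum.cong refl const that)
    then show ?thesis
      using y(2)[OF k] that V(1) by auto
  qed
  then show ?thesis
    using y(1)[OF k] by (auto simp: fun_eq_iff vectors_on_def)
qed

lemma alt_minus:
  assumes "square_alt V f" "triple_alt V f"
  shows "square_alt V (\<lambda>\<sigma>. - f \<sigma>)" "triple_alt V (\<lambda>\<sigma>. - f \<sigma>)"
proof -
  show "square_alt V (\<lambda>\<sigma>. - f \<sigma>)"
    unfolding square_alt_def
  proof (intro ballI impI)
    fix a b c d \<sigma> assume *: "a \<in> V" "b \<in> V" "c \<in> V" "d \<in> V" "\<sigma> \<in> Sym V" "distinct [a, b, c, d]"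
    show "- f \<sigma> + - f (swp a b \<circ> (swp c d \<circ> \<sigma>)) = - f (swp a b \<circ> \<sigma>) + - f (swp c d \<circ> \<sigma>)"
      using assms(1)[unfolded square_alt_def, rule_format, OF *] by linarith
  qed
  show "triple_alt V (\<lambda>\<sigma>. - f \<sigma>)"
    unfolding triple_alt_def
  proof (intro ballI impI)
    fix a b c \<sigma> assume *: "a \<in> V" "b \<in> V" "c \<in> V" "\<sigma> \<in> Sym V" "distinct [a, b, c]"
    show "- f \<sigma> + - f (cyc a b c \<circ> \<sigma>) + - f (cyc a c b \<circ> \<sigma>) =
      - f (swp a b \<circ> \<sigma>) + - f (swp b c \<circ> \<sigma>) + - f (swp a c \<circ> \<sigma>)"
      using assms(2)[unfolded triple_alt_def, rule_format, OF *] by linarith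
  qed
qed

text \<open>The basis consists of the lifts of a basis of \<open>EL V c l\<close> to the positions
  other than z. Spanning is the equality case: \<open>f - proj V f\<close> satisfies both
  alternating relations and has vanishing marginals, so it is zero. Independence is
  \<open>additive_unique\<close>.\<close>

theorem dim_ES:
  assumes V: "finite V" "card V \<ge> 2" "wgraph V c" "conn V c" "gap_ge V c l" "l > 0"
    and nu: "\<not> uniform_C4 V c"
  shows "dim (ES V c l) = (card V - 1) * dim (EL V c l)"
proof -
  obtain z where z: "z \<in> V"
    using V(2) by fastforce
  obtain B where B: "B \<subseteq> EL V c l" "independent B" "EL V c l \<subseteq> span B" "card B = dim (EL V c l)"
    by (metis basis_exists)
  have fB: "finite B"
    using B by (intro independent_vectors_on_finite[OF V(1) B(2)]) (auto simp: EL_def)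
  define I where "I = (V - {z}) \<times> B"
  define g where "g = (\<lambda>(k, b). lift V k b)"
  have "dim (ES V c l) = card I"
  proof (rule dim_family)
    show "finite I"
      using V fB by (simp add: I_def)
    show "g ` I \<subseteq> ES V c l"
      using lift_in_ES[OF V(1,3)] B(1) by (auto simp: g_def I_def)
    show "ES V c l \<subseteq> span (g ` I)"
    proof
      fix f assume f: "f \<in> ES V c l"
      have s: "(\<Sum>\<sigma>\<in>Sym V. f \<sigma>) = 0"
        using ES_sum_zero[OF V(1) f] V(6) by simp
      have alt: "square_alt V f \<and> triple_alt V f"
        using V nu s ES_Q[OF f] by (intro equality_alt[of V c l]) auto
      have zm: "zero_marg V (\<lambda>\<sigma>. f \<sigma> - proj V f \<sigma>)"
        by (rule zero_marg_diff_proj[OF V(1,2) s])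
      have alt': "square_alt V (\<lambda>\<sigma>. f \<sigma> - proj V f \<sigma>)" "triple_alt V (\<lambda>\<sigma>. f \<sigma> - proj V f \<sigma>)"
        using square_alt_add[OF conjunct1[OF alt] alt_minus(1)[OF alt_proj, of V f]]
          triple_alt_add[OF conjunct2[OF alt] alt_minus(2)[OF alt_proj, of V f]] by simp_all
      have "f \<sigma> - proj V f \<sigma> = 0" if "\<sigma> permutes V" for \<sigma>
        by (rule alt_zero_marg_zero[OF V(1) _ zm alt' that]) (use z in auto)
      then have "f = additive_part V f"
        using f by (auto simp: fun_eq_iff additive_part_def ES_def vectors_on_def)
      then show "f \<in> span (g ` I)"
        using additive_part_in_span[OF V(1,3) z f _ fB B(3)] V(6) unfolding g_def I_def by simp
    qed
    fix a i assume a: "(\<Sum>i\<in>I. a i *\<^sub>R g i) = 0" and i: "i \<in> I"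
    define y where "y k = (\<Sum>b\<in>B. a (k, b) *\<^sub>R b)" for k
    have yS: "y k \<in> vectors_on V" for k
      unfolding y_def using B(1)
      by (intro subspace_sum[OF subspace_vectors_on] subspace_scale[OF subspace_vectors_on]) (auto simp: EL_def)
    have sB: "sum b V = 0" if "b \<in> B" for b
      using EL_sum_zero[OF V(3), of b l] that B(1) V(6) by auto
    have y0: "sum (y k) V = 0" for k
      unfolding y_def sum_fun_apply scaleR_fun_apply
      by (subst sum.swap) (simp add: sB sum_distrib_left[symmetric])
    have "(\<Sum>k\<in>V - {z}. y k (\<sigma> k)) = 0" if "\<sigma> permutes V" for \<sigma>
    proof -
      have "0 = (\<Sum>i\<in>I. a i *\<^sub>R g i) \<sigma>"
        using a by simp
      also have "\<dots> = (\<Sum>k\<in>V - {z}. \<Sum>b\<in>B. a (k, b) * b (\<sigma> k))"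
        unfolding I_def sum_fun_apply scaleR_fun_apply using that
        by (simp add: sum.cartesian_product g_def lift_def case_prod_unfold)
      finally show ?thesis
        by (simp add: y_def sum_fun_apply scaleR_fun_apply)
    qed
    then have "y k = 0" if "k \<in> V - {z}" for k
      using additive_unique[OF V(1) z, of y] yS y0 that by blast
    then show "a i = 0"
      using B(2) fB i unfolding I_def y_def dependent_finite[OF fB] by fastforce
  qed
  then show ?thesis
    using V(1) z fB B(4) by (simp add: I_def card_cartesian_product)
qed

section \<open>The uniform 4-cycle\<close>

lemma uniform_C4_card: "uniform_C4 W d \<Longrightarrow> card W = 4"
  by (auto simp: uniform_C4_def)

locale uniform_cycle =
  fixes V :: "'a set" and c :: "'a \<Rightarrow> 'a \<Rightarrow> real" and p q r s :: 'a and w :: real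
  assumes V: "V = {p, q, r, s}" and dist: "distinct [p, q, r, s]" and wg: "wgraph V c"
    and w: "w > 0" "c p q = w" "c q r = w" "c r s = w" "c s p = w" "c p r = 0" "c q s = 0"
begin

lemma finV: "finite V" and cardV: "card V = 4"
  using V dist by auto

lemma ne: "p \<noteq> q" "p \<noteq> r" "p \<noteq> s" "q \<noteq> r" "q \<noteq> s" "r \<noteq> s" "q \<noteq> p" "r \<noteq> p" "s \<noteq> p" "r \<noteq> q" "s \<noteq> q" "s \<noteq> r"
  using dist by auto

lemma sumV: "(\<Sum>i\<in>V. h i) = h p + h q + h r + h s" for h :: "'a \<Rightarrow> real"
  using V dist by (simp add: add.assoc)

lemma inV: "p \<in> V" "q \<in> V" "r \<in> V" "s \<in> V"
  using V by auto

lemma sym: "c q p = w" "c r q = w" "c s r = w" "c p s = w" "c r p = 0" "c s q = 0"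
  using wgraph_sym[OF wg, of q p] wgraph_sym[OF wg, of r q] wgraph_sym[OF wg, of s r]
    wgraph_sym[OF wg, of p s] wgraph_sym[OF wg, of r p] wgraph_sym[OF wg, of s q] w V by auto

lemma gap: "gap_ge V c (2 * w)"
  by (rule gap_ge_uniform_C4[OF V dist wg w(2-7)])

text \<open>The gap eigenfunctions with vanishing marginals turn out to be the functions of this kind.\<close>

definition exceptional :: "(('a \<Rightarrow> 'a) \<Rightarrow> real) \<Rightarrow> bool" where
  "exceptional e \<longleftrightarrow> (\<forall>\<sigma>\<in>Sym V. e (dbl p q r s \<circ> \<sigma>) = e \<sigma> \<and> e (dbl p r q s \<circ> \<sigma>) = e \<sigma> \<and>
     e (dbl p s q r \<circ> \<sigma>) = e \<sigma> \<and> e (swp p r \<circ> \<sigma>) = - e \<sigma> \<and>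
     e \<sigma> + e (cyc p q r \<circ> \<sigma>) + e (cyc p r q \<circ> \<sigma>) = 0)"

lemma exceptionalD:
  assumes "exceptional e" "\<sigma> permutes V"
  shows "e (dbl p q r s \<circ> \<sigma>) = e \<sigma>" "e (dbl p r q s \<circ> \<sigma>) = e \<sigma>" "e (dbl p s q r \<circ> \<sigma>) = e \<sigma>"
    "e (swp p r \<circ> \<sigma>) = - e \<sigma>" "e \<sigma> + e (cyc p q r \<circ> \<sigma>) + e (cyc p r q \<circ> \<sigma>) = 0"
  using assms by (auto simp: exceptional_def)

lemma exceptional_diff:
  assumes "exceptional e" "exceptional f"
  shows "exceptional (\<lambda>\<sigma>. e \<sigma> - t * f \<sigma>)"
  unfolding exceptional_def
proof (intro ballI conjI)
  fix \<sigma> assume "\<sigma> \<in> Sym V"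
  then have \<sigma>: "\<sigma> permutes V"
    by simp
  note E = exceptionalD[OF assms(1) \<sigma>] and F = exceptionalD[OF assms(2) \<sigma>]
  show "e (dbl p q r s \<circ> \<sigma>) - t * f (dbl p q r s \<circ> \<sigma>) = e \<sigma> - t * f \<sigma>"
    "e (dbl p r q s \<circ> \<sigma>) - t * f (dbl p r q s \<circ> \<sigma>) = e \<sigma> - t * f \<sigma>"
    "e (dbl p s q r \<circ> \<sigma>) - t * f (dbl p s q r \<circ> \<sigma>) = e \<sigma> - t * f \<sigma>"
    "e (swp p r \<circ> \<sigma>) - t * f (swp p r \<circ> \<sigma>) = - (e \<sigma> - t * f \<sigma>)"
    unfolding E(1-4) F(1-4) by simp_all
  have "e \<sigma> - t * f \<sigma> + (e (cyc p q r \<circ> \<sigma>) - t * f (cyc p q r \<circ> \<sigma>)) + (e (cyc p r q \<circ> \<sigma>) - t * f (cyc p r q \<circ> \<sigma>)) =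
      (e \<sigma> + e (cyc p q r \<circ> \<sigma>) + e (cyc p r q \<circ> \<sigma>)) - t * (f \<sigma> + f (cyc p q r \<circ> \<sigma>) + f (cyc p r q \<circ> \<sigma>))"
    by (simp add: algebra_simps)
  then show "e \<sigma> - t * f \<sigma> + (e (cyc p q r \<circ> \<sigma>) - t * f (cyc p q r \<circ> \<sigma>)) + (e (cyc p r q \<circ> \<sigma>) - t * f (cyc p r q \<circ> \<sigma>)) = 0"
    unfolding E(5) F(5) by simp
qed

lemma klein_swp:
  assumes \<sigma>: "\<sigma> permutes V"
    and inv: "\<And>\<sigma>. \<sigma> permutes V \<Longrightarrow> e (dbl p q r s \<circ> \<sigma>) = e \<sigma>"
      "\<And>\<sigma>. \<sigma> permutes V \<Longrightarrow> e (dbl p s q r \<circ> \<sigma>) = e \<sigma>"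
  shows "e (swp r s \<circ> \<sigma>) = e (swp p q \<circ> \<sigma>)" "e (swp s p \<circ> \<sigma>) = e (swp q r \<circ> \<sigma>)"
proof -
  have 1: "dbl p q r s \<circ> (swp r s \<circ> \<sigma>) = swp p q \<circ> \<sigma>" "dbl p s q r \<circ> (swp q r \<circ> \<sigma>) = swp s p \<circ> \<sigma>"
    by (simp_all add: dbl_def fun_eq_iff transpose_commute[of s p])
  have "swp r s \<circ> \<sigma> permutes V" "swp q r \<circ> \<sigma> permutes V"
    by (rule permutes_compose[OF \<sigma> permutes_swap_id]; simp add: inV)+
  from inv(1)[OF this(1)] inv(2)[OF this(2)]
  show "e (swp r s \<circ> \<sigma>) = e (swp p q \<circ> \<sigma>)" "e (swp s p \<circ> \<sigma>) = e (swp q r \<circ> \<sigma>)"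
    unfolding 1 by simp_all
qed

lemma Lop_cycle:
  "Lop V c e \<sigma> = 2 * w * (4 * e \<sigma> - e (swp p q \<circ> \<sigma>) - e (swp q r \<circ> \<sigma>) - e (swp r s \<circ> \<sigma>) - e (swp s p \<circ> \<sigma>))"
  unfolding Lop_def sumV
  by (simp add: sym w transpose_commute[of q p] transpose_commute[of r q] transpose_commute[of s r]
      transpose_commute[of p s] algebra_simps)

text \<open>\<open>equality_alt\<close> excludes the cycle itself but applies to its reductions to
  three points, so \<open>triple_alt\<close> is still available and gives the Klein
  invariance.\<close>

lemma exceptional_if_ES:
  assumes f: "f \<in> ES V c (2 * w)" and zm: "zero_marg V f"
    and conn: "conn V c"
  shows "exceptional f"
proof -
  have "triple_alt V f"
  proof (rule triple_alt_slices[OF finV])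
    fix v k assume vk: "v \<in> V" "k \<in> V"
    have "square_alt (V - {v}) (coset v k f) \<and> triple_alt (V - {v}) (coset v k f)"
    proof (rule equality_alt[OF _ wgraph_red conn_red gap_ge_red, where \<mu>="2 * w"])
      show "Q (V - {v}) (red V c v) (coset v k f) \<le> 2 * (2 * w) * corr (V - {v}) (coset v k f) id"
        by (rule slice_equality[OF finV wg vk gap _ zm]) (use ES_Q[OF f] w in auto)
      show "(\<Sum>\<sigma>\<in>Sym (V - {v}). coset v k f \<sigma>) = 0"
        by (rule coset_sum_zero[OF finV vk zm])
      have "card (V - {v}) = 3"
        using vk finV cardV by simp
      then show "\<not> uniform_C4 (V - {v}) (red V c v)"
        using uniform_C4_card by fastforce
    qed (use finV wg vk conn gap w in auto)
    then show "triple_alt (V - {v}) (coset v k f)" ..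
  qed (simp add: cardV)
  note st = four_point_structure[OF _ _ zm this]
  have V': "V = {p, r, q, s}" "V = {p, s, q, r}"
    using V by auto
  have dist': "distinct [p, r, q, s]" "distinct [p, s, q, r]"
    using dist by auto
  have inv: "f (dbl p q r s \<circ> \<sigma>) = f \<sigma>" "f (dbl p r q s \<circ> \<sigma>) = f \<sigma>" "f (dbl p s q r \<circ> \<sigma>) = f \<sigma>"
    if "\<sigma> permutes V" for \<sigma>
    by (rule st(3)[OF V dist that] st(3)[OF V'(1) dist'(1) that] st(3)[OF V'(2) dist'(2) that])+
  show ?thesis
    unfolding exceptional_def
  proof (intro ballI conjI)
    fix \<sigma> assume "\<sigma> \<in> Sym V"
    then have \<sigma>: "\<sigma> permutes V"
      by simp
    show "f (dbl p q r s \<circ> \<sigma>) = f \<sigma>" "f (dbl p r q s \<circ> \<sigma>) = f \<sigma>" "f (dbl p s q r \<circ> \<sigma>) = f \<sigma>"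
      by (rule inv[OF \<sigma>])+
    show "f \<sigma> + f (cyc p q r \<circ> \<sigma>) + f (cyc p r q \<circ> \<sigma>) = 0"
      by (rule st(1)[OF V dist \<sigma>])
    have "2 * w * (4 * f \<sigma> - f (swp p q \<circ> \<sigma>) - f (swp q r \<circ> \<sigma>) - f (swp r s \<circ> \<sigma>) - f (swp s p \<circ> \<sigma>)) =
        2 * w * (2 * f \<sigma>)"
      using f \<sigma> unfolding Lop_cycle[symmetric] by (simp add: ES_def)
    then have "4 * f \<sigma> - f (swp p q \<circ> \<sigma>) - f (swp q r \<circ> \<sigma>) - f (swp r s \<circ> \<sigma>) - f (swp s p \<circ> \<sigma>) = 2 * f \<sigma>"
      using w(1) by simp
    \<comment> \<open>Opposite edges give equal values by \<open>klein_swp\<close>, so the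
      eigenvalue equation says that \<open>f \<sigma>\<close> is the sum of the values at
      \<open>swp p q\<close> and \<open>swp q r\<close>; the relation between the three
      transpositions gives the third.\<close>
    then show "f (swp p r \<circ> \<sigma>) = - f \<sigma>"
      using klein_swp[of \<sigma> f, OF \<sigma> inv(1) inv(3)] st(2)[OF V dist \<sigma>] by simp
  qed
qed

lemma ES_if_exceptional:
  assumes e: "exceptional e" "e \<in> vectors_on (Sym V)"
  shows "e \<in> ES V c (2 * w)"
proof -
  have "Lop V c e \<sigma> = 2 * (2 * w) * e \<sigma>" if "\<sigma> \<in> Sym V" for \<sigma>
  proof -
    have \<sigma>: "\<sigma> permutes V"
      using that by simp
    have pr: "swp p r \<circ> \<sigma> permutes V"
      by (rule permutes_compose[OF \<sigma> permutes_swap_id]; simp add: inV)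
    have "cyc p q r \<circ> (swp p r \<circ> \<sigma>) = swp q r \<circ> \<sigma>" "cyc p r q \<circ> (swp p r \<circ> \<sigma>) = swp p q \<circ> \<sigma>"
      using ne by (auto simp: cyc_def fun_eq_iff swp_app)
    then have "e (swp p r \<circ> \<sigma>) + e (swp q r \<circ> \<sigma>) + e (swp p q \<circ> \<sigma>) = 0"
      using exceptionalD(5)[OF e(1) pr] by simp
    then show ?thesis
      using klein_swp[of \<sigma> e, OF \<sigma> exceptionalD(1)[OF e(1)] exceptionalD(3)[OF e(1)]] exceptionalD(4)[OF e(1) \<sigma>]
      unfolding Lop_cycle by simp
  qed
  then show ?thesis
    using e(2) by (simp add: ES_def)
qed

text \<open>Additive functions satisfy \<open>square_alt\<close>, so this separates them from the
  exceptional ones. For the diagonals \<open>p r\<close> and \<open>q s\<close> the product is in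
  the Klein four-group, and the relation reads \<open>2 * e = - 2 * e\<close>.\<close>

lemma exceptional_square_alt_zero:
  assumes e: "exceptional e" "square_alt V e" and \<sigma>: "\<sigma> permutes V"
  shows "e \<sigma> = 0"
proof -
  have 1: "swp p r \<circ> (swp q s \<circ> \<sigma>) = dbl p r q s \<circ> \<sigma>" "dbl p r q s \<circ> (swp q s \<circ> \<sigma>) = swp p r \<circ> \<sigma>"
    by (simp_all add: dbl_def fun_eq_iff)
  have "swp q s \<circ> \<sigma> permutes V"
    by (rule permutes_compose[OF \<sigma> permutes_swap_id]; simp add: inV)
  then have "e (swp q s \<circ> \<sigma>) = e (swp p r \<circ> \<sigma>)"
    using exceptionalD(2)[OF e(1), of "swp q s \<circ> \<sigma>"] unfolding 1 by simp
  moreover have "e \<sigma> + e (swp p r \<circ> (swp q s \<circ> \<sigma>)) = e (swp p r \<circ> \<sigma>) + e (swp q s \<circ> \<sigma>)"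
    using e(2) \<sigma> inV ne unfolding square_alt_def by simp
  ultimately show ?thesis
    using exceptionalD(2,4)[OF e(1) \<sigma>] unfolding 1 by simp
qed

text \<open>Exceptional functions thus form a space of dimension at most two: the Klein four-group
  moves any permutation into the stabilizer of \<open>s\<close>, and there the remaining relations
  determine everything from the values at \<open>id\<close> and \<open>cyc p q r\<close>.\<close>

lemma exceptional_zero:
  assumes e: "exceptional e" "e id = 0" "e (cyc p q r) = 0" and \<sigma>: "\<sigma> permutes V"
  shows "e \<sigma> = 0"
proof -
  have W: "V - {s} = {p, q, r}" "distinct [p, q, r]"
    using V dist by auto
  have idV: "id permutes V"
    by (rule permutes_id)
  have cycV: "cyc p q r permutes V" "cyc p r q permutes V"
    by (rule cyc_permutes; simp add: inV)+
  have c2: "e (cyc p r q) = 0"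
    using exceptionalD(5)[OF e(1) idV] e by simp
  have s: "swp p r \<circ> cyc p q r = swp p q" "swp p r \<circ> cyc p r q = swp q r"
    using ne by (auto simp: cyc_def fun_eq_iff swp_app)
  have "e (swp p r) = 0" "e (swp p q) = 0" "e (swp q r) = 0"
    using exceptionalD(4)[OF e(1) idV] exceptionalD(4)[OF e(1) cycV(1)] exceptionalD(4)[OF e(1) cycV(2)]
      e c2 unfolding s by simp_all
  then have "(\<Sum>\<pi>\<in>Sym {p, q, r}. (e \<pi>)\<^sup>2) = 0"
    unfolding sum_Sym3[OF W(2)] using e c2 by simp
  moreover have "finite (Sym {p, q, r})"
    by (intro finite_permutations) simp
  ultimately have triple: "e \<pi> = 0" if "\<pi> permutes {p, q, r}" for \<pi>
    using that by (simp add: sum_nonneg_eq_0_iff)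
  have z: "e \<pi> = 0" if "\<pi> permutes V" "\<pi> s = s" for \<pi>
  proof -
    have "\<pi> permutes V - {s}"
      by (rule permutes_superset[OF that(1)]) (use that V in auto)
    then show ?thesis
      using triple unfolding W by blast
  qed
  have "\<sigma> s \<in> V"
    using \<sigma> inV by (simp add: permutes_in_image)
  then consider "\<sigma> s = s" | "\<sigma> s = p" | "\<sigma> s = q" | "\<sigma> s = r"
    unfolding V by auto
  then show ?thesis
  proof cases
    case 1
    then show ?thesis
      using z[OF \<sigma>] by simp
  next
    case 2
    have "dbl p s q r \<circ> \<sigma> permutes V"
      by (rule permutes_compose[OF \<sigma> dbl_permutes]; simp add: inV)
    moreover have "(dbl p s q r \<circ> \<sigma>) s = s"
      using 2 ne by (simp add: dbl_def swp_app)
    ultimately show ?thesis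
      using z exceptionalD(3)[OF e(1) \<sigma>] by metis
  next
    case 3
    have "dbl p r q s \<circ> \<sigma> permutes V"
      by (rule permutes_compose[OF \<sigma> dbl_permutes]; simp add: inV)
    moreover have "(dbl p r q s \<circ> \<sigma>) s = s"
      using 3 ne by (simp add: dbl_def swp_app)
    ultimately show ?thesis
      using z exceptionalD(2)[OF e(1) \<sigma>] by metis
  next
    case 4
    have "dbl p q r s \<circ> \<sigma> permutes V"
      by (rule permutes_compose[OF \<sigma> dbl_permutes]; simp add: inV)
    moreover have "(dbl p q r s \<circ> \<sigma>) s = s"
      using 4 ne by (simp add: dbl_def swp_app)
    ultimately show ?thesis
      using z exceptionalD(1)[OF e(1) \<sigma>] by metis
  qed
qed

text \<open>The symmetric group on four points permutes the three perfect matchings, with the Klein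
  four-group as kernel. The values 1, -1, 0 are attached to the matchings of the cycle's opposite
  sides and to its diagonals, and \<open>H k\<close> evaluates them at the matching that contains
  the image of the pair \<open>k\<close>, \<open>s\<close>.\<close>

definition edge_sign :: "'a \<Rightarrow> 'a \<Rightarrow> real" where
  "edge_sign u v = (if {u, v} = {p, q} \<or> {u, v} = {r, s} then 1
     else if {u, v} = {q, r} \<or> {u, v} = {s, p} then -1 else 0)"

definition H :: "'a \<Rightarrow> ('a \<Rightarrow> 'a) \<Rightarrow> real" where
  "H k \<sigma> = (if \<sigma> \<in> Sym V then edge_sign (\<sigma> k) (\<sigma> s) else 0)"

lemma edge_sign_table:
  "edge_sign p q = 1" "edge_sign q p = 1" "edge_sign r s = 1" "edge_sign s r = 1"
  "edge_sign q r = -1" "edge_sign r q = -1" "edge_sign s p = -1" "edge_sign p s = -1"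
  "edge_sign p r = 0" "edge_sign r p = 0" "edge_sign q s = 0" "edge_sign s q = 0"
  using ne by (simp_all add: edge_sign_def doubleton_eq_iff)

lemma exceptional_H:
  assumes "k \<in> V - {s}"
  shows "exceptional (H k)"
  unfolding exceptional_def
proof (intro ballI)
  fix \<sigma> assume "\<sigma> \<in> Sym V"
  then have \<sigma>: "\<sigma> permutes V"
    by simp
  have perm: "dbl p q r s \<circ> \<sigma> permutes V" "dbl p r q s \<circ> \<sigma> permutes V" "dbl p s q r \<circ> \<sigma> permutes V"
    "swp p r \<circ> \<sigma> permutes V" "cyc p q r \<circ> \<sigma> permutes V" "cyc p r q \<circ> \<sigma> permutes V"
    by (rule permutes_compose[OF \<sigma>], rule dbl_permutes permutes_swap_id cyc_permutes; simp add: inV)+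
  define u where "u = \<sigma> k"
  define v where "v = \<sigma> s"
  have uv: "u \<in> V" "v \<in> V" "u \<noteq> v"
    using \<sigma> assms inV permutes_inj[OF \<sigma>] by (auto simp: u_def v_def permutes_in_image inj_eq)
  have "edge_sign (dbl p q r s u) (dbl p q r s v) = edge_sign u v \<and>
      edge_sign (dbl p r q s u) (dbl p r q s v) = edge_sign u v \<and>
      edge_sign (dbl p s q r u) (dbl p s q r v) = edge_sign u v \<and>
      edge_sign (swp p r u) (swp p r v) = - edge_sign u v \<and>
      edge_sign u v + edge_sign (cyc p q r u) (cyc p q r v) + edge_sign (cyc p r q u) (cyc p r q v) = 0"
    using uv ne unfolding V by (auto simp: dbl_def cyc_def swp_app edge_sign_table)
  then show "H k (dbl p q r s \<circ> \<sigma>) = H k \<sigma> \<and> H k (dbl p r q s \<circ> \<sigma>) = H k \<sigma> \<and>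
     H k (dbl p s q r \<circ> \<sigma>) = H k \<sigma> \<and> H k (swp p r \<circ> \<sigma>) = - H k \<sigma> \<and>
     H k \<sigma> + H k (cyc p q r \<circ> \<sigma>) + H k (cyc p r q \<circ> \<sigma>) = 0"
    using \<sigma> perm by (simp add: H_def u_def v_def)
qed

lemma H_values: "H p id = -1" "H q id = 0" "H p (cyc p q r) = 0" "H q (cyc p q r) = 1"
proof -
  have "cyc p q r permutes V" "cyc p q r p = q" "cyc p q r q = r" "cyc p q r s = s"
    using ne inV by (auto simp: cyc_def swp_app intro!: permutes_compose permutes_swap_id)
  then show "H p id = -1" "H q id = 0" "H p (cyc p q r) = 0" "H q (cyc p q r) = 1"
    by (simp_all add: H_def edge_sign_table permutes_id)
qed

definition b1 :: "'a \<Rightarrow> real" where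
  "b1 x = (if x = p then 1 else if x = r then -1 else 0)"

definition b2 :: "'a \<Rightarrow> real" where
  "b2 x = (if x = q then 1 else if x = s then -1 else 0)"

lemma b_values: "b1 p = 1" "b1 q = 0" "b1 r = -1" "b1 s = 0" "b2 p = 0" "b2 q = 1" "b2 r = 0" "b2 s = -1"
  using ne by (simp_all add: b1_def b2_def)

lemma b_in_EL: "b1 \<in> EL V c (2 * w)" "b2 \<in> EL V c (2 * w)"
proof -
  have "lap V c b1 a = 2 * (2 * w) * b1 a \<and> lap V c b2 a = 2 * (2 * w) * b2 a" if "a \<in> V" for a
    using that unfolding V lap_def sumV[unfolded V] by (auto simp: b_values sym w)
  moreover have "b1 \<in> vectors_on V" "b2 \<in> vectors_on V"
    using V by (auto simp: vectors_on_def b1_def b2_def)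
  ultimately show "b1 \<in> EL V c (2 * w)" "b2 \<in> EL V c (2 * w)"
    by (simp_all add: EL_def)
qed

lemma EL_span: "EL V c (2 * w) \<subseteq> span {b1, b2}"
proof
  fix x assume x: "x \<in> EL V c (2 * w)"
  have "2 * w * (2 * x a) = lap V c x a" if "a \<in> V" for a
    using x that by (simp add: EL_def)
  from this[OF inV(1)] this[OF inV(2)]
  have "w * (x q + x s) = 0" "w * (x p + x r) = 0"
    unfolding lap_def sumV by (simp_all add: sym w algebra_simps)
  then have "x s = - x q" "x r = - x p"
    using w(1) by (simp_all add: eq_neg_iff_add_eq_0 add.commute)
  moreover have "x a = 0" if "a \<notin> V" for a
    using x that by (auto simp: EL_def vectors_on_def)
  ultimately have "x = x p *\<^sub>R b1 + x q *\<^sub>R b2"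
    using ne V by (auto simp: fun_eq_iff scaleR_fun_apply b1_def b2_def)
  then show "x \<in> span {b1, b2}"
    by (metis insertI1 insertI2 span_add span_base span_scale)
qed

text \<open>The dimension is \<open>3 * 2 + 2\<close>: three positions other than \<open>s\<close>
  with the two gap eigenvectors, and two exceptional functions. \<open>H r\<close> is left out
  because \<open>H p\<close>, \<open>H q\<close> and \<open>H r\<close> add up to zero.\<close>

lemma dim_ES_cycle:
  assumes conn: "conn V c"
  shows "dim (ES V c (2 * w)) = 8"
proof -
  define K where "K = V - {s}"
  have K: "K = {p, q, r}"
    using V dist by (auto simp: K_def)
  have b12: "b1 \<noteq> b2"
  proof
    assume "b1 = b2"
    then have "b1 p = b2 p"
      by simp
    then show False
      by (simp add: b_values)
  qed
  define I :: "(('a \<times> ('a \<Rightarrow> real)) + 'a) set" where "I = Inl ` (K \<times> {b1, b2}) \<union> Inr ` {p, q}"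
  define g where "g = case_sum (\<lambda>(k, b). lift V k b) H"
  have finI: "finite I"
    by (simp add: I_def K)
  have sumI: "(\<Sum>i\<in>I. F i) = (\<Sum>k\<in>K. \<Sum>b\<in>{b1, b2}. F (Inl (k, b))) + (F (Inr p) + F (Inr q))"
    for F :: "_ \<Rightarrow> (('a \<Rightarrow> 'a) \<Rightarrow> real)"
  proof -
    have "(\<Sum>i\<in>I. F i) = (\<Sum>i\<in>Inl ` (K \<times> {b1, b2}). F i) + (\<Sum>i\<in>Inr ` {p, q}. F i)"
      unfolding I_def by (intro sum.union_disjoint) (auto simp: K)
    also have "(\<Sum>i\<in>Inl ` (K \<times> {b1, b2}). F i) = (\<Sum>k\<in>K. \<Sum>b\<in>{b1, b2}. F (Inl (k, b)))"
      by (subst sum.reindex) (auto simp: sum.cartesian_product)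
    also have "(\<Sum>i\<in>Inr ` {p, q}. F i) = F (Inr p) + F (Inr q)"
      using ne by (subst sum.reindex) auto
    finally show ?thesis .
  qed
  have HS: "H k \<in> vectors_on (Sym V)" for k
    by (auto simp: vectors_on_def H_def)
  have pq: "p \<in> V - {s}" "q \<in> V - {s}"
    using inV ne by auto
  have "dim (ES V c (2 * w)) = card I"
  proof (rule dim_family[OF finI])
    show "g ` I \<subseteq> ES V c (2 * w)"
      using lift_in_ES[OF finV wg b_in_EL(1)] lift_in_ES[OF finV wg b_in_EL(2)]
        ES_if_exceptional[OF exceptional_H HS] pq inV by (auto simp: I_def g_def K)
    show "ES V c (2 * w) \<subseteq> span (g ` I)"
    proof
      fix f assume f: "f \<in> ES V c (2 * w)"
      define h where "h = f - additive_part V f"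
      have subsp: "h \<in> ES V c (2 * w)"
      proof -
        note ap = additive_part_in_ES[OF finV wg f]
        have "Lop V c h \<sigma> = Lop V c f \<sigma> - Lop V c (additive_part V f) \<sigma>" for \<sigma>
          by (simp add: Lop_def h_def algebra_simps sum.distrib sum_subtractf)
        then have "Lop V c h \<sigma> = 2 * (2 * w) * h \<sigma>" if "\<sigma> \<in> Sym V" for \<sigma>
          using f ap that by (simp add: ES_def h_def right_diff_distrib)
        moreover have "h \<in> vectors_on (Sym V)"
          unfolding h_def using f ap by (intro subspace_diff[OF subspace_vectors_on]) (simp_all add: ES_def)
        ultimately show ?thesis
          by (simp add: ES_def)
      qed
      have "zero_marg V (\<lambda>\<sigma>. f \<sigma> - proj V f \<sigma>)"
        by (rule zero_marg_diff_proj[OF finV _ ES_sum_zero[OF finV f]]) (use w cardV in auto)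
      moreover have "marg V h k a = marg V (\<lambda>\<sigma>. f \<sigma> - proj V f \<sigma>) k a" for k a
        unfolding marg_def by (intro sum.cong) (auto simp: h_def additive_part_def)
      ultimately have "zero_marg V h"
        by (simp add: zero_marg_def)
      then have ex: "exceptional h"
        by (rule exceptional_if_ES[OF subsp _ conn])
      \<comment> \<open>By \<open>H_values\<close> the functions \<open>H p\<close> and
        \<open>H q\<close> are diagonal at \<open>id\<close> and \<open>cyc p q r\<close>, with
        entries -1 and 1, which dictates the coefficients.\<close>
      define e where "e = (\<lambda>\<sigma>. h \<sigma> - (- h id) * H p \<sigma> - h (cyc p q r) * H q \<sigma>)"
      have "exceptional e"
        unfolding e_def by (intro exceptional_diff ex exceptional_H pq)
      moreover have "e id = 0" "e (cyc p q r) = 0"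
        by (simp_all add: e_def H_values)
      ultimately have e0: "e \<sigma> = 0" if "\<sigma> permutes V" for \<sigma>
        using exceptional_zero that by blast
      have "h \<sigma> = ((- h id) *\<^sub>R H p + h (cyc p q r) *\<^sub>R H q) \<sigma>" for \<sigma>
      proof (cases "\<sigma> permutes V")
        case True
        then show ?thesis
          using e0[OF True] by (simp add: e_def scaleR_fun_apply)
      next
        case False
        then show ?thesis
          using subsp by (simp add: scaleR_fun_apply ES_def vectors_on_def H_def)
      qed
      then have "h = (- h id) *\<^sub>R H p + h (cyc p q r) *\<^sub>R H q"
        by (rule ext)
      moreover have "H p \<in> g ` I" "H q \<in> g ` I"
        by (force simp: I_def g_def)+
      ultimately have hs: "h \<in> span (g ` I)"
        by (metis span_add span_base span_scale)
      have "additive_part V f \<in> span ((\<lambda>(k, b). lift V k b) ` (K \<times> {b1, b2}))"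
        unfolding K_def by (rule additive_part_in_span[OF finV wg inV(4) f _ _ EL_span]) (use w in auto)
      moreover have "(\<lambda>(k, b). lift V k b) ` (K \<times> {b1, b2}) \<subseteq> g ` I"
        by (force simp: I_def g_def)
      ultimately have "additive_part V f \<in> span (g ` I)"
        using span_mono by blast
      then have "h + additive_part V f \<in> span (g ` I)"
        by (intro span_add hs)
      then show "f \<in> span (g ` I)"
        by (simp add: h_def)
    qed
    fix a i assume a: "(\<Sum>i\<in>I. a i *\<^sub>R g i) = 0" and i: "i \<in> I"
    define y where "y k x = a (Inl (k, b1)) * b1 x + a (Inl (k, b2)) * b2 x" for k x
    define e where "e \<sigma> = a (Inr p) * H p \<sigma> + a (Inr q) * H q \<sigma>" for \<sigma>
    have rel: "(\<Sum>k\<in>K. y k (\<sigma> k)) + e \<sigma> = 0" if "\<sigma> permutes V" for \<sigma>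
    proof -
      have "0 = (\<Sum>i\<in>I. a i *\<^sub>R g i) \<sigma>"
        using a by simp
      also have "\<dots> = (\<Sum>k\<in>K. y k (\<sigma> k)) + e \<sigma>"
        unfolding sumI using b12 that
        by (simp add: sum_fun_apply scaleR_fun_apply g_def lift_def y_def e_def)
      finally show ?thesis by simp
    qed
    \<comment> \<open>Starting with the zero function \<open>H p - 1 * H p\<close> brings the
      combination into the form of \<open>exceptional_diff\<close>.\<close>
    have "exceptional (\<lambda>\<sigma>. H p \<sigma> - 1 * H p \<sigma> - (- a (Inr p)) * H p \<sigma> - (- a (Inr q)) * H q \<sigma>)"
      by (intro exceptional_diff exceptional_H pq)
    then have exe: "exceptional e"
      by (simp add: e_def[abs_def])
    \<comment> \<open>By \<open>rel\<close> the function \<open>e\<close> is the negative of an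
      additive one, here extended by 0 at \<open>s\<close> to run over all of V. Being exceptional
      as well, it vanishes.\<close>
    have "square_alt V (\<lambda>\<sigma>. \<Sum>k\<in>V. (if k = s then 0 else - y k (\<sigma> k)))"
      by (rule square_alt_additive[of V "\<lambda>k x. if k = s then 0 else - y k x"])
    moreover have "(\<Sum>k\<in>V. (if k = s then 0 else - y k (\<sigma> k))) = - (\<Sum>k\<in>K. y k (\<sigma> k))" for \<sigma>
      unfolding sumV K using ne by simp
    ultimately have "square_alt V e"
      using rel by (intro square_alt_cong[of V e "\<lambda>\<sigma>. - (\<Sum>k\<in>K. y k (\<sigma> k))"]) (auto simp: eq_neg_iff_add_eq_0 add.commute)
    then have e0: "e \<sigma> = 0" if "\<sigma> permutes V" for \<sigma>
      using exceptional_square_alt_zero[OF exe _ that] by blast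
    have aH: "a (Inr p) = 0" "a (Inr q) = 0"
      using e0[OF permutes_id] e0[of "cyc p q r"] inV by (simp_all add: e_def H_values cyc_permutes)
    have "y k = 0" if "k \<in> V - {s}" for k
    proof (rule additive_unique[OF finV inV(4) _ _ _ that])
      fix j assume "j \<in> V - {s}"
      show "y j \<in> vectors_on V"
        using V by (auto simp: vectors_on_def y_def b1_def b2_def)
      show "sum (y j) V = 0"
        unfolding sumV by (simp add: y_def b_values)
    next
      fix \<sigma> assume "\<sigma> permutes V"
      then show "(\<Sum>k\<in>V - {s}. y k (\<sigma> k)) = 0"
        using rel e0 unfolding K_def by force
    qed
    then have "y k p = 0" "y k q = 0" if "k \<in> K" for k
      using that unfolding K_def by auto
    then have "a (Inl (k, b1)) = 0" "a (Inl (k, b2)) = 0" if "k \<in> K" for k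
      using that by (simp_all add: y_def b_values)
    then show "a i = 0"
      using i aH by (auto simp: I_def)
  qed
  also have "card I = 8"
  proof -
    have "card I = card (Inl ` (K \<times> {b1, b2}) :: (('a \<times> ('a \<Rightarrow> real)) + 'a) set) + card (Inr ` {p, q} :: (('a \<times> ('a \<Rightarrow> real)) + 'a) set)"
      unfolding I_def by (intro card_Un_disjoint) (auto simp: K)
    also have "\<dots> = card (K \<times> {b1, b2}) + card {p, q}"
      by (intro arg_cong2[where f="(+)"] card_image) (auto simp: inj_on_def)
    finally show ?thesis
      using b12 ne by (simp add: K card_cartesian_product)
  qed
  finally show ?thesis .
qed

end

section \<open>Translation to the group algebra\<close>

lemma wgraph_if_weighted_graph: "weighted_graph n c \<Longrightarrow> wgraph {1..n} c"
  unfolding weighted_graph_def wgraph_def by blast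

lemma support_edges_iff:
  assumes "weighted_graph n c"
  shows "{u, v} \<in> support_edges n c \<longleftrightarrow> u \<in> {1..n} \<and> v \<in> {1..n} \<and> c u v > 0"
proof
  assume "{u, v} \<in> support_edges n c"
  then obtain i j where ij: "{u, v} = {i, j}" "1 \<le> i" "i < j" "j \<le> n" "0 < c i j"
    unfolding support_edges_def by blast
  moreover have "c j i = c i j"
    using assms ij unfolding weighted_graph_def by simp
  ultimately show "u \<in> {1..n} \<and> v \<in> {1..n} \<and> c u v > 0"
    by (auto simp: doubleton_eq_iff)
next
  assume *: "u \<in> {1..n} \<and> v \<in> {1..n} \<and> c u v > 0"
  have "u \<noteq> v"
    using * assms unfolding weighted_graph_def by force
  moreover have "c v u = c u v"
    using assms * unfolding weighted_graph_def by simp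
  moreover have "{u, v} = {v, u}"
    by auto
  moreover have edge: "{i, j} \<in> support_edges n c" if "1 \<le> i" "i < j" "j \<le> n" "0 < c i j" for i j
    unfolding support_edges_def using that by blast
  ultimately show "{u, v} \<in> support_edges n c"
    using * edge[of u v] edge[of v u] by (cases "u < v") simp_all
qed

lemma conn_if_connected_graph:
  assumes w: "weighted_graph n c" and conn: "connected_graph n c"
  shows "conn {1..n} c"
  unfolding conn_def
proof (intro allI impI)
  fix A assume A: "A \<noteq> {} \<and> A \<subset> {1..n}"
  then obtain a b where ab: "a \<in> A" "b \<in> {1..n} - A"
    by blast
  show "\<exists>i\<in>A. \<exists>j\<in>{1..n} - A. c i j > 0"
  proof (rule ccontr)
    assume no: "\<not> ?thesis"
    have "(a, b) \<in> {(u, v). {u, v} \<in> support_edges n c}\<^sup>*"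
      using conn ab A unfolding connected_graph_def by blast
    then have "b \<in> A"
    proof (induction rule: rtrancl_induct)
      case (step x y)
      then have "y \<in> {1..n}" "c x y > 0"
        using support_edges_iff[OF w, of x y] by simp_all
      then show ?case
        using no step.IH by blast
    qed (rule ab(1))
    then show False
      using ab by simp
  qed
qed

lemma uniform_four_cycle_iff:
  assumes w: "weighted_graph n c"
  shows "uniform_four_cycle n c \<longleftrightarrow> uniform_C4 {1..n} c"
proof
  assume u: "uniform_four_cycle n c"
  then have n: "n = 4"
    by (simp add: uniform_four_cycle_def)
  obtain p q r s where d: "distinct [p, q, r, s]"
    and E: "support_edges n c = {{p, q}, {q, r}, {r, s}, {s, p}}"
    using u unfolding uniform_four_cycle_def by (elim conjE exE) (rule that; assumption)
  obtain t where t: "t > 0" "\<forall>i\<in>{1..n}. \<forall>j\<in>{1..n}. {i, j} \<in> support_edges n c \<longrightarrow> c i j = t"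
    using u unfolding uniform_four_cycle_def by (elim conjE exE) (rule that; assumption)
  have e: "{p, q} \<in> support_edges n c" "{q, r} \<in> support_edges n c" "{r, s} \<in> support_edges n c"
    "{s, p} \<in> support_edges n c"
    unfolding E by simp_all
  then have inV: "p \<in> {1..n}" "q \<in> {1..n}" "r \<in> {1..n}" "s \<in> {1..n}"
    using support_edges_iff[OF w] by blast+
  have "{p, q, r, s} = {1..n}"
    using inV d by (intro card_subset_eq) (auto simp: n)
  moreover have "c p q = t" "c q r = t" "c r s = t" "c s p = t"
    using t(2) e inV by blast+
  moreover have "c p r = 0" "c q s = 0"
  proof -
    have "{p, r} \<notin> support_edges n c" "{q, s} \<notin> support_edges n c"
      using d unfolding E by (auto simp: doubleton_eq_iff)
    then have "\<not> c p r > 0" "\<not> c q s > 0"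
      using support_edges_iff[OF w] inV by blast+
    moreover have "c p r \<ge> 0" "c q s \<ge> 0"
      using w inV unfolding weighted_graph_def by blast+
    ultimately show "c p r = 0" "c q s = 0"
      by simp_all
  qed
  ultimately show "uniform_C4 {1..n} c"
    unfolding uniform_C4_def using d t(1) by metis
next
  assume "uniform_C4 {1..n} c"
  then obtain p q r s t where d: "distinct [p, q, r, s]" and V: "{1..n} = {p, q, r, s}" and t: "t > 0"
    and c: "c p q = t" "c q r = t" "c r s = t" "c s p = t" "c p r = 0" "c q s = 0"
    unfolding uniform_C4_def by blast
  have wg: "wgraph {p, q, r, s} c"
    using wgraph_if_weighted_graph[OF w] unfolding V .
  have sym: "c q p = t" "c r q = t" "c s r = t" "c p s = t" "c r p = 0" "c s q = 0"
    using wgraph_sym[OF wg, of q p] wgraph_sym[OF wg, of r q] wgraph_sym[OF wg, of s r]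
      wgraph_sym[OF wg, of p s] wgraph_sym[OF wg, of r p] wgraph_sym[OF wg, of s q] c by auto
  have diag: "c p p = 0" "c q q = 0" "c r r = 0" "c s s = 0"
    using w V unfolding weighted_graph_def by auto
  have "n = card {1..n}"
    by simp
  also have "\<dots> = 4"
    unfolding V using d by simp
  finally have n: "n = 4" .
  have ne: "p \<noteq> q" "p \<noteq> r" "p \<noteq> s" "q \<noteq> r" "q \<noteq> s" "r \<noteq> s" "q \<noteq> p" "r \<noteq> p" "s \<noteq> p" "r \<noteq> q" "s \<noteq> q" "s \<noteq> r"
    using d by auto
  have supp: "{i, j} \<in> support_edges n c \<longleftrightarrow> i \<in> {p, q, r, s} \<and> j \<in> {p, q, r, s} \<and> c i j > 0" for i j
    using support_edges_iff[OF w, of i j] unfolding V .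
  \<comment> \<open>For \<open>i = j\<close> the pair collapses to a singleton, a form in which
    \<open>supp\<close> does not apply.\<close>
  have loops: "{i} \<in> support_edges n c \<longleftrightarrow> i \<in> {p, q, r, s} \<and> c i i > 0" for i
    using supp[of i i] by simp
  have edge: "{i, j} \<in> support_edges n c \<longleftrightarrow> {i, j} \<in> {{p, q}, {q, r}, {r, s}, {s, p}}" for i j
  proof (cases "i \<in> {p, q, r, s} \<and> j \<in> {p, q, r, s}")
    case True
    then show ?thesis
      by (elim conjE insertE emptyE; simp add: supp loops ne c sym diag t doubleton_eq_iff)
  next
    case False
    then have "{i, j} \<notin> support_edges n c"
      unfolding supp by blast
    moreover have "{i, j} \<notin> {{p, q}, {q, r}, {r, s}, {s, p}}"
      using False by (auto simp: doubleton_eq_iff)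
    ultimately show ?thesis
      by simp
  qed
  have "support_edges n c = {{p, q}, {q, r}, {r, s}, {s, p}}"
  proof (intro subset_antisym subsetI)
    fix X assume X: "X \<in> support_edges n c"
    then obtain i j where "X = {i, j}"
      unfolding support_edges_def by blast
    then show "X \<in> {{p, q}, {q, r}, {r, s}, {s, p}}"
      using X edge by simp
  next
    fix X assume X: "X \<in> {{p, q}, {q, r}, {r, s}, {s, p}}"
    then obtain i j where "X = {i, j}"
      by blast
    then show "X \<in> support_edges n c"
      using X edge by simp
  qed
  moreover have "c i j = t" if "{i, j} \<in> support_edges n c" for i j
    using that unfolding edge by (auto simp: doubleton_eq_iff c sym)
  ultimately show "uniform_four_cycle n c"
    unfolding uniform_four_cycle_def using n d t by blast
qed

lemma graph_laplacian_eq: "graph_laplacian n c = lapl {1..n} c"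
proof (intro ext)
  fix x i
  have "(\<Sum>j\<in>{1..n} - {i}. c i j * (x i - x j)) = (\<Sum>j\<in>{1..n}. c i j * (x i - x j))"
    by (intro sum.mono_neutral_left) auto
  then show "graph_laplacian n c x i = lapl {1..n} c x i"
    by (simp add: graph_laplacian_def lapl_def lap_def)
qed

lemma sum_upper_triangle:
  fixes h :: "nat \<Rightarrow> nat \<Rightarrow> real"
  assumes "\<And>i j. i \<in> {1..n} \<Longrightarrow> j \<in> {1..n} \<Longrightarrow> h i j = h j i" "\<And>i. i \<in> {1..n} \<Longrightarrow> h i i = 0"
  shows "(\<Sum>i=1..n. \<Sum>j=Suc i..n. h i j) = (\<Sum>i\<in>{1..n}. \<Sum>j\<in>{1..n}. h i j) / 2"
proof -
  have "(\<Sum>i\<in>{1..n}. \<Sum>j\<in>{1..n}. h i j) =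
      (\<Sum>i\<in>{1..n}. \<Sum>j\<in>{1..n}. (if i < j then h i j else 0) + (if j < i then h i j else 0))"
    using assms(2) by (intro sum.cong refl) (auto simp: not_less_iff_gr_or_eq)
  also have "\<dots> = (\<Sum>i\<in>{1..n}. \<Sum>j\<in>{1..n}. if i < j then h i j else 0) +
      (\<Sum>i\<in>{1..n}. \<Sum>j\<in>{1..n}. if j < i then h i j else 0)"
    by (simp only: sum.distrib)
  also have "(\<Sum>i\<in>{1..n}. \<Sum>j\<in>{1..n}. if j < i then h i j else 0) =
      (\<Sum>i\<in>{1..n}. \<Sum>j\<in>{1..n}. if i < j then h i j else 0)"
    using assms(1) by (subst sum.swap) (intro sum.cong refl, auto)
  also have "(\<Sum>i\<in>{1..n}. \<Sum>j\<in>{1..n}. if i < j then h i j else 0) = (\<Sum>i=1..n. \<Sum>j=Suc i..n. h i j)"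
    by (intro sum.cong refl sum.mono_neutral_cong_right) auto
  finally show ?thesis
    by simp
qed

text \<open>Left multiplication by a permutation translates by its inverse, and transpositions are
  their own inverses. Halving the sum over ordered pairs gives the sum over \<open>i < j\<close>.
  Outside the group both sides vanish because \<open>f\<close> does.\<close>

lemma interchange_operator_eq:
  assumes w: "weighted_graph n c" and f: "f \<in> group_algebra n"
  shows "interchange_operator n c f = LL {1..n} c f"
proof
  fix \<rho>
  have fin: "finite (sym_group n)"
    by (intro finite_permutations) simp
  have pv: "(\<Sum>\<sigma>\<in>sym_group n. perm_vector \<tau> \<sigma> * f (inv \<sigma> \<circ> \<rho>)) = f (inv \<tau> \<circ> \<rho>)"
    if "\<tau> permutes {1..n}" for \<tau>
  proof -
    have "(\<Sum>\<sigma>\<in>sym_group n. perm_vector \<tau> \<sigma> * f (inv \<sigma> \<circ> \<rho>)) =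
        (\<Sum>\<sigma>\<in>sym_group n. if \<sigma> = \<tau> then f (inv \<tau> \<circ> \<rho>) else 0)"
      by (intro sum.cong) (auto simp: perm_vector_def)
    then show ?thesis
      using fin that by simp
  qed
  have "interchange_operator n c f \<rho> = (\<Sum>i=1..n. \<Sum>j=Suc i..n. c i j *
      ((\<Sum>\<sigma>\<in>sym_group n. perm_vector id \<sigma> * f (inv \<sigma> \<circ> \<rho>)) - (\<Sum>\<sigma>\<in>sym_group n. perm_vector (swp i j) \<sigma> * f (inv \<sigma> \<circ> \<rho>))))"
  proof -
    have "interchange_operator n c f \<rho> = (\<Sum>\<sigma>\<in>sym_group n. \<Sum>i=1..n. \<Sum>j=Suc i..n.
        c i j * (perm_vector id \<sigma> * f (inv \<sigma> \<circ> \<rho>) - perm_vector (swp i j) \<sigma> * f (inv \<sigma> \<circ> \<rho>)))"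
      unfolding interchange_operator_def ga_mult_def interchange_element_def sum_fun_apply scaleR_fun_apply
        sum_distrib_right by (simp add: algebra_simps)
    also have "\<dots> = (\<Sum>i=1..n. \<Sum>j=Suc i..n. \<Sum>\<sigma>\<in>sym_group n.
        c i j * (perm_vector id \<sigma> * f (inv \<sigma> \<circ> \<rho>) - perm_vector (swp i j) \<sigma> * f (inv \<sigma> \<circ> \<rho>)))"
      by (subst sum.swap) (intro sum.cong refl sum.swap)
    finally show ?thesis
      by (simp add: sum_distrib_left[symmetric] sum_subtractf)
  qed
  also have "\<dots> = (\<Sum>i=1..n. \<Sum>j=Suc i..n. c i j * (f \<rho> - f (swp i j \<circ> \<rho>)))"
  proof (intro sum.cong refl)
    fix i j assume "i \<in> {1..n}" "j \<in> {Suc i..n}"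
    then have "swp i j permutes {1..n}"
      by (intro permutes_swap_id) auto
    then show "c i j * ((\<Sum>\<sigma>\<in>sym_group n. perm_vector id \<sigma> * f (inv \<sigma> \<circ> \<rho>)) -
        (\<Sum>\<sigma>\<in>sym_group n. perm_vector (swp i j) \<sigma> * f (inv \<sigma> \<circ> \<rho>))) = c i j * (f \<rho> - f (swp i j \<circ> \<rho>))"
      by (simp only: pv permutes_id inv_id inv_transpose_eq id_o)
  qed
  also have "\<dots> = LL {1..n} c f \<rho>"
  proof (cases "\<rho> \<in> sym_group n")
    case True
    have "(\<Sum>i=1..n. \<Sum>j=Suc i..n. c i j * (f \<rho> - f (swp i j \<circ> \<rho>))) = Lop {1..n} c f \<rho> / 2"
      unfolding Lop_def using w
      by (intro sum_upper_triangle) (auto simp: weighted_graph_def transpose_commute)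
    then show ?thesis
      using True by (simp add: LL_def)
  next
    case False
    have "f (swp i j \<circ> \<rho>) = 0" if "i \<in> {1..n}" "j \<in> {1..n}" for i j
    proof -
      have "\<not> swp i j \<circ> \<rho> permutes {1..n}"
      proof
        assume "swp i j \<circ> \<rho> permutes {1..n}"
        then have "swp i j \<circ> (swp i j \<circ> \<rho>) permutes {1..n}"
          using permutes_swap_id[OF that] by (rule permutes_compose)
        then show False
          using False by (simp add: o_assoc)
      qed
      then show ?thesis
        using f by (simp add: vectors_on_def)
    qed
    then have "(\<Sum>i=1..n. \<Sum>j=Suc i..n. c i j * (f \<rho> - f (swp i j \<circ> \<rho>))) = 0"
      using f False by (intro sum.neutral ballI) (auto simp: vectors_on_def)
    then show ?thesis
      using False by (simp add: LL_def)
  qed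
  finally show "interchange_operator n c f \<rho> = LL {1..n} c f \<rho>" .
qed

text \<open>Eigenspaces only test vectors of V, so agreement there is enough;
  \<open>interchange_operator_eq\<close> provides no more.\<close>

lemma second_eigenvalue_mult_cong:
  assumes "\<And>v. v \<in> V \<Longrightarrow> T v = T' v"
  shows "second_eigenvalue_mult V T = second_eigenvalue_mult V T'"
proof -
  have "eigenspace_on V T = eigenspace_on V T'"
    using assms by (auto simp: eigenspace_on_def fun_eq_iff)
  then show ?thesis
    by (simp add: second_eigenvalue_mult_def second_eigenvalue_def eigenvalue_list_def
        eigenvalue_mult_def eigenvalues_on_def)
qed

theorem corollary2p5:
  fixes n :: nat and c :: "nat \<Rightarrow> nat \<Rightarrow> real"
  assumes "n \<ge> 2"
    and "weighted_graph n c"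
    and "connected_graph n c"
  shows "(uniform_four_cycle n c \<longrightarrow>
            second_eigenvalue_mult (group_algebra n) (interchange_operator n c) = 8) \<and>
         (\<not> uniform_four_cycle n c \<longrightarrow>
            second_eigenvalue_mult (group_algebra n) (interchange_operator n c) =
            (n - 1) * second_eigenvalue_mult (vectors_on {1..n}) (graph_laplacian n c))"
proof -
  define V where "V = {1..n}"
  have V: "finite V" "card V = n" "card V \<ge> 2"
    using assms(1) by (simp_all add: V_def)
  have wg: "wgraph V c"
    unfolding V_def by (rule wgraph_if_weighted_graph[OF assms(2)])
  have conn: "conn V c"
    unfolding V_def by (rule conn_if_connected_graph[OF assms(2,3)])
  have L: "second_eigenvalue_mult (group_algebra n) (interchange_operator n c) =
      second_eigenvalue_mult (vectors_on (Sym V)) (LL V c)"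
    unfolding V_def by (rule second_eigenvalue_mult_cong[OF interchange_operator_eq[OF assms(2)]])
  \<comment> \<open>A gap bound that is also an eigenvalue of the Laplacian is the second eigenvalue
    of both operators, so one l turns both multiplicities into dimensions of \<open>ES\<close> and
    \<open>EL\<close>.\<close>
  have mult: "second_eigenvalue_mult (vectors_on (Sym V)) (LL V c) = dim (ES V c l)"
    "second_eigenvalue_mult (vectors_on V) (lapl V c) = dim (EL V c l)"
    if "gap_ge V c l" "l > 0" "x \<in> EL V c l" "x \<noteq> 0" for l x
    unfolding second_eigenvalue_mult_def second_eigenvalue_ES[OF V(1) wg that]
      second_eigenvalue_EL[OF V(1) wg that] eigenvalue_mult_def eigenspace_LL eigenspace_lapl
    by (rule refl)+
  have "second_eigenvalue_mult (vectors_on (Sym V)) (LL V c) = 8" if u: "uniform_C4 V c"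
  proof -
    obtain p q r s w where u': "V = {p, q, r, s}" "distinct [p, q, r, s]" "w > 0" "c p q = w" "c q r = w"
      "c r s = w" "c s p = w" "c p r = 0" "c q s = 0"
      using u unfolding uniform_C4_def by blast
    interpret uniform_cycle V c p q r s w
      by standard (use u' wg in auto)
    have "b1 \<noteq> 0"
      using b_values(1) by (metis zero_fun_apply zero_neq_one)
    then show ?thesis
      using mult(1)[OF gap _ b_in_EL(1)] dim_ES_cycle[OF conn] u'(3) by simp
  qed
  moreover have "second_eigenvalue_mult (vectors_on (Sym V)) (LL V c) =
      (n - 1) * second_eigenvalue_mult (vectors_on V) (lapl V c)" if nu: "\<not> uniform_C4 V c"
  proof -
    obtain l x where l: "l > 0" "gap_ge V c l" and x: "\<And>i. i \<notin> V \<Longrightarrow> x i = 0" "sum x V = 0"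
      "(\<Sum>i\<in>V. (x i)\<^sup>2) = 1" "\<And>a. a \<in> V \<Longrightarrow> lap V c x a = 2 * l * x a"
      using gap_attained[OF V(1,3) wg conn] by blast
    have "x \<in> EL V c l"
      using x by (simp add: EL_def vectors_on_def)
    moreover have "x \<noteq> 0"
      using x(3) by auto
    ultimately show ?thesis
      using mult[OF l(2,1)] dim_ES[OF V(1,3) wg conn l(2,1) nu] V(2) by simp
  qed
  ultimately show ?thesis
    unfolding L uniform_four_cycle_iff[OF assms(2)] graph_laplacian_eq V_def by blast
qed

end
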